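(* Let $N\ge 2$ be an integer and let $\theta(\alpha,\beta)$ be the percolation probability of long-range percolation on the hierarchical lattice $\Omega_N$. Then the function $(\alpha,\beta)\mapsto\theta(\alpha,\beta)$ is continuous at every point $(\alpha,\beta)$ with $\alpha>0$ and $\beta>0$.
   Context: For an integer $N\ge 2$, the hierarchical lattice of order $N$ is the countable set $\Omega_N=\{\mathbf x=(x_1,x_2,\ldots): x_i\in\{0,1,\ldots,N-1\},\ \sum_i x_i<\infty\}$ with the (ultra)metric $d(\mathbf x,\mathbf x)=0$ and $d(\mathbf x,\mathbf y)=\max\{i: x_i\ne y_i\}$ for $\mathbf x\ne \mathbf y$. Write $0$ for the all-zero sequence. Long-range percolation on $\Omega_N$ with parameters $0\le\alpha<\infty$ and $0<\beta<\infty$: each unordered pair of distinct vertices $x,y\in\Omega_N$ is, independently of all other pairs, joined by an (undirected) edge with probability $p_k=1-\exp(-\alpha/\beta^{k})$, where $k=d(x,y)$. The law is denoted $\mathbb P_{\alpha,\beta}$. The cluster $\mathcal C(x)$ is the connected component of $x$ in the resulting random graph (all vertices reachable from $x$ by finite paths of present edges). The percolation probability is $\theta(\alpha,\beta)=\mathbb P_{\alpha,\beta}(|\mathcal C(0)|=\infty)$. *)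

theory Defs
  imports "HOL-Probability.Probability"
begin

text \<open>
  Coordinates are numbered from \<open>1\<close>, so position \<open>0\<close> is unused and fixed to \<open>0\<close>.  For sequences of
  natural numbers, convergence of the sum of the entries means finite support.
\<close>

definition hier_lattice :: "nat \<Rightarrow> (nat \<Rightarrow> nat) set" where
  "hier_lattice N = {x. x 0 = 0 \<and> (\<forall>i\<ge>1. x i \<in> {0..<N}) \<and> finite {i. x i \<noteq> 0}}"

definition hier_dist :: "(nat \<Rightarrow> nat) \<Rightarrow> (nat \<Rightarrow> nat) \<Rightarrow> nat" where
  "hier_dist x y = (if x = y then 0 else Max {i. x i \<noteq> y i})"

definition vertex_pairs :: "nat \<Rightarrow> (nat \<Rightarrow> nat) set set" where
  "vertex_pairs N = {{x, y} |x y. x \<in> hier_lattice N \<and> y \<in> hier_lattice N \<and> x \<noteq> y}"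

definition pair_dist :: "(nat \<Rightarrow> nat) set \<Rightarrow> nat" where
  "pair_dist e = (THE k. \<exists>x y. e = {x, y} \<and> k = hier_dist x y)"

lemma hier_dist_commute: "hier_dist x y = hier_dist y x"
  by (simp add: hier_dist_def eq_commute)

lemma pair_dist_insert [simp]: "pair_dist {x, y} = hier_dist x y"
  unfolding pair_dist_def
  by (rule the_equality) (auto simp: doubleton_eq_iff hier_dist_commute)

definition edge_prob :: "real \<Rightarrow> real \<Rightarrow> nat \<Rightarrow> real" where
  "edge_prob \<alpha> \<beta> k = 1 - exp (- \<alpha> / \<beta> ^ k)"

text \<open>
  A configuration assigns to every unordered pair of distinct vertices whether it is an edge.
  \<open>bernoulli_pmf\<close> is only meaningful for parameters in \<open>[0, 1]\<close>, which holds for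
  \<open>0 \<le> \<alpha>\<close> and \<open>0 < \<beta>\<close>.
\<close>

definition percolation :: "nat \<Rightarrow> real \<Rightarrow> real \<Rightarrow> ((nat \<Rightarrow> nat) set \<Rightarrow> bool) measure" where
  "percolation N \<alpha> \<beta> =
     (\<Pi>\<^sub>M e\<in>vertex_pairs N. measure_pmf (bernoulli_pmf (edge_prob \<alpha> \<beta> (pair_dist e))))"

definition adjacency :: "nat \<Rightarrow> ((nat \<Rightarrow> nat) set \<Rightarrow> bool) \<Rightarrow> (nat \<Rightarrow> nat) rel" where
  "adjacency N \<omega> = {(x, y). {x, y} \<in> vertex_pairs N \<and> \<omega> {x, y}}"

definition cluster :: "nat \<Rightarrow> ((nat \<Rightarrow> nat) set \<Rightarrow> bool) \<Rightarrow> (nat \<Rightarrow> nat) \<Rightarrow> (nat \<Rightarrow> nat) set" where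
  "cluster N \<omega> x = {y. (x, y) \<in> (adjacency N \<omega>)\<^sup>*}"

definition percolation_prob :: "nat \<Rightarrow> real \<Rightarrow> real \<Rightarrow> real" where
  "percolation_prob N \<alpha> \<beta> =
     measure (percolation N \<alpha> \<beta>)
       {\<omega> \<in> space (percolation N \<alpha> \<beta>). infinite (cluster N \<omega> (\<lambda>_. 0))}"

end

theory Submission
  imports Defs
begin

text \<open>
  Only events that depend on finitely many edges enter the estimates; their probabilities are
  polynomials in the edge probabilities, hence continuous in \<open>(\<alpha>, \<beta>)\<close>.

  Upper semicontinuity: for \<open>\<beta> \<le> N\<close> the origin has infinitely many neighbours almost surely, so
  \<open>\<theta> = 1\<close>.  For \<open>\<beta> > N\<close> the expected number of edges leaving a fixed ball is summable over the
  distance, locally uniformly in the parameters, so the probability that the cluster of the origin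
  stays in a given ball is approximated from below by continuous functions.

  Lower semicontinuity: suppose \<open>\<theta> > 0\<close>.
  Inside the ball of radius \<open>n\<close> the cluster of the origin has, with probability at least
  \<open>\<theta> - \<epsilon>\<close>, size at least \<open>A (max 1 \<beta> / N) ^ n\<close> for every constant \<open>A\<close>, since a smaller cluster
  could not be left with probability bounded below.  In particular \<open>max 1 \<beta> < N ^ 2\<close>.
  By transitivity a positive fraction of the vertices of two sibling balls lies in such clusters.
  If their union had no component of positive density, then
  grouping components into two balanced halves would exhibit order \<open>N ^ (2 n)\<close> closed edges between
  the balls for one of at most \<open>exp (2 N ^ n / (A (max 1 \<beta> / N) ^ n))\<close> groupings, which is unlikely
  when \<open>A\<close> is large.  Hence a component of positive density exists with probability bounded below,
  and by independence of many subballs with probability close to one.  From such a scale on, a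
  renormalisation with blocks of \<open>N ^ L\<close> subballs propagates the dense component and the attachment
  of the origin to it through all larger scales, using only finitely many strict inequalities at the
  initial scale; these persist for nearby parameters.
\<close>


section \<open>Events determined by finitely many edges\<close>

text \<open>The order \<open>(b1 / N) ^ n\<close>, with \<open>b1 = max 1 b\<close>, matters for
  three reasons. For \<open>N < b\<close>, a cluster of size \<open>s\<close> in a ball of radius
  \<open>n\<close> has at most of order \<open>s * (N / b) ^ n\<close> expected edges to the
  outside, so below this order it stays inside with a probability that does not decay. A cluster of
  size \<open>A * (b1 / N) ^ n\<close> misses a disjoint one of size \<open>c * N ^ n\<close> in the
  same ball of radius \<open>n + L\<close> with probability at most
  \<open>exp (- a * A * c / b1 ^ L)\<close>, whatever \<open>n\<close> is. Finally, clusters of that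
  size number at most \<open>(N ^ 2 / b1) ^ n / A\<close> in a ball, while a balanced cut
  contributes a fixed multiple of \<open>(N ^ 2 / b1) ^ n\<close> to the exponent; a large
  \<open>A\<close> lets energy beat entropy. The obstacle to lower semicontinuity is the need for a
  criterion at one finite scale. The renormalisation does not keep the density of the large cluster:
  its size grows by \<open>N ^ L - 1\<close> while the ball grows by \<open>N ^ L\<close>. This is
  harmless as long as \<open>(N ^ L - 1) ^ 2\<close> exceeds \<open>b1 ^ L\<close> by a factor 2.
  Conditioning on a cluster is always a finite sum over its possible values.\<close>

type_synonym vertex = "nat \<Rightarrow> nat"
type_synonym config = "vertex set \<Rightarrow> bool"

text \<open>The value type is arbitrary, so that random sets such as clusters are treated like
  events and can be summed over when conditioning.\<close>

definition determined_by :: "vertex set set \<Rightarrow> (config \<Rightarrow> 'c) \<Rightarrow> bool" where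
  "determined_by A f \<longleftrightarrow> (\<forall>\<omega> \<omega>'. (\<forall>e\<in>A. \<omega> e = \<omega>' e) \<longrightarrow> f \<omega> = f \<omega>')"

lemma determined_by_mono: "determined_by A f \<Longrightarrow> A \<subseteq> B \<Longrightarrow> determined_by B f"
  unfolding determined_by_def by blast

lemma determined_by_comp: "determined_by A f \<Longrightarrow> determined_by A (\<lambda>\<omega>. h (f \<omega>))"
  unfolding determined_by_def by metis

lemma determined_by_comp2:
  "determined_by A f \<Longrightarrow> determined_by A g \<Longrightarrow> determined_by A (\<lambda>\<omega>. h (f \<omega>) (g \<omega>))"
  unfolding determined_by_def by metis

lemma determined_by_conj_Un:
  "determined_by A P \<Longrightarrow> determined_by B Q \<Longrightarrow> determined_by (A \<union> B) (\<lambda>\<omega>. P \<omega> \<and> Q \<omega>)"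
  unfolding determined_by_def by (metis UnI1 UnI2)

lemma determined_by_D:
  "determined_by A f \<Longrightarrow> (\<And>e. e \<in> A \<Longrightarrow> \<omega> e = \<omega>' e) \<Longrightarrow> f \<omega> = f \<omega>'"
  unfolding determined_by_def by metis

lemma determined_by_bex:
  assumes "\<And>i. i \<in> I \<Longrightarrow> determined_by A (P i)"
  shows "determined_by A (\<lambda>\<omega>. \<exists>i\<in>I. P i \<omega>)"
  unfolding determined_by_def
proof (intro allI impI)
  fix \<omega> \<omega>' :: config assume *: "\<forall>e\<in>A. \<omega> e = \<omega>' e"
  have "P i \<omega> = P i \<omega>'" if "i \<in> I" for i
    by (rule determined_by_D[OF assms[OF that]]) (use * in blast)
  then show "(\<exists>i\<in>I. P i \<omega>) = (\<exists>i\<in>I. P i \<omega>')" by (rule bex_cong[OF refl])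
qed

text \<open>For finite \<open>A\<close> and \<open>S\<close> inside it: the probability that
  precisely the edges of \<open>S\<close> are open among those of \<open>A\<close>.\<close>

definition weight :: "(vertex set \<Rightarrow> real) \<Rightarrow> vertex set set \<Rightarrow> vertex set set \<Rightarrow> real" where
  "weight p A S = (\<Prod>e\<in>A. if e \<in> S then p e else 1 - p e)"

definition pr :: "nat \<Rightarrow> real \<Rightarrow> real \<Rightarrow> (config \<Rightarrow> bool) \<Rightarrow> real" where
  "pr N a b P = measure (percolation N a b) {\<omega> \<in> space (percolation N a b). P \<omega>}"

locale percolation_model =
  fixes N :: nat and a b :: real
  assumes N_ge_2: "2 \<le> N" and a_pos: "0 < a" and b_pos: "0 < b"
begin

abbreviation "V \<equiv> hier_lattice N"
abbreviation "E \<equiv> vertex_pairs N"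
abbreviation "\<PP> \<equiv> percolation N a b"
abbreviation "Pr \<equiv> pr N a b"
abbreviation "p e \<equiv> edge_prob a b (pair_dist e)"

lemma edge_prob_bounds: "0 \<le> edge_prob a b k" "edge_prob a b k \<le> 1"
  using a_pos b_pos by (simp_all add: edge_prob_def)

sublocale prob_space \<PP>
  unfolding percolation_def by (intro prob_space_PiM prob_space_measure_pmf)

lemma space_percolation: "space \<PP> = E \<rightarrow>\<^sub>E UNIV"
  by (simp add: percolation_def space_PiM)

lemma edge_event_sets:
  assumes "e \<in> E" shows "{\<omega> \<in> space \<PP>. \<omega> e = c} \<in> sets \<PP>"
proof -
  have "(\<lambda>\<omega>. \<omega> e) \<in> measurable \<PP> (measure_pmf (bernoulli_pmf (p e)))"
    unfolding percolation_def using assms by (rule measurable_component_singleton)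
  then have "(\<lambda>\<omega>. \<omega> e) \<in> measurable \<PP> (count_space UNIV)" by simp
  from measurable_sets[OF this, of "{c}"] show ?thesis
    by (simp add: vimage_def Collect_conj_eq Int_commute)
qed

lemma cylinder_sets:
  assumes "finite A" "A \<subseteq> E"
  shows "{\<omega> \<in> space \<PP>. \<forall>e\<in>A. \<omega> e = c e} \<in> sets \<PP>"
  using assms
proof (induction A rule: finite_induct)
  case empty then show ?case by simp
next
  case (insert e A)
  then have "{\<omega> \<in> space \<PP>. \<omega> e = c e} \<inter> {\<omega> \<in> space \<PP>. \<forall>e\<in>A. \<omega> e = c e} \<in> sets \<PP>"
    by (intro sets.Int edge_event_sets) auto
  moreover have "{\<omega> \<in> space \<PP>. \<omega> e = c e} \<inter> {\<omega> \<in> space \<PP>. \<forall>e\<in>A. \<omega> e = c e}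
      = {\<omega> \<in> space \<PP>. \<forall>e\<in>insert e A. \<omega> e = c e}" by auto
  ultimately show ?case by simp
qed

lemma prob_cylinder:
  assumes "finite A" "A \<subseteq> E"
  shows "prob {\<omega> \<in> space \<PP>. \<forall>e\<in>A. \<omega> e = (e \<in> S)} = weight p A S"
proof -
  let ?M = "\<lambda>e. measure_pmf (bernoulli_pmf (p e))"
  interpret Q: product_prob_space ?M E
    by (simp add: product_prob_space_def product_prob_space_axioms_def product_sigma_finite_def
        prob_space_measure_pmf prob_space_imp_sigma_finite)
  have "{\<omega> \<in> space \<PP>. \<forall>e\<in>A. \<omega> e = (e \<in> S)} = prod_emb E ?M A (Pi\<^sub>E A (\<lambda>e. {e \<in> S}))"
    using assms(2) unfolding space_percolation prod_emb_PiE[OF assms(2), of "\<lambda>e. {e \<in> S}" ?M, simplified]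
    by (auto simp: PiE_iff extensional_def split: if_splits)
  then have "prob {\<omega> \<in> space \<PP>. \<forall>e\<in>A. \<omega> e = (e \<in> S)} = (\<Prod>e\<in>A. measure (?M e) {e \<in> S})"
    using Q.measure_PiM_emb[OF assms(2,1), of "\<lambda>e. {e \<in> S}"] by (simp add: percolation_def)
  also have "\<dots> = weight p A S"
    unfolding weight_def
    by (intro prod.cong refl) (auto simp: measure_pmf_single edge_prob_bounds)
  finally show ?thesis .
qed

lemma determined_event_eq:
  assumes "determined_by A P"
  shows "{\<omega> \<in> space \<PP>. P \<omega>} =
    (\<Union>S\<in>{S\<in>Pow A. P (\<lambda>e. e \<in> S)}. {\<omega> \<in> space \<PP>. \<forall>e\<in>A. \<omega> e = (e \<in> S)})"
proof (intro equalityI subsetI)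
  fix \<omega> assume \<omega>: "\<omega> \<in> {\<omega> \<in> space \<PP>. P \<omega>}"
  have "P \<omega> = P (\<lambda>e. e \<in> {e\<in>A. \<omega> e})"
    by (rule determined_by_D[OF assms]) auto
  with \<omega> show "\<omega> \<in> (\<Union>S\<in>{S\<in>Pow A. P (\<lambda>e. e \<in> S)}. {\<omega> \<in> space \<PP>. \<forall>e\<in>A. \<omega> e = (e \<in> S)})"
    by (intro UN_I[of "{e\<in>A. \<omega> e}"]) auto
next
  fix \<omega> assume "\<omega> \<in> (\<Union>S\<in>{S\<in>Pow A. P (\<lambda>e. e \<in> S)}. {\<omega> \<in> space \<PP>. \<forall>e\<in>A. \<omega> e = (e \<in> S)})"
  then obtain S where S: "P (\<lambda>e. e \<in> S)" "\<omega> \<in> space \<PP>" "\<forall>e\<in>A. \<omega> e = (e \<in> S)" by auto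
  have "P \<omega> = P (\<lambda>e. e \<in> S)"
    by (rule determined_by_D[OF assms]) (use S in auto)
  with S show "\<omega> \<in> {\<omega> \<in> space \<PP>. P \<omega>}" by simp
qed

lemma determined_event_sets:
  assumes "finite A" "A \<subseteq> E" "determined_by A P"
  shows "{\<omega> \<in> space \<PP>. P \<omega>} \<in> sets \<PP>"
  unfolding determined_event_eq[OF assms(3)]
  using assms(1,2) by (intro sets.finite_UN cylinder_sets) auto

text \<open>A determined event is a disjoint union of cylinders. Independence, invariance under
  isometries and continuity in the parameters are all read off this finite sum.\<close>

lemma pr_eq_sum:
  assumes "finite A" "A \<subseteq> E" "determined_by A P"
  shows "Pr P = (\<Sum>S\<in>{S\<in>Pow A. P (\<lambda>e. e \<in> S)}. weight p A S)"
proof -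
  have "Pr P = (\<Sum>S\<in>{S\<in>Pow A. P (\<lambda>e. e \<in> S)}. prob {\<omega> \<in> space \<PP>. \<forall>e\<in>A. \<omega> e = (e \<in> S)})"
    unfolding pr_def determined_event_eq[OF assms(3)]
    using assms(1,2)
    by (intro finite_measure_finite_Union)
      (auto simp: disjoint_family_on_def intro!: cylinder_sets)
  then show ?thesis using prob_cylinder[OF assms(1,2)] by simp
qed

text \<open>A subset of \<open>A \<union> B\<close> corresponds to the pair of its traces on
  \<open>A\<close> and \<open>B\<close>, and its weight is the product of theirs.\<close>

lemma pr_indep:
  assumes "finite A" "A \<subseteq> E" "determined_by A P"
    and "finite B" "B \<subseteq> E" "determined_by B Q" and "A \<inter> B = {}"
  shows "Pr (\<lambda>\<omega>. P \<omega> \<and> Q \<omega>) = Pr P * Pr Q"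
proof -
  have det: "determined_by (A \<union> B) (\<lambda>\<omega>. P \<omega> \<and> Q \<omega>)"
    by (rule determined_by_conj_Un[OF assms(3,6)])
  have w: "weight p (A \<union> B) (S \<union> T) = weight p A S * weight p B T" if "S \<subseteq> A" "T \<subseteq> B" for S T
  proof -
    have "weight p (A \<union> B) (S \<union> T) = weight p A (S \<union> T) * weight p B (S \<union> T)"
      unfolding weight_def using assms(1,4,7) by (rule prod.union_disjoint)
    moreover have "weight p A (S \<union> T) = weight p A S" "weight p B (S \<union> T) = weight p B T"
      unfolding weight_def using that assms(7) by (auto intro!: prod.cong)
    ultimately show ?thesis by simp
  qed
  have PA: "P (\<lambda>e. e \<in> S) = P (\<lambda>e. e \<in> S \<inter> A)" for S
    by (rule determined_by_D[OF assms(3)]) auto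
  have QB: "Q (\<lambda>e. e \<in> S) = Q (\<lambda>e. e \<in> S \<inter> B)" for S
    by (rule determined_by_D[OF assms(6)]) auto
  have "Pr P * Pr Q = (\<Sum>(S,T)\<in>{S\<in>Pow A. P (\<lambda>e. e \<in> S)} \<times> {T\<in>Pow B. Q (\<lambda>e. e \<in> T)}.
      weight p A S * weight p B T)"
    unfolding pr_eq_sum[OF assms(1-3)] pr_eq_sum[OF assms(4-6)]
    by (simp add: sum_product sum.cartesian_product)
  also have "\<dots> = (\<Sum>S\<in>{S\<in>Pow (A \<union> B). P (\<lambda>e. e \<in> S) \<and> Q (\<lambda>e. e \<in> S)}. weight p (A \<union> B) S)"
  proof (rule sum.reindex_bij_witness[where i="\<lambda>S. (S \<inter> A, S \<inter> B)" and j="\<lambda>(S, T). S \<union> T"])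
    fix x assume "x \<in> {S\<in>Pow A. P (\<lambda>e. e \<in> S)} \<times> {T\<in>Pow B. Q (\<lambda>e. e \<in> T)}"
    then obtain S T where x: "x = (S, T)" "S \<subseteq> A" "T \<subseteq> B" "P (\<lambda>e. e \<in> S)" "Q (\<lambda>e. e \<in> T)"
      by auto
    have i: "(S \<union> T) \<inter> A = S" "(S \<union> T) \<inter> B = T" using x(2,3) assms(7) by auto
    show "((case x of (S, T) \<Rightarrow> S \<union> T) \<inter> A, (case x of (S, T) \<Rightarrow> S \<union> T) \<inter> B) = x"
      using i x(1) by simp
    show "(case x of (S, T) \<Rightarrow> S \<union> T) \<in> {S\<in>Pow (A \<union> B). P (\<lambda>e. e \<in> S) \<and> Q (\<lambda>e. e \<in> S)}"
      using x PA[of "S \<union> T"] QB[of "S \<union> T"] i by auto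
    show "weight p (A \<union> B) (case x of (S, T) \<Rightarrow> S \<union> T) =
        (case x of (S, T) \<Rightarrow> weight p A S * weight p B T)"
      using w x by simp
  next
    fix S assume S: "S \<in> {S\<in>Pow (A \<union> B). P (\<lambda>e. e \<in> S) \<and> Q (\<lambda>e. e \<in> S)}"
    show "(case (S \<inter> A, S \<inter> B) of (S, T) \<Rightarrow> S \<union> T) = S" using S by auto
    show "(S \<inter> A, S \<inter> B) \<in> {S\<in>Pow A. P (\<lambda>e. e \<in> S)} \<times> {T\<in>Pow B. Q (\<lambda>e. e \<in> T)}"
      using S PA[of S] QB[of S] by auto
  qed
  also have "\<dots> = Pr (\<lambda>\<omega>. P \<omega> \<and> Q \<omega>)"
    using pr_eq_sum[OF _ _ det] assms(1,2,4,5) by simp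
  finally show ?thesis by simp
qed

text \<open>Edge probabilities depend on the distance alone, so a distance-preserving relabelling of
  edges carries each weight to an equal one.\<close>

lemma pr_reindex:
  assumes "finite A" "A \<subseteq> E" "determined_by A P" "inj_on h A" "h ` A \<subseteq> E"
    and "\<And>e. e \<in> A \<Longrightarrow> pair_dist (h e) = pair_dist e"
  shows "Pr (\<lambda>\<omega>. P (\<lambda>e. \<omega> (h e))) = Pr P"
proof -
  have det: "determined_by (h ` A) (\<lambda>\<omega>. P (\<lambda>e. \<omega> (h e)))"
    using assms(3) unfolding determined_by_def by auto
  have P: "P (\<lambda>e. h e \<in> h ` S) = P (\<lambda>e. e \<in> S)" if "S \<subseteq> A" for S
    by (rule determined_by_D[OF assms(3)]) (use that assms(4) in \<open>auto simp: inj_on_def\<close>)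
  have "Pr (\<lambda>\<omega>. P (\<lambda>e. \<omega> (h e))) =
      (\<Sum>T\<in>{T\<in>Pow (h ` A). P (\<lambda>e. h e \<in> T)}. weight p (h ` A) T)"
    using pr_eq_sum[OF _ assms(5) det] assms(1) by simp
  also have "{T\<in>Pow (h ` A). P (\<lambda>e. h e \<in> T)} = (`) h ` {S\<in>Pow A. P (\<lambda>e. e \<in> S)}"
    using P by (auto simp: subset_image_iff)
  also have "(\<Sum>T\<in>\<dots>. weight p (h ` A) T) =
      (\<Sum>S\<in>{S\<in>Pow A. P (\<lambda>e. e \<in> S)}. weight p (h ` A) (h ` S))"
    by (rule sum.reindex[unfolded o_def])
      (rule inj_on_subset[OF inj_on_image_Pow[OF assms(4)]], auto)
  also have "\<dots> = (\<Sum>S\<in>{S\<in>Pow A. P (\<lambda>e. e \<in> S)}. weight p A S)"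
  proof (rule sum.cong[OF refl])
    fix S assume "S \<in> {S\<in>Pow A. P (\<lambda>e. e \<in> S)}"
    then have "h e \<in> h ` S \<longleftrightarrow> e \<in> S" if "e \<in> A" for e
      using that assms(4) by (auto simp: inj_on_def)
    then show "weight p (h ` A) (h ` S) = weight p A S"
      unfolding weight_def prod.reindex[OF assms(4)] o_def using assms(6)
      by (intro prod.cong refl) auto
  qed
  also have "\<dots> = Pr P" using pr_eq_sum[OF assms(1-3)] by simp
  finally show ?thesis .
qed

text \<open>The form of \<open>edge_prob\<close> turns a product over closed edges into the
  exponential of a sum. All later bounds on closed edges start from this identity.\<close>

lemma pr_closed:
  assumes "finite F" "F \<subseteq> E"
  shows "Pr (\<lambda>\<omega>. \<forall>e\<in>F. \<not> \<omega> e) = exp (- a * (\<Sum>e\<in>F. 1 / b ^ pair_dist e))"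
proof -
  have "Pr (\<lambda>\<omega>. \<forall>e\<in>F. \<not> \<omega> e) = weight p F {}"
    unfolding pr_def using prob_cylinder[OF assms, of "{}"] by simp
  also have "\<dots> = (\<Prod>e\<in>F. exp (- a * (1 / b ^ pair_dist e)))"
    by (simp add: weight_def edge_prob_def)
  also have "\<dots> = exp (- a * (\<Sum>e\<in>F. 1 / b ^ pair_dist e))"
    by (simp only: exp_sum[OF assms(1), symmetric] sum_distrib_left)
  finally show ?thesis .
qed

lemma pr_le_1: "Pr P \<le> 1" and pr_nonneg: "0 \<le> Pr P"
  unfolding pr_def by auto

text \<open>Measurability is asked of the larger event only, because \<open>measure\<close> is 0
  outside the sigma-algebra.\<close>

lemma pr_mono_sets:
  assumes "{\<omega> \<in> space \<PP>. Q \<omega>} \<in> sets \<PP>" "\<And>\<omega>. P \<omega> \<Longrightarrow> Q \<omega>"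
  shows "Pr P \<le> Pr Q"
  unfolding pr_def using assms by (intro finite_measure_mono) auto

lemma pr_mono:
  assumes "finite A" "A \<subseteq> E" "determined_by A Q" "\<And>\<omega>. P \<omega> \<Longrightarrow> Q \<omega>"
  shows "Pr P \<le> Pr Q"
  by (rule pr_mono_sets[OF determined_event_sets[OF assms(1-3)] assms(4)])

lemma pr_disj_le:
  assumes "finite A" "A \<subseteq> E" "determined_by A P" "determined_by A Q"
  shows "Pr (\<lambda>\<omega>. P \<omega> \<or> Q \<omega>) \<le> Pr P + Pr Q"
proof -
  have "{\<omega> \<in> space \<PP>. P \<omega> \<or> Q \<omega>} = {\<omega> \<in> space \<PP>. P \<omega>} \<union> {\<omega> \<in> space \<PP>. Q \<omega>}" by auto
  then show ?thesis unfolding pr_def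
    using measure_Un_le[OF determined_event_sets[OF assms(1-3)]
        determined_event_sets[OF assms(1,2,4)]] by simp
qed

lemma pr_ex_le:
  assumes "finite A" "A \<subseteq> E" "finite I" "\<And>i. i \<in> I \<Longrightarrow> determined_by A (F i)"
  shows "Pr (\<lambda>\<omega>. \<exists>i\<in>I. F i \<omega>) \<le> (\<Sum>i\<in>I. Pr (F i))"
proof -
  have "{\<omega> \<in> space \<PP>. \<exists>i\<in>I. F i \<omega>} = (\<Union>i\<in>I. {\<omega> \<in> space \<PP>. F i \<omega>})" by auto
  then show ?thesis unfolding pr_def
    using assms by (auto intro!: finite_measure_subadditive_finite determined_event_sets)
qed

lemma pr_not:
  assumes "finite A" "A \<subseteq> E" "determined_by A P"
  shows "Pr (\<lambda>\<omega>. \<not> P \<omega>) = 1 - Pr P"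
proof -
  have "{\<omega> \<in> space \<PP>. \<not> P \<omega>} = space \<PP> - {\<omega> \<in> space \<PP>. P \<omega>}" by auto
  then show ?thesis unfolding pr_def using prob_compl[OF determined_event_sets[OF assms]] by simp
qed

section \<open>First-moment estimates and unions over random index sets\<close>

lemma expectation_card:
  assumes "finite A" "A \<subseteq> E" "finite I" "\<And>i. i \<in> I \<Longrightarrow> determined_by A (F i)"
  shows "integrable \<PP> (\<lambda>\<omega>. real (card {i\<in>I. F i \<omega>}))"
    and "expectation (\<lambda>\<omega>. real (card {i\<in>I. F i \<omega>})) = (\<Sum>i\<in>I. Pr (F i))"
proof -
  have eq: "real (card {i\<in>I. F i \<omega>}) = (\<Sum>i\<in>I. indicator {\<omega> \<in> space \<PP>. F i \<omega>} \<omega>)"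
    if "\<omega> \<in> space \<PP>" for \<omega>
  proof -
    have "real (card {i\<in>I. F i \<omega>}) = (\<Sum>i\<in>{i\<in>I. F i \<omega>}. 1)" by simp
    also have "\<dots> = (\<Sum>i\<in>I. if F i \<omega> then 1 else 0)"
      using assms(3) by (rule sum.inter_filter)
    also have "\<dots> = (\<Sum>i\<in>I. indicator {\<omega> \<in> space \<PP>. F i \<omega>} \<omega>)"
      using that by (intro sum.cong) auto
    finally show ?thesis .
  qed
  have ev: "{\<omega> \<in> space \<PP>. F i \<omega>} \<in> sets \<PP>" if "i \<in> I" for i
    using assms that by (intro determined_event_sets) auto
  have int: "integrable \<PP> (\<lambda>\<omega>. \<Sum>i\<in>I. indicator {\<omega> \<in> space \<PP>. F i \<omega>} \<omega> :: real)"
    using ev by (intro Bochner_Integration.integrable_sum integrable_real_indicator)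
      (auto simp: emeasure_eq_measure)
  then show "integrable \<PP> (\<lambda>\<omega>. real (card {i\<in>I. F i \<omega>}))"
    by (subst Bochner_Integration.integrable_cong[OF refl eq]) auto
  have "expectation (\<lambda>\<omega>. real (card {i\<in>I. F i \<omega>})) =
      expectation (\<lambda>\<omega>. \<Sum>i\<in>I. indicator {\<omega> \<in> space \<PP>. F i \<omega>} \<omega>)"
    by (rule Bochner_Integration.integral_cong[OF refl eq])
  also have "\<dots> = (\<Sum>i\<in>I. expectation (indicator {\<omega> \<in> space \<PP>. F i \<omega>}))"
    using ev by (intro Bochner_Integration.integral_sum integrable_real_indicator)
      (auto simp: emeasure_eq_measure)
  also have "\<dots> = (\<Sum>i\<in>I. Pr (F i))"
    using ev by (intro sum.cong) (auto simp: pr_def intro!: arg_cong[where f=prob])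
  finally show "expectation (\<lambda>\<omega>. real (card {i\<in>I. F i \<omega>})) = (\<Sum>i\<in>I. Pr (F i))" .
qed

lemma sum_pr_le:
  assumes "finite A" "A \<subseteq> E" "finite I" "\<And>i. i \<in> I \<Longrightarrow> determined_by A (F i)"
    and "\<And>\<omega>. real (card {i\<in>I. F i \<omega>}) \<le> K"
  shows "(\<Sum>i\<in>I. Pr (F i)) \<le> K"
proof -
  have "(\<Sum>i\<in>I. Pr (F i)) = expectation (\<lambda>\<omega>. real (card {i\<in>I. F i \<omega>}))"
    using expectation_card(2)[OF assms(1-4)] by simp
  also have "\<dots> \<le> expectation (\<lambda>\<omega>. K)"
    using expectation_card(1)[OF assms(1-4)] assms(5) by (intro integral_mono) auto
  finally show ?thesis by (simp add: prob_space)
qed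

text \<open>The count is at most \<open>card I\<close> where it reaches \<open>h\<close>, and below
  \<open>h\<close> elsewhere.\<close>

lemma reverse_Markov_card:
  assumes "finite A" "A \<subseteq> E" "finite I" "\<And>i. i \<in> I \<Longrightarrow> determined_by A (F i)" and "0 \<le> h"
  shows "(\<Sum>i\<in>I. Pr (F i)) \<le> card I * Pr (\<lambda>\<omega>. h \<le> real (card {i\<in>I. F i \<omega>})) + h"
proof -
  let ?G = "{\<omega> \<in> space \<PP>. h \<le> real (card {i\<in>I. F i \<omega>})}"
  have det: "determined_by A (\<lambda>\<omega>. h \<le> real (card {i\<in>I. F i \<omega>}))"
    unfolding determined_by_def
  proof (intro allI impI)
    fix \<omega> \<omega>' :: config assume *: "\<forall>e\<in>A. \<omega> e = \<omega>' e"
    have "F i \<omega> = F i \<omega>'" if "i \<in> I" for i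
      by (rule determined_by_D[OF assms(4)[OF that]]) (use * in blast)
    then have "{i\<in>I. F i \<omega>} = {i\<in>I. F i \<omega>'}" by blast
    then show "(h \<le> real (card {i\<in>I. F i \<omega>})) = (h \<le> real (card {i\<in>I. F i \<omega>'}))"
      by (simp only:)
  qed
  have G: "?G \<in> sets \<PP>" by (rule determined_event_sets[OF assms(1,2) det])
  then have int_G: "integrable \<PP> (indicator ?G :: config \<Rightarrow> real)"
    by (intro integrable_real_indicator) (auto simp: emeasure_eq_measure)
  have "(\<Sum>i\<in>I. Pr (F i)) = expectation (\<lambda>\<omega>. real (card {i\<in>I. F i \<omega>}))"
    using expectation_card(2)[OF assms(1-4)] by simp
  also have "\<dots> \<le> expectation (\<lambda>\<omega>. real (card I) * (indicator ?G \<omega> :: real) + h)"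
  proof (rule integral_mono[OF expectation_card(1)[OF assms(1-4)]])
    show "integrable \<PP> (\<lambda>\<omega>. real (card I) * (indicator ?G \<omega> :: real) + h)"
      using int_G by simp
    fix \<omega> assume "\<omega> \<in> space \<PP>"
    have "card {i\<in>I. F i \<omega>} \<le> card I" using assms(3) by (intro card_mono) auto
    then show "real (card {i\<in>I. F i \<omega>}) \<le> real (card I) * (indicator ?G \<omega> :: real) + h"
      using assms(5) \<open>\<omega> \<in> space \<PP>\<close> by (auto simp: indicator_def)
  qed
  also have "\<dots> = card I * Pr (\<lambda>\<omega>. h \<le> real (card {i\<in>I. F i \<omega>})) + h"
    using G int_G by (simp add: pr_def prob_space)
  finally show ?thesis .
qed

text \<open>A union bound over a random set of indices: the edges of \<open>A\<close> leave at most
  \<open>K\<close> candidates, and the edges of \<open>B\<close> are independent of them. The cost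
  is \<open>K\<close> rather than the size of \<open>I\<close>.\<close>

lemma pr_ex_conj_le:
  assumes A: "finite A" "A \<subseteq> E" and B: "finite B" "B \<subseteq> E" and "A \<inter> B = {}" and I: "finite I"
    and F: "\<And>i. i \<in> I \<Longrightarrow> determined_by A (F i)" and G: "\<And>i. i \<in> I \<Longrightarrow> determined_by B (G i)"
    and "\<And>i. i \<in> I \<Longrightarrow> Pr (G i) \<le> d" "0 \<le> d"
    and "\<And>\<omega>. real (card {i\<in>I. F i \<omega>}) \<le> K"
  shows "Pr (\<lambda>\<omega>. \<exists>i\<in>I. F i \<omega> \<and> G i \<omega>) \<le> K * d"
proof -
  have FG: "determined_by (A \<union> B) (\<lambda>\<omega>. F i \<omega> \<and> G i \<omega>)" if "i \<in> I" for i
    by (rule determined_by_conj_Un[OF F[OF that] G[OF that]])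
  have "Pr (\<lambda>\<omega>. \<exists>i\<in>I. F i \<omega> \<and> G i \<omega>) \<le> (\<Sum>i\<in>I. Pr (\<lambda>\<omega>. F i \<omega> \<and> G i \<omega>))"
    by (rule pr_ex_le[of "A \<union> B"]) (use A B I FG in auto)
  also have "\<dots> = (\<Sum>i\<in>I. Pr (F i) * Pr (G i))"
    by (rule sum.cong[OF refl]) (use assms in \<open>auto intro!: pr_indep[of A _ B]\<close>)
  also have "\<dots> \<le> (\<Sum>i\<in>I. Pr (F i) * d)"
    using assms by (intro sum_mono mult_left_mono pr_nonneg)
  also have "\<dots> \<le> K * d"
    unfolding sum_distrib_right[symmetric]
    using sum_pr_le[OF A I F assms(11)] assms(10) by (intro mult_right_mono) auto
  finally show ?thesis .
qed

text \<open>The disjointness of the events \<open>F i\<close> is what makes the lower bound possible.\<close>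

lemma pr_ex_conj_ge:
  assumes A: "finite A" "A \<subseteq> E" and B: "finite B" "B \<subseteq> E" and "A \<inter> B = {}" and I: "finite I"
    and F: "\<And>i. i \<in> I \<Longrightarrow> determined_by A (F i)" and G: "\<And>i. i \<in> I \<Longrightarrow> determined_by B (G i)"
    and "\<And>i. i \<in> I \<Longrightarrow> q \<le> Pr (G i)" "0 \<le> q"
    and disj: "\<And>i j \<omega>. i \<in> I \<Longrightarrow> j \<in> I \<Longrightarrow> F i \<omega> \<Longrightarrow> F j \<omega> \<Longrightarrow> i = j"
  shows "Pr (\<lambda>\<omega>. \<exists>i\<in>I. F i \<omega>) * q \<le> Pr (\<lambda>\<omega>. \<exists>i\<in>I. F i \<omega> \<and> G i \<omega>)"
proof -
  have FG: "determined_by (A \<union> B) (\<lambda>\<omega>. F i \<omega> \<and> G i \<omega>)" if "i \<in> I" for i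
    by (rule determined_by_conj_Un[OF F[OF that] G[OF that]])
  have "Pr (\<lambda>\<omega>. \<exists>i\<in>I. F i \<omega>) * q \<le> (\<Sum>i\<in>I. Pr (F i)) * q"
    using pr_ex_le[OF A I F] assms(10) by (intro mult_right_mono) auto
  also have "\<dots> \<le> (\<Sum>i\<in>I. Pr (F i) * Pr (G i))"
    unfolding sum_distrib_right using assms by (intro sum_mono mult_left_mono pr_nonneg)
  also have "\<dots> = (\<Sum>i\<in>I. Pr (\<lambda>\<omega>. F i \<omega> \<and> G i \<omega>))"
    by (rule sum.cong[OF refl], rule pr_indep[of A _ B, symmetric]) (use assms in auto)
  also have "\<dots> = prob (\<Union>i\<in>I. {\<omega> \<in> space \<PP>. F i \<omega> \<and> G i \<omega>})"
    unfolding pr_def using I A B FG disj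
    by (intro finite_measure_finite_Union[symmetric])
      (auto simp: disjoint_family_on_def intro!: determined_event_sets[of "A \<union> B"])
  also have "(\<Union>i\<in>I. {\<omega> \<in> space \<PP>. F i \<omega> \<and> G i \<omega>}) = {\<omega> \<in> space \<PP>. \<exists>i\<in>I. F i \<omega> \<and> G i \<omega>}"
    by auto
  finally show ?thesis by (simp add: pr_def)
qed

end

lemma isCont_pr:
  assumes "2 \<le> N" "0 < a" "0 < b" "finite A" "A \<subseteq> vertex_pairs N" "determined_by A P"
  shows "isCont (\<lambda>(a, b). pr N a b P) (a, b)"
proof -
  \<comment> \<open>The finite-sum formula is available at positive parameters; agreement on an open
    neighbourhood suffices for continuity.\<close>
  have ev: "\<forall>\<^sub>F x in nhds (a, b). (case x of (a, b) \<Rightarrow> pr N a b P) =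
     (\<Sum>S\<in>{S\<in>Pow A. P (\<lambda>e. e \<in> S)}. weight (\<lambda>e. edge_prob (fst x) (snd x) (pair_dist e)) A S)"
  proof (rule eventually_nhds_in_open[THEN eventually_mono])
    show "open ({0<..} \<times> {0<..} :: (real \<times> real) set)" by (intro open_Times open_greaterThan)
    show "(a, b) \<in> {0<..} \<times> {0<..}" using assms by simp
    fix x :: "real \<times> real" assume "x \<in> {0<..} \<times> {0<..}"
    then interpret percolation_model N "fst x" "snd x"
      using assms by unfold_locales auto
    show "(case x of (a, b) \<Rightarrow> pr N a b P) =
     (\<Sum>S\<in>{S\<in>Pow A. P (\<lambda>e. e \<in> S)}. weight (\<lambda>e. edge_prob (fst x) (snd x) (pair_dist e)) A S)"
      using pr_eq_sum[OF assms(4-6)] by (simp add: case_prod_beta)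
  qed
  have "isCont (\<lambda>x. if e \<in> S then edge_prob (fst x) (snd x) k else 1 - edge_prob (fst x) (snd x) k) (a, b)"
    for S k and e :: "vertex set"
    unfolding edge_prob_def using assms(3) by (cases "e \<in> S") (auto intro!: continuous_intros)
  then show ?thesis
    unfolding isCont_cong[OF ev] weight_def by (intro continuous_intros)
qed


section \<open>Balls and clusters\<close>

definition hball :: "nat \<Rightarrow> nat \<Rightarrow> vertex \<Rightarrow> vertex set" where
  "hball N n x = {y \<in> hier_lattice N. \<forall>i>n. y i = x i}"

text \<open>Coordinates in \<open>I\<close> are free, the others are those of \<open>x\<close>.
  Balls and the centres of a tiling by balls both have this form, so one count serves both.\<close>

definition box :: "nat \<Rightarrow> vertex \<Rightarrow> nat set \<Rightarrow> vertex set" where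
  "box N x I = {y \<in> hier_lattice N. \<forall>i. i \<notin> I \<longrightarrow> y i = x i}"

definition edges_between :: "vertex set \<Rightarrow> vertex set \<Rightarrow> vertex set set" where
  "edges_between X Y = {{u, v} |u v. u \<in> X \<and> v \<in> Y \<and> u \<noteq> v}"

abbreviation edges_within :: "vertex set \<Rightarrow> vertex set set" where
  "edges_within W \<equiv> edges_between W W"

definition local_adj :: "vertex set \<Rightarrow> config \<Rightarrow> vertex rel" where
  "local_adj W \<omega> = {(u, v). u \<in> W \<and> v \<in> W \<and> u \<noteq> v \<and> \<omega> {u, v}}"

text \<open>Paths must stay in \<open>W\<close>. The cluster then depends on the edges inside
  \<open>W\<close> only, and clusters in disjoint balls are independent.\<close>

definition local_cluster :: "vertex set \<Rightarrow> config \<Rightarrow> vertex \<Rightarrow> vertex set" where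
  "local_cluster W \<omega> x = {y. (x, y) \<in> (local_adj W \<omega>)\<^sup>*}"

section \<open>Boxes, balls and the ultrametric distance\<close>

lemma zero_in_lattice: "0 < N \<Longrightarrow> (\<lambda>_. 0) \<in> hier_lattice N"
  by (simp add: hier_lattice_def)

lemma lattice_update:
  assumes "x \<in> hier_lattice N" "finite I" "0 \<notin> I" "\<And>i. i \<in> I \<Longrightarrow> f i < N"
  shows "(\<lambda>i. if i \<in> I then f i else x i) \<in> hier_lattice N"
proof -
  have "{i. (if i \<in> I then f i else x i) \<noteq> 0} \<subseteq> I \<union> {i. x i \<noteq> 0}" by auto
  moreover have "finite (I \<union> {i. x i \<noteq> 0})" using assms by (simp add: hier_lattice_def)
  ultimately have "finite {i. (if i \<in> I then f i else x i) \<noteq> 0}" by (rule finite_subset)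
  then show ?thesis using assms by (auto simp: hier_lattice_def)
qed

lemma box_bij:
  assumes "x \<in> hier_lattice N" "finite I" "0 \<notin> I"
  shows "bij_betw (\<lambda>f i. if i \<in> I then f i else x i) (I \<rightarrow>\<^sub>E {0..<N}) (box N x I)"
proof (rule bij_betw_byWitness[where f' = "\<lambda>y. restrict y I"])
  show "(\<lambda>f i. if i \<in> I then f i else x i) ` (I \<rightarrow>\<^sub>E {0..<N}) \<subseteq> box N x I"
    using lattice_update[OF assms] by (fastforce simp: box_def PiE_iff)
  show "(\<lambda>y. restrict y I) ` box N x I \<subseteq> I \<rightarrow>\<^sub>E {0..<N}"
  proof (intro image_subsetI)
    fix y assume "y \<in> box N x I"
    then have "y i < N" if "i \<in> I" for i
      using that assms(3) by (cases i) (auto simp: box_def hier_lattice_def)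
    then show "restrict y I \<in> I \<rightarrow>\<^sub>E {0..<N}" by (auto simp: PiE_iff)
  qed
qed (auto simp: box_def PiE_iff extensional_def fun_eq_iff)

lemma card_box:
  assumes "x \<in> hier_lattice N" "finite I" "0 \<notin> I"
  shows "card (box N x I) = N ^ card I" and "finite (box N x I)"
  using bij_betw_same_card[OF box_bij[OF assms]] bij_betw_finite[OF box_bij[OF assms]] assms
  by (auto simp: card_PiE finite_PiE)

lemma hball_eq_box: "x \<in> hier_lattice N \<Longrightarrow> hball N n x = box N x {1..n}"
  unfolding hball_def box_def hier_lattice_def
  by (auto simp: not_le)

lemma
  assumes "x \<in> hier_lattice N"
  shows card_hball: "card (hball N n x) = N ^ n" and finite_hball: "finite (hball N n x)"
  using card_box[OF assms, of "{1..n}"] by (simp_all add: hball_eq_box[OF assms])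

lemma hball_subset: "hball N n x \<subseteq> hier_lattice N"
  by (auto simp: hball_def)

lemma hball_mono: "n \<le> m \<Longrightarrow> hball N n x \<subseteq> hball N m x"
  by (auto simp: hball_def)

lemma center_in_hball: "x \<in> hier_lattice N \<Longrightarrow> x \<in> hball N n x"
  by (simp add: hball_def)

lemma hball_cong: "y \<in> hball N n x \<Longrightarrow> hball N n y = hball N n x"
  by (auto simp: hball_def)

lemma ex_hball:
  assumes "x \<in> hier_lattice N" shows "\<exists>n. x \<in> hball N n (\<lambda>_. 0)"
proof -
  have "finite {i. x i \<noteq> 0}" using assms by (simp add: hier_lattice_def)
  then obtain n where "\<forall>i\<in>{i. x i \<noteq> 0}. i \<le> n" by (meson finite_nat_set_iff_bounded_le)
  then show ?thesis using assms by (intro exI[of _ n]) (auto simp: hball_def)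
qed

lemma
  assumes "x \<in> hier_lattice N" "y \<in> hier_lattice N" "x \<noteq> y"
  shows hier_dist_neq: "x (hier_dist x y) \<noteq> y (hier_dist x y)"
    and hier_dist_above: "hier_dist x y < i \<Longrightarrow> x i = y i"
proof -
  have "{i. x i \<noteq> y i} \<subseteq> {i. x i \<noteq> 0} \<union> {i. y i \<noteq> 0}" by auto
  moreover have "finite ({i. x i \<noteq> 0} \<union> {i. y i \<noteq> 0})" using assms by (simp add: hier_lattice_def)
  ultimately have fin: "finite {i. x i \<noteq> y i}" by (rule finite_subset)
  moreover have "{i. x i \<noteq> y i} \<noteq> {}" using assms(3) by auto
  ultimately have "Max {i. x i \<noteq> y i} \<in> {i. x i \<noteq> y i}" by (rule Max_in)
  then show *: "x (hier_dist x y) \<noteq> y (hier_dist x y)" using assms(3) by (simp add: hier_dist_def)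
  show "x i = y i" if "hier_dist x y < i"
    using that Max_ge[OF fin, of i] assms(3) by (auto simp: hier_dist_def)
qed

lemma hier_dist_le_in_hball:
  assumes "u \<in> hball N n x" "v \<in> hball N n x" "u \<noteq> v"
  shows "hier_dist u v \<le> n"
  using hier_dist_neq[of u N v] assms by (force simp: hball_def not_le[symmetric])

lemma hier_dist_shell:
  assumes "u \<in> hball N n x" "v \<in> hball N k x" "v \<notin> hball N n x"
  shows "n < hier_dist u v"
proof (rule ccontr)
  assume *: "\<not> n < hier_dist u v"
  have "u \<noteq> v" using assms by auto
  have "v i = x i" if "i > n" for i
    using hier_dist_above[of u N v i] * that assms \<open>u \<noteq> v\<close> by (auto simp: hball_def)
  then show False using assms by (auto simp: hball_def)
qed

section \<open>Edges between two sets of vertices\<close>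

lemma edges_between_subset:
  "X \<subseteq> hier_lattice N \<Longrightarrow> Y \<subseteq> hier_lattice N \<Longrightarrow> edges_between X Y \<subseteq> vertex_pairs N"
  unfolding edges_between_def vertex_pairs_def by blast

lemma finite_edges_between: "finite X \<Longrightarrow> finite Y \<Longrightarrow> finite (edges_between X Y)"
  by (rule finite_subset[of _ "(\<lambda>(u, v). {u, v}) ` (X \<times> Y)"]) (auto simp: edges_between_def)

lemma edges_between_mono: "X \<subseteq> X' \<Longrightarrow> Y \<subseteq> Y' \<Longrightarrow> edges_between X Y \<subseteq> edges_between X' Y'"
  unfolding edges_between_def by blast

lemma edges_between_subset_within: "X \<subseteq> W \<Longrightarrow> Y \<subseteq> W \<Longrightarrow> edges_between X Y \<subseteq> edges_within W"
  by (rule edges_between_mono)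

lemma edges_within_disjoint: "X \<inter> Y = {} \<Longrightarrow> edges_within X \<inter> edges_within Y = {}"
  by (auto simp: edges_between_def doubleton_eq_iff)

lemma edges_within_between_disjoint:
  "X \<inter> Y = {} \<Longrightarrow> edges_within X \<inter> edges_between X Y = {}"
  "X \<inter> Y = {} \<Longrightarrow> edges_within Y \<inter> edges_between X Y = {}"
  by (auto simp: edges_between_def doubleton_eq_iff)

lemma in_edges_between: "u \<in> X \<Longrightarrow> v \<in> Y \<Longrightarrow> u \<noteq> v \<Longrightarrow> {u, v} \<in> edges_between X Y"
  by (auto simp: edges_between_def)

text \<open>For disjoint sets each unordered pair arises from exactly one ordered pair.\<close>

lemma sum_edges_between:
  assumes "finite X" "finite Y" "X \<inter> Y = {}"
  shows "(\<Sum>e\<in>edges_between X Y. f (pair_dist e)) = (\<Sum>u\<in>X. \<Sum>v\<in>Y. f (hier_dist u v))"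
proof -
  have "edges_between X Y = (\<lambda>(u, v). {u, v}) ` (X \<times> Y)"
    using assms(3) unfolding edges_between_def by fast
  moreover have "inj_on (\<lambda>(u, v). {u, v}) (X \<times> Y)"
    using assms(3) by (auto simp: inj_on_def doubleton_eq_iff)
  ultimately show ?thesis
    by (simp only: sum.reindex sum.cartesian_product) (simp add: o_def case_prod_beta')
qed

lemma card_edges_between:
  assumes "finite X" "finite Y" "X \<inter> Y = {}"
  shows "card (edges_between X Y) = card X * card Y"
  using sum_edges_between[OF assms, of "\<lambda>_. 1 :: nat"] by simp

section \<open>Clusters inside a set of vertices\<close>

lemma local_adj_sym: "(u, v) \<in> local_adj W \<omega> \<Longrightarrow> (v, u) \<in> local_adj W \<omega>"
  by (auto simp: local_adj_def insert_commute)

lemma local_cluster_refl: "x \<in> local_cluster W \<omega> x"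
  by (simp add: local_cluster_def)

lemma local_cluster_sym: "y \<in> local_cluster W \<omega> x \<Longrightarrow> x \<in> local_cluster W \<omega> y"
  unfolding local_cluster_def mem_Collect_eq
  by (rule symD[OF sym_rtrancl]) (auto intro: symI local_adj_sym)

lemma local_cluster_eq:
  assumes "y \<in> local_cluster W \<omega> x" shows "local_cluster W \<omega> y = local_cluster W \<omega> x"
  using assms local_cluster_sym[OF assms] unfolding local_cluster_def by (auto intro: rtrancl_trans)

lemma local_cluster_subset: "x \<in> W \<Longrightarrow> local_cluster W \<omega> x \<subseteq> W"
proof
  fix y assume "x \<in> W" "y \<in> local_cluster W \<omega> x"
  then have "(x, y) \<in> (local_adj W \<omega>)\<^sup>*" by (simp add: local_cluster_def)
  then show "y \<in> W" by (induction rule: rtrancl_induct) (use \<open>x \<in> W\<close> in \<open>auto simp: local_adj_def\<close>)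
qed

lemma local_cluster_mono: "W \<subseteq> W' \<Longrightarrow> local_cluster W \<omega> x \<subseteq> local_cluster W' \<omega> x"
  unfolding local_cluster_def
  using rtrancl_mono[of "local_adj W \<omega>" "local_adj W' \<omega>"] by (auto simp: local_adj_def)

lemma local_cluster_edge:
  assumes "u \<in> W" "v \<in> W" "\<omega> {u, v}"
  shows "local_cluster W \<omega> u = local_cluster W \<omega> v"
proof (cases "u = v")
  case False
  then have "(u, v) \<in> local_adj W \<omega>" using assms by (auto simp: local_adj_def)
  then have "v \<in> local_cluster W \<omega> u" by (auto simp: local_cluster_def)
  then show ?thesis using local_cluster_eq by blast
qed simp

lemma local_cluster_closed:
  assumes "x \<in> C" "\<And>u v. u \<in> C \<Longrightarrow> (u, v) \<in> local_adj W \<omega> \<Longrightarrow> v \<in> C"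
  shows "local_cluster W \<omega> x \<subseteq> C"
proof
  fix y assume "y \<in> local_cluster W \<omega> x"
  then have "(x, y) \<in> (local_adj W \<omega>)\<^sup>*" by (simp add: local_cluster_def)
  then show "y \<in> C" by (induction rule: rtrancl_induct) (use assms in auto)
qed

text \<open>A new vertex could only be reached through an open edge from the old cluster to the
  outside of \<open>W\<close>.\<close>

lemma local_cluster_no_exit:
  assumes "x \<in> W" "W \<subseteq> W'"
    and "\<forall>e\<in>edges_between (local_cluster W \<omega> x) (W' - W). \<not> \<omega> e"
  shows "local_cluster W' \<omega> x = local_cluster W \<omega> x"
proof (rule antisym)
  let ?C = "local_cluster W \<omega> x"
  show "local_cluster W' \<omega> x \<subseteq> ?C"
  proof (rule local_cluster_closed[OF local_cluster_refl])
    fix u v assume u: "u \<in> ?C" and uv: "(u, v) \<in> local_adj W' \<omega>"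
    have "v \<in> W"
    proof (rule ccontr)
      assume "v \<notin> W"
      then have "{u, v} \<in> edges_between ?C (W' - W)"
        using u uv by (intro in_edges_between) (auto simp: local_adj_def)
      then show False using assms(3) uv by (auto simp: local_adj_def)
    qed
    then have "(u, v) \<in> local_adj W \<omega>"
      using uv u local_cluster_subset[OF assms(1)] by (auto simp: local_adj_def)
    with u show "v \<in> ?C" by (auto simp: local_cluster_def intro: rtrancl_into_rtrancl)
  qed
qed (rule local_cluster_mono[OF assms(2)])

lemma determined_by_local_cluster:
  "determined_by (edges_within W) (\<lambda>\<omega>. local_cluster W \<omega> x)"
  unfolding determined_by_def
proof (intro allI impI)
  fix \<omega> \<omega>' :: config assume "\<forall>e\<in>edges_within W. \<omega> e = \<omega>' e"
  then have "local_adj W \<omega> = local_adj W \<omega>'"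
    by (auto simp: local_adj_def in_edges_between)
  then show "local_cluster W \<omega> x = local_cluster W \<omega>' x" by (simp add: local_cluster_def)
qed

lemma local_cluster_subset_cluster:
  assumes "W \<subseteq> hier_lattice N" shows "local_cluster W \<omega> x \<subseteq> cluster N \<omega> x"
proof -
  have "local_adj W \<omega> \<subseteq> adjacency N \<omega>"
    using assms by (auto simp: local_adj_def adjacency_def vertex_pairs_def)
  then show ?thesis unfolding local_cluster_def cluster_def using rtrancl_mono by blast
qed

text \<open>A finite path lies in one ball around the origin.\<close>

lemma cluster_eq_UN:
  assumes "0 < N"
  shows "cluster N \<omega> (\<lambda>_. 0) = (\<Union>k. local_cluster (hball N k (\<lambda>_. 0)) \<omega> (\<lambda>_. 0))"
proof
  show "cluster N \<omega> (\<lambda>_. 0) \<subseteq> (\<Union>k. local_cluster (hball N k (\<lambda>_. 0)) \<omega> (\<lambda>_. 0))"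
  proof
    fix y assume "y \<in> cluster N \<omega> (\<lambda>_. 0)"
    then have "((\<lambda>_. 0), y) \<in> (adjacency N \<omega>)\<^sup>*" by (simp add: cluster_def)
    then show "y \<in> (\<Union>k. local_cluster (hball N k (\<lambda>_. 0)) \<omega> (\<lambda>_. 0))"
    proof (induction rule: rtrancl_induct)
      case base then show ?case by (auto intro: local_cluster_refl)
    next
      case (step y z)
      obtain k where k: "y \<in> local_cluster (hball N k (\<lambda>_. 0)) \<omega> (\<lambda>_. 0)" using step by auto
      have yz: "y \<in> hier_lattice N" "z \<in> hier_lattice N" "y \<noteq> z" "\<omega> {y, z}"
        using step(2) by (auto simp: adjacency_def vertex_pairs_def doubleton_eq_iff)
      obtain i j where ij: "y \<in> hball N i (\<lambda>_. 0)" "z \<in> hball N j (\<lambda>_. 0)"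
        using ex_hball yz by blast
      define m where "m = max k (max i j)"
      have le: "k \<le> m" "i \<le> m" "j \<le> m" by (auto simp: m_def)
      have "(y, z) \<in> local_adj (hball N m (\<lambda>_. 0)) \<omega>"
        using ij yz hball_mono[OF le(2), of N "\<lambda>_. 0"] hball_mono[OF le(3), of N "\<lambda>_. 0"]
        by (auto simp: local_adj_def)
      moreover have "y \<in> local_cluster (hball N m (\<lambda>_. 0)) \<omega> (\<lambda>_. 0)"
        using k local_cluster_mono[OF hball_mono[OF le(1)]] by blast
      ultimately have "z \<in> local_cluster (hball N m (\<lambda>_. 0)) \<omega> (\<lambda>_. 0)"
        by (auto simp: local_cluster_def intro: rtrancl_into_rtrancl)
      then show ?case by blast
    qed
  qed
qed (use local_cluster_subset_cluster[OF hball_subset] in blast)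

text \<open>Exchanging the digits \<open>0\<close> and \<open>x i\<close> in every coordinate is an isometric involution that
  maps the origin to \<open>x\<close>; this avoids modular arithmetic.\<close>

definition swap_origin :: "vertex \<Rightarrow> vertex \<Rightarrow> vertex" where
  "swap_origin x z = (\<lambda>i. if z i = 0 then x i else if z i = x i then 0 else z i)"

lemma swap_origin_0 [simp]: "swap_origin x (\<lambda>_. 0) = x"
  by (simp add: swap_origin_def)

lemma swap_origin_involution [simp]: "swap_origin x (swap_origin x z) = z"
  by (auto simp: swap_origin_def fun_eq_iff)

lemma inj_swap_origin: "inj (swap_origin x)"
  by (metis injI swap_origin_involution)

lemma swap_origin_coordinate: "swap_origin x u i = swap_origin x v i \<longleftrightarrow> u i = v i"
  by (auto simp: swap_origin_def)

lemma swap_origin_in_lattice: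
  assumes "x \<in> hier_lattice N" "z \<in> hier_lattice N"
  shows "swap_origin x z \<in> hier_lattice N"
proof -
  have "{i. swap_origin x z i \<noteq> 0} \<subseteq> {i. x i \<noteq> 0} \<union> {i. z i \<noteq> 0}" by (auto simp: swap_origin_def)
  moreover have "finite ({i. x i \<noteq> 0} \<union> {i. z i \<noteq> 0})" using assms by (simp add: hier_lattice_def)
  ultimately have "finite {i. swap_origin x z i \<noteq> 0}" by (rule finite_subset)
  then show ?thesis using assms by (auto simp: hier_lattice_def swap_origin_def)
qed

lemma hier_dist_swap_origin: "hier_dist (swap_origin x u) (swap_origin x v) = hier_dist u v"
  using injD[OF inj_swap_origin[of x], of u v] by (auto simp: hier_dist_def swap_origin_coordinate)

lemma image_swap_origin_hball:
  assumes "x \<in> hier_lattice N"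
  shows "swap_origin x ` hball N n (\<lambda>_. 0) = hball N n x"
proof (intro equalityI subsetI)
  fix y assume "y \<in> swap_origin x ` hball N n (\<lambda>_. 0)"
  then show "y \<in> hball N n x"
    using swap_origin_in_lattice[OF assms] by (auto simp: hball_def swap_origin_def)
next
  fix y assume "y \<in> hball N n x"
  then have "swap_origin x y \<in> hball N n (\<lambda>_. 0)"
    using swap_origin_in_lattice[OF assms] by (auto simp: hball_def swap_origin_def)
  then show "y \<in> swap_origin x ` hball N n (\<lambda>_. 0)"
    by (rule rev_image_eqI) simp
qed

lemma local_cluster_image:
  assumes "inj \<sigma>"
  shows "local_cluster (\<sigma> ` W) \<omega> (\<sigma> u) = \<sigma> ` local_cluster W (\<lambda>e. \<omega> (\<sigma> ` e)) u"
proof (intro equalityI)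
  show "local_cluster (\<sigma> ` W) \<omega> (\<sigma> u) \<subseteq> \<sigma> ` local_cluster W (\<lambda>e. \<omega> (\<sigma> ` e)) u"
  proof (rule local_cluster_closed)
    show "\<sigma> u \<in> \<sigma> ` local_cluster W (\<lambda>e. \<omega> (\<sigma> ` e)) u" by (simp add: local_cluster_refl)
    fix v w assume "v \<in> \<sigma> ` local_cluster W (\<lambda>e. \<omega> (\<sigma> ` e)) u" "(v, w) \<in> local_adj (\<sigma> ` W) \<omega>"
    then obtain v' w' where v': "v = \<sigma> v'" "v' \<in> local_cluster W (\<lambda>e. \<omega> (\<sigma> ` e)) u" and
      w': "w = \<sigma> w'" "w' \<in> W" and "\<sigma> v' \<in> \<sigma> ` W" "\<sigma> v' \<noteq> \<sigma> w'" "\<omega> {\<sigma> v', \<sigma> w'}"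
      by (auto simp: local_adj_def)
    then have "(v', w') \<in> local_adj W (\<lambda>e. \<omega> (\<sigma> ` e))"
      using assms by (auto simp: local_adj_def inj_image_mem_iff)
    then show "w \<in> \<sigma> ` local_cluster W (\<lambda>e. \<omega> (\<sigma> ` e)) u"
      using v' w' by (auto simp: local_cluster_def intro: rtrancl_into_rtrancl)
  qed
  show "\<sigma> ` local_cluster W (\<lambda>e. \<omega> (\<sigma> ` e)) u \<subseteq> local_cluster (\<sigma> ` W) \<omega> (\<sigma> u)"
  proof (rule image_subsetI)
    fix v assume "v \<in> local_cluster W (\<lambda>e. \<omega> (\<sigma> ` e)) u"
    then have "(u, v) \<in> (local_adj W (\<lambda>e. \<omega> (\<sigma> ` e)))\<^sup>*" by (simp add: local_cluster_def)
    then show "\<sigma> v \<in> local_cluster (\<sigma> ` W) \<omega> (\<sigma> u)"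
    proof (induction rule: rtrancl_induct)
      case base show ?case by (rule local_cluster_refl)
    next
      case (step v w)
      then have "(\<sigma> v, \<sigma> w) \<in> local_adj (\<sigma> ` W) \<omega>"
        using injD[OF assms, of v w] by (auto simp: local_adj_def)
      with step show ?case by (auto simp: local_cluster_def intro: rtrancl_into_rtrancl)
    qed
  qed
qed

definition large_cluster :: "vertex set \<Rightarrow> real \<Rightarrow> config \<Rightarrow> bool" where
  "large_cluster W s \<omega> \<longleftrightarrow> (\<exists>u\<in>W. s \<le> real (card (local_cluster W \<omega> u)))"

lemma determined_by_large_cluster: "determined_by (edges_within W) (large_cluster W s)"
  unfolding determined_by_def large_cluster_def
  using determined_by_local_cluster[of W] unfolding determined_by_def by metis

lemma large_cluster_mono:
  assumes "W \<subseteq> W'" "finite W'" "s' \<le> s" "large_cluster W s \<omega>"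
  shows "large_cluster W' s' \<omega>"
proof -
  obtain u where u: "u \<in> W" "s \<le> real (card (local_cluster W \<omega> u))"
    using assms(4) by (auto simp: large_cluster_def)
  have "local_cluster W' \<omega> u \<subseteq> W'" using u assms(1) by (intro local_cluster_subset) auto
  then have "card (local_cluster W \<omega> u) \<le> card (local_cluster W' \<omega> u)"
    using finite_subset[OF _ assms(2)] by (intro card_mono local_cluster_mono assms(1)) auto
  then show ?thesis using u assms by (auto simp: large_cluster_def intro!: bexI[of _ u])
qed

section \<open>Transitivity of the model\<close>

context percolation_model
begin

abbreviation "B n x \<equiv> hball N n x"
abbreviation "B0 n \<equiv> hball N n (\<lambda>_. 0)"
abbreviation "C0 n \<omega> \<equiv> local_cluster (hball N n (\<lambda>_. 0)) \<omega> (\<lambda>_. 0)"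

lemma zero_V: "(\<lambda>_. 0) \<in> V"
  using N_ge_2 by (intro zero_in_lattice) auto

lemma edges_hball:
  assumes "x \<in> V"
  shows "finite (edges_within (B n x))" "edges_within (B n x) \<subseteq> E"
  using assms by (simp_all add: finite_edges_between finite_hball edges_between_subset hball_subset)

lemma pr_swap_origin:
  assumes "x \<in> V" "determined_by (edges_within (B0 n)) P"
  shows "Pr (\<lambda>\<omega>. P (\<lambda>e. \<omega> (swap_origin x ` e))) = Pr P"
proof (rule pr_reindex[OF edges_hball[OF zero_V] assms(2)])
  show "inj_on ((`) (swap_origin x)) (edges_within (B0 n))"
    using inj_swap_origin[of x] by (simp add: inj_on_def inj_image_eq_iff)
  show "(`) (swap_origin x) ` edges_within (B0 n) \<subseteq> E"
  proof (rule image_subsetI)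
    fix e assume "e \<in> edges_within (B0 n)"
    then obtain u v where "e = {u, v}" "u \<in> V" "v \<in> V" "u \<noteq> v"
      by (auto simp: edges_between_def hball_def)
    then show "swap_origin x ` e \<in> E"
      using swap_origin_in_lattice[OF assms(1)] injD[OF inj_swap_origin[of x], of u v]
      unfolding vertex_pairs_def by blast
  qed
  fix e assume "e \<in> edges_within (B0 n)"
  then show "pair_dist (swap_origin x ` e) = pair_dist e"
    by (auto simp: edges_between_def hier_dist_swap_origin)
qed

lemma pr_cluster_size_transitive:
  assumes "x \<in> V"
  shows "Pr (\<lambda>\<omega>. s \<le> real (card (local_cluster (B n x) \<omega> x))) = Pr (\<lambda>\<omega>. s \<le> real (card (C0 n \<omega>)))"
proof -
  have "card (local_cluster (B n x) \<omega> x) = card (C0 n (\<lambda>e. \<omega> (swap_origin x ` e)))" for \<omega>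
    using local_cluster_image[OF inj_swap_origin[of x], of "B0 n" \<omega> "\<lambda>_. 0"]
    by (simp add: image_swap_origin_hball[OF assms] card_image inj_on_subset[OF inj_swap_origin])
  then show ?thesis
    using pr_swap_origin[OF assms, of n "\<lambda>\<omega>. s \<le> real (card (C0 n \<omega>))"]
      determined_by_comp[OF determined_by_local_cluster, of "B0 n" "\<lambda>C. s \<le> real (card C)"] by simp
qed

lemma pr_large_cluster_transitive:
  assumes "x \<in> V"
  shows "Pr (large_cluster (B n x) s) = Pr (large_cluster (B0 n) s)"
proof -
  have "large_cluster (B n x) s = (\<lambda>\<omega>. large_cluster (B0 n) s (\<lambda>e. \<omega> (swap_origin x ` e)))"
  proof (rule ext)
    fix \<omega> show "large_cluster (B n x) s \<omega> = large_cluster (B0 n) s (\<lambda>e. \<omega> (swap_origin x ` e))"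
    unfolding large_cluster_def image_swap_origin_hball[OF assms, symmetric] bex_simps
    by (simp add: local_cluster_image[OF inj_swap_origin] card_image
        inj_on_subset[OF inj_swap_origin])
  qed
  then show ?thesis
    using pr_swap_origin[OF assms determined_by_large_cluster, of n s] by simp
qed

end


section \<open>Edges between disjoint sets and escape from a ball\<close>

context percolation_model
begin

text \<open>For \<open>b < 1\<close> the largest of the numbers \<open>b ^ d\<close> with
  \<open>d \<le> k\<close> is not \<open>b ^ k\<close>. With base \<open>b1\<close> the power
  \<open>b1 ^ k\<close> dominates them all, so \<open>1 / b1 ^ k\<close> bounds from below the
  weight of every edge inside a ball of radius \<open>k\<close>.\<close>

abbreviation "b1 \<equiv> max 1 b"

lemma b1_facts: "1 \<le> b1" "0 < b1" "b \<le> b1" by auto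

lemma pr_closed_le:
  assumes "F \<subseteq> edges_within (B0 k)" and "s \<le> real (card F)"
  shows "Pr (\<lambda>\<omega>. \<forall>e\<in>F. \<not> \<omega> e) \<le> exp (- a * s / b1 ^ k)"
proof -
  have fin: "finite F" "F \<subseteq> E"
    using assms(1) edges_hball[OF zero_V] by (auto intro: finite_subset)
  have "1 / b1 ^ k \<le> 1 / b ^ pair_dist e" if e: "e \<in> F" for e
  proof -
    obtain u v where uv: "e = {u, v}" "u \<in> B0 k" "v \<in> B0 k" "u \<noteq> v"
      using e assms(1) unfolding edges_between_def by blast
    have "b ^ hier_dist u v \<le> b1 ^ hier_dist u v" using b_pos by (intro power_mono) auto
    also have "\<dots> \<le> b1 ^ k" using hier_dist_le_in_hball[OF uv(2-4)] by (intro power_increasing) auto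
    finally show ?thesis using b_pos uv(1) by (auto intro!: divide_left_mono mult_pos_pos)
  qed
  then have "(\<Sum>e\<in>F. 1 / b1 ^ k) \<le> (\<Sum>e\<in>F. 1 / b ^ pair_dist e)" by (rule sum_mono)
  moreover have "s / b1 ^ k \<le> real (card F) / b1 ^ k" using assms(2) by (intro divide_right_mono) auto
  ultimately have "a * (s / b1 ^ k) \<le> a * (\<Sum>e\<in>F. 1 / b ^ pair_dist e)"
    using a_pos by (intro mult_left_mono) auto
  then show ?thesis unfolding pr_closed[OF fin] by simp
qed

lemma determined_by_closed: "F \<subseteq> A \<Longrightarrow> determined_by A (\<lambda>\<omega>. \<forall>e\<in>F. \<not> \<omega> e)"
  unfolding determined_by_def by blast

text \<open>The edges within \<open>W1\<close> and \<open>W2\<close> fix the values of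
  \<open>U1\<close> and \<open>U2\<close>; the edges between \<open>W1\<close> and \<open>W2\<close>
  are independent of these. Exactly one pair of values occurs, so the union bound over pairs is used
  with \<open>K = 1\<close> and loses nothing.\<close>

lemma pr_not_joined_le:
  assumes W: "W1 \<subseteq> B0 k" "W2 \<subseteq> B0 k" "W1 \<inter> W2 = {}"
    and U: "determined_by (edges_within W1) U1" "determined_by (edges_within W2) U2"
    and sub: "\<And>\<omega>. U1 \<omega> \<subseteq> W1" "\<And>\<omega>. U2 \<omega> \<subseteq> W2" and "0 \<le> s" "0 \<le> t"
  shows "Pr (\<lambda>\<omega>. s \<le> real (card (U1 \<omega>)) \<and> t \<le> real (card (U2 \<omega>)) \<and>
      (\<forall>e\<in>edges_between (U1 \<omega>) (U2 \<omega>). \<not> \<omega> e)) \<le> exp (- a * (s * t) / b1 ^ k)"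
    (is "Pr ?P \<le> ?d")
proof -
  let ?I = "{S\<in>Pow W1. s \<le> real (card S)} \<times> {S\<in>Pow W2. t \<le> real (card S)}"
  let ?F = "\<lambda>i \<omega>. U1 \<omega> = fst i \<and> U2 \<omega> = snd i"
  let ?G = "\<lambda>i \<omega>. \<forall>e\<in>edges_between (fst i) (snd i). \<not> \<omega> e"
  have fin: "finite W1" "finite W2" using W finite_hball[OF zero_V] by (auto intro: finite_subset)
  have V: "W1 \<subseteq> V" "W2 \<subseteq> V" using W hball_subset by blast+
  have eq: "?P = (\<lambda>\<omega>. \<exists>i\<in>?I. ?F i \<omega> \<and> ?G i \<omega>)" using sub by (auto simp: fun_eq_iff)
  have "Pr (\<lambda>\<omega>. \<exists>i\<in>?I. ?F i \<omega> \<and> ?G i \<omega>) \<le> 1 * ?d"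
  proof (rule pr_ex_conj_le[of "edges_within W1 \<union> edges_within W2" "edges_between W1 W2"])
    show "(edges_within W1 \<union> edges_within W2) \<inter> edges_between W1 W2 = {}"
      using edges_within_between_disjoint[OF W(3)] by blast
    show "finite ?I" using fin by simp
    fix i assume i: "i \<in> ?I"
    show "determined_by (edges_within W1 \<union> edges_within W2) (?F i)"
      by (rule determined_by_conj_Un[OF determined_by_comp[OF U(1), of "\<lambda>S. S = fst i"]
            determined_by_comp[OF U(2), of "\<lambda>S. S = snd i"]])
    show "determined_by (edges_between W1 W2) (?G i)"
      using i by (intro determined_by_closed edges_between_mono) auto
    have sub': "fst i \<subseteq> W1" "snd i \<subseteq> W2" and sz: "s \<le> real (card (fst i))" "t \<le> real (card (snd i))"
      using i by auto
    have "card (edges_between (fst i) (snd i)) = card (fst i) * card (snd i)"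
      using sub' W(3) fin by (intro card_edges_between) (auto intro: finite_subset)
    moreover have "s * t \<le> real (card (fst i)) * real (card (snd i))"
      using sz \<open>0 \<le> s\<close> \<open>0 \<le> t\<close> by (intro mult_mono) auto
    ultimately show "Pr (?G i) \<le> ?d"
      using sub' W by (intro pr_closed_le edges_between_subset_within) auto
  next
    fix \<omega>
    have "{i\<in>?I. ?F i \<omega>} \<subseteq> {(U1 \<omega>, U2 \<omega>)}" by auto
    from card_mono[OF _ this] show "real (card {i\<in>?I. ?F i \<omega>}) \<le> 1" by simp
  qed (use fin V in \<open>simp_all add: finite_edges_between edges_between_subset\<close>)
  then show ?thesis unfolding eq by (simp only: mult_1)
qed

text \<open>The shell at distance \<open>j\<close> has at most \<open>N ^ j\<close> vertices, each
  of weight \<open>1 / b ^ j\<close>.\<close>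

lemma sum_shell_le:
  assumes "u \<in> B0 n" "n \<le> k"
  shows "(\<Sum>v\<in>B0 k - B0 n. 1 / b ^ hier_dist u v) \<le> (\<Sum>j\<in>{n<..k}. (N / b) ^ j)"
  using assms(2)
proof (induction k rule: dec_induct)
  case base then show ?case by simp
next
  case (step k)
  have sub: "B0 n \<subseteq> B0 k" "B0 k \<subseteq> B0 (Suc k)" using step by (auto intro!: hball_mono)
  have fin: "finite (B0 k)" "finite (B0 (Suc k))" using finite_hball[OF zero_V] by auto
  have "(\<Sum>v\<in>B0 (Suc k) - B0 n. 1 / b ^ hier_dist u v) =
      (\<Sum>v\<in>B0 k - B0 n. 1 / b ^ hier_dist u v) + (\<Sum>v\<in>B0 (Suc k) - B0 k. 1 / b ^ hier_dist u v)"
    using sub fin by (subst sum.union_disjoint[symmetric]) (auto intro!: sum.cong)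
  also have "(\<Sum>v\<in>B0 (Suc k) - B0 k. 1 / b ^ hier_dist u v) = (\<Sum>v\<in>B0 (Suc k) - B0 k. 1 / b ^ Suc k)"
  proof (rule sum.cong[OF refl])
    fix v assume v: "v \<in> B0 (Suc k) - B0 k"
    have u: "u \<in> B0 k" using assms(1) sub by auto
    have "k < hier_dist u v" using hier_dist_shell[OF u] v by auto
    moreover have "hier_dist u v \<le> Suc k"
      using u v sub by (intro hier_dist_le_in_hball[of u N _ "\<lambda>_. 0"]) auto
    ultimately have "hier_dist u v = Suc k" by simp
    then show "1 / b ^ hier_dist u v = 1 / b ^ Suc k" by simp
  qed
  also have "\<dots> = real (card (B0 (Suc k) - B0 k)) / b ^ Suc k" by simp
  also have "\<dots> \<le> real (N ^ Suc k) / b ^ Suc k"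
  proof (rule divide_right_mono)
    have "card (B0 (Suc k) - B0 k) \<le> card (B0 (Suc k))" using fin by (intro card_mono) auto
    then show "real (card (B0 (Suc k) - B0 k)) \<le> real (N ^ Suc k)"
      by (simp only: card_hball[OF zero_V] of_nat_le_iff)
  qed (use b_pos in simp)
  also have "\<dots> = (N / b) ^ Suc k" by (simp add: power_divide)
  finally show ?case using step by (simp add: atLeastSucAtMost_greaterThanAtMost[symmetric] sum.atLeast_Suc_atMost
        sum.nat_ivl_Suc')
qed

lemma pr_no_exit_ge:
  assumes "C \<subseteq> B0 n" "n \<le> k" "real (card C) \<le> s"
  shows "exp (- a * s * (\<Sum>j\<in>{n<..k}. (N / b) ^ j)) \<le> Pr (\<lambda>\<omega>. \<forall>e\<in>edges_between C (B0 k - B0 n). \<not> \<omega> e)"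
proof -
  have fin: "finite C" "finite (B0 k - B0 n)"
    using assms(1) finite_hball[OF zero_V] by (auto intro: finite_subset)
  have "(\<Sum>e\<in>edges_between C (B0 k - B0 n). 1 / b ^ pair_dist e) =
      (\<Sum>u\<in>C. \<Sum>v\<in>B0 k - B0 n. 1 / b ^ hier_dist u v)"
    using assms(1) fin by (intro sum_edges_between[of _ _ "\<lambda>d. 1 / b ^ d"]) auto
  also have "\<dots> \<le> (\<Sum>u\<in>C. \<Sum>j\<in>{n<..k}. (N / b) ^ j)"
    using assms by (intro sum_mono sum_shell_le) auto
  also have "\<dots> \<le> s * (\<Sum>j\<in>{n<..k}. (N / b) ^ j)"
    using assms(3) b_pos by (auto intro!: mult_right_mono sum_nonneg)
  finally have "a * (\<Sum>e\<in>edges_between C (B0 k - B0 n). 1 / b ^ pair_dist e) \<le>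
      a * (s * (\<Sum>j\<in>{n<..k}. (N / b) ^ j))"
    using a_pos by (intro mult_left_mono) auto
  moreover have "edges_between C (B0 k - B0 n) \<subseteq> E"
    using assms(1) hball_subset by (intro edges_between_subset) blast+
  ultimately show ?thesis
    using pr_closed[OF finite_edges_between[OF fin]] by (simp add: mult.assoc)
qed

lemma determined_by_C0: "determined_by (edges_within (B0 n)) (C0 n)"
  by (rule determined_by_local_cluster)

lemma C0_subset: "C0 n \<omega> \<subseteq> B0 n"
  by (rule local_cluster_subset[OF center_in_hball[OF zero_V]])

lemma finite_C0: "finite (C0 n \<omega>)"
  using C0_subset finite_hball[OF zero_V] finite_subset by blast

lemma C0_mono: "n \<le> m \<Longrightarrow> C0 n \<omega> \<subseteq> C0 m \<omega>"
  by (intro local_cluster_mono hball_mono)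

lemma determined_by_C0': "n \<le> k \<Longrightarrow> determined_by (edges_within (B0 k)) (C0 n)"
  by (rule determined_by_mono[OF determined_by_C0]) (intro edges_between_mono hball_mono)

text \<open>Once \<open>C0 n \<omega>\<close> is known to be \<open>C\<close>, the edges from
  \<open>C\<close> to the outside of the ball are still unexplored, and if all are closed the
  cluster stops growing. The events \<open>C0 n \<omega> = C\<close> are disjoint, so the lower
  bounds add up.\<close>

lemma pr_C0_stays_ge:
  assumes "\<And>C. C \<in> \<C> \<Longrightarrow> real (card C) \<le> s" "n \<le> k"
  shows "Pr (\<lambda>\<omega>. C0 n \<omega> \<in> \<C>) * exp (- a * s * (\<Sum>j\<in>{n<..k}. (N / b) ^ j))
    \<le> Pr (\<lambda>\<omega>. C0 n \<omega> \<in> \<C> \<and> C0 k \<omega> = C0 n \<omega>)"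
proof -
  let ?I = "\<C> \<inter> Pow (B0 n)"
  let ?Y = "B0 k - B0 n"
  have Bk: "B0 n \<subseteq> B0 k" using assms(2) by (rule hball_mono)
  have fin: "finite (B0 n)" "finite ?Y" using finite_hball[OF zero_V] by auto
  have V: "B0 n \<subseteq> V" "?Y \<subseteq> V" using hball_subset by blast+
  have finite_I: "finite ?I" using fin by simp
  have det: "determined_by (edges_between (B0 n) ?Y) (\<lambda>\<omega>. \<forall>e\<in>edges_between C ?Y. \<not> \<omega> e)"
    if "C \<in> ?I" for C
    using that by (intro determined_by_closed edges_between_mono) auto
  have low: "exp (- a * s * (\<Sum>j\<in>{n<..k}. (N / b) ^ j)) \<le>
      Pr (\<lambda>\<omega>. \<forall>e\<in>edges_between C ?Y. \<not> \<omega> e)" if "C \<in> ?I" for C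
    using that assms by (intro pr_no_exit_ge) auto
  have disj: "C0 n \<omega> = C \<Longrightarrow> C0 n \<omega> = D \<Longrightarrow> C = D" for C D \<omega> by (rule trans[OF sym])
  have eq: "(\<lambda>\<omega>. C0 n \<omega> \<in> \<C>) = (\<lambda>\<omega>. \<exists>C\<in>?I. C0 n \<omega> = C)"
    using C0_subset by (auto simp: fun_eq_iff)
  have "Pr (\<lambda>\<omega>. \<exists>C\<in>?I. C0 n \<omega> = C) * exp (- a * s * (\<Sum>j\<in>{n<..k}. (N / b) ^ j)) \<le>
      Pr (\<lambda>\<omega>. \<exists>C\<in>?I. C0 n \<omega> = C \<and> (\<forall>e\<in>edges_between C ?Y. \<not> \<omega> e))"
    by (rule pr_ex_conj_ge[OF edges_hball[OF zero_V] finite_edges_between[OF fin]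
          edges_between_subset[OF V] edges_within_between_disjoint(1) finite_I
          determined_by_comp[OF determined_by_C0] det low exp_ge_zero disj]) auto
  also have "\<dots> \<le> Pr (\<lambda>\<omega>. C0 n \<omega> \<in> \<C> \<and> C0 k \<omega> = C0 n \<omega>)"
  proof (rule pr_mono[OF edges_hball[OF zero_V, of k]])
    show "determined_by (edges_within (B0 k)) (\<lambda>\<omega>. C0 n \<omega> \<in> \<C> \<and> C0 k \<omega> = C0 n \<omega>)"
      by (rule determined_by_comp2[OF determined_by_C0'[OF assms(2)] determined_by_C0,
            of "\<lambda>C D. C \<in> \<C> \<and> D = C"])
    fix \<omega> assume "\<exists>C\<in>?I. C0 n \<omega> = C \<and> (\<forall>e\<in>edges_between C ?Y. \<not> \<omega> e)"
    then show "C0 n \<omega> \<in> \<C> \<and> C0 k \<omega> = C0 n \<omega>"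
      using local_cluster_no_exit[OF center_in_hball[OF zero_V] Bk] by auto
  qed
  finally show ?thesis unfolding eq .
qed

lemma cluster_0_eq: "cluster N \<omega> (\<lambda>_. 0) = (\<Union>k. C0 k \<omega>)"
  using N_ge_2 by (intro cluster_eq_UN) auto

lemma pr_all_ge:
  assumes "\<And>i::nat. {\<omega> \<in> space \<PP>. Q i \<omega>} \<in> sets \<PP>" "\<And>i \<omega>. Q (Suc i) \<omega> \<Longrightarrow> Q i \<omega>"
    and "\<And>i. c \<le> Pr (Q i)"
  shows "c \<le> Pr (\<lambda>\<omega>. \<forall>i. Q i \<omega>)"
proof -
  have "(\<lambda>i. prob {\<omega> \<in> space \<PP>. Q i \<omega>}) \<longlonglongrightarrow> prob (\<Inter>i. {\<omega> \<in> space \<PP>. Q i \<omega>})"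
    using assms(1,2) by (intro finite_Lim_measure_decseq) (auto intro!: decseq_SucI)
  moreover have "(\<Inter>i. {\<omega> \<in> space \<PP>. Q i \<omega>}) = {\<omega> \<in> space \<PP>. \<forall>i. Q i \<omega>}" by auto
  ultimately show ?thesis
    using assms(3) unfolding pr_def by (intro LIMSEQ_le_const) auto
qed

lemma pr_ex_limit:
  assumes "\<And>i::nat. {\<omega> \<in> space \<PP>. Q i \<omega>} \<in> sets \<PP>" "\<And>i \<omega>. Q i \<omega> \<Longrightarrow> Q (Suc i) \<omega>"
  shows "(\<lambda>i. Pr (Q i)) \<longlonglongrightarrow> Pr (\<lambda>\<omega>. \<exists>i. Q i \<omega>)"
proof -
  have "(\<lambda>i. prob {\<omega> \<in> space \<PP>. Q i \<omega>}) \<longlonglongrightarrow> prob (\<Union>i. {\<omega> \<in> space \<PP>. Q i \<omega>})"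
    using assms by (intro finite_Lim_measure_incseq) (auto intro!: incseq_SucI)
  moreover have "(\<Union>i. {\<omega> \<in> space \<PP>. Q i \<omega>}) = {\<omega> \<in> space \<PP>. \<exists>i. Q i \<omega>}" by auto
  ultimately show ?thesis unfolding pr_def by simp
qed

section \<open>Confinement to a ball and the percolation probability\<close>

lemma C0_event_sets: "{\<omega> \<in> space \<PP>. C0 n \<omega> \<in> \<C>} \<in> sets \<PP>"
  by (rule determined_event_sets[OF edges_hball[OF zero_V] determined_by_comp[OF determined_by_C0]])

definition confined :: "nat \<Rightarrow> config \<Rightarrow> bool" where
  "confined m \<omega> \<longleftrightarrow> cluster N \<omega> (\<lambda>_. 0) \<subseteq> B0 m"

lemma confined_iff: "confined m \<omega> \<longleftrightarrow> (\<forall>k. C0 k \<omega> \<subseteq> B0 m)"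
  by (auto simp: confined_def cluster_0_eq)

lemma confined_sets: "{\<omega> \<in> space \<PP>. confined m \<omega>} \<in> sets \<PP>"
proof -
  have "{\<omega> \<in> space \<PP>. confined m \<omega>} = (\<Inter>k. {\<omega> \<in> space \<PP>. C0 k \<omega> \<in> Pow (B0 m)})"
    by (auto simp: confined_iff)
  also have "\<dots> \<in> sets \<PP>" by (intro sets.countable_INT image_subsetI C0_event_sets) simp
  finally show ?thesis .
qed

lemma confined_mono: "m \<le> n \<Longrightarrow> confined m \<omega> \<Longrightarrow> confined n \<omega>"
  using hball_mono[of m n N "\<lambda>_. 0"] by (auto simp: confined_def)

lemma finite_cluster_iff: "finite (cluster N \<omega> (\<lambda>_. 0)) \<longleftrightarrow> (\<exists>m. confined m \<omega>)"
proof
  assume "finite (cluster N \<omega> (\<lambda>_. 0))"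
  moreover have "cluster N \<omega> (\<lambda>_. 0) \<subseteq> (\<Union>m. B0 m)"
    using C0_subset by (fastforce simp: cluster_0_eq)
  ultimately have "\<exists>m. cluster N \<omega> (\<lambda>_. 0) \<subseteq> B0 m"
  proof (induction rule: finite_induct)
    case (insert x F)
    then obtain m n where mn: "F \<subseteq> B0 m" "x \<in> B0 n" by auto
    then have "insert x F \<subseteq> B0 (max m n)"
      using hball_mono[of m "max m n" N "\<lambda>_. 0"] hball_mono[of n "max m n" N "\<lambda>_. 0"] by auto
    then show ?case by blast
  qed simp
  then show "\<exists>m. confined m \<omega>" by (simp add: confined_def)
qed (use finite_hball[OF zero_V] finite_subset in \<open>auto simp: confined_def\<close>)

lemma percolation_prob_eq: "percolation_prob N a b = 1 - Pr (\<lambda>\<omega>. \<exists>m. confined m \<omega>)"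
proof -
  have "{\<omega> \<in> space \<PP>. \<exists>m. confined m \<omega>} = (\<Union>m. {\<omega> \<in> space \<PP>. confined m \<omega>})" by auto
  also have "\<dots> \<in> sets \<PP>" using confined_sets by (intro sets.countable_UN) auto
  finally have "{\<omega> \<in> space \<PP>. \<exists>m. confined m \<omega>} \<in> sets \<PP>" .
  moreover have "{\<omega> \<in> space \<PP>. infinite (cluster N \<omega> (\<lambda>_. 0))} =
      space \<PP> - {\<omega> \<in> space \<PP>. \<exists>m. confined m \<omega>}"
    unfolding finite_cluster_iff by blast
  ultimately show ?thesis
    unfolding percolation_prob_def pr_def using prob_compl by simp
qed

lemma pr_confined_tendsto: "(\<lambda>m. Pr (confined m)) \<longlonglongrightarrow> 1 - percolation_prob N a b"
  using pr_ex_limit[of confined, OF confined_sets confined_mono[OF le_SucI[OF order_refl]]]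
  by (simp add: percolation_prob_eq)

lemma pr_confined_le: "Pr (confined m) \<le> 1 - percolation_prob N a b"
  by (rule incseq_le[OF _ pr_confined_tendsto])
    (intro incseq_SucI pr_mono_sets confined_sets, rule confined_mono, auto)

text \<open>Confinement is a decreasing intersection of finite events, which approximate it from
  above; \<open>pr_cluster_stays_ge\<close> supplies the approximation from below.\<close>

lemma C0_tendsto_confined:
  "(\<lambda>n. Pr (\<lambda>\<omega>. C0 n \<omega> \<subseteq> B0 m)) \<longlonglongrightarrow> Pr (confined m)"
proof -
  have "(\<lambda>n. prob {\<omega> \<in> space \<PP>. C0 n \<omega> \<in> Pow (B0 m)}) \<longlonglongrightarrow> prob (\<Inter>n. {\<omega> \<in> space \<PP>. C0 n \<omega> \<in> Pow (B0 m)})"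
  proof (rule finite_Lim_measure_decseq)
    show "range (\<lambda>n. {\<omega> \<in> space \<PP>. C0 n \<omega> \<in> Pow (B0 m)}) \<subseteq> sets \<PP>"
      by (intro image_subsetI C0_event_sets)
    show "decseq (\<lambda>n. {\<omega> \<in> space \<PP>. C0 n \<omega> \<in> Pow (B0 m)})"
      unfolding decseq_Suc_iff using C0_mono[OF le_SucI[OF order_refl]] by blast
  qed
  moreover have "(\<Inter>n. {\<omega> \<in> space \<PP>. C0 n \<omega> \<in> Pow (B0 m)}) = {\<omega> \<in> space \<PP>. confined m \<omega>}"
    by (auto simp: confined_iff)
  ultimately show ?thesis unfolding pr_def by simp
qed

text \<open>For \<open>N < b\<close> the exit weights form a convergent geometric series. The lemma
  is used in two regimes: for fixed \<open>s\<close> the exponential factor tends to 1 as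
  \<open>n\<close> grows, which gives upper semicontinuity; for \<open>s = A * (b / N) ^ n\<close>
  it does not depend on \<open>n\<close>, which makes small clusters that leave a fixed ball
  unlikely.\<close>

lemma pr_cluster_stays_ge:
  assumes "N < b" "\<And>C. C \<in> \<C> \<Longrightarrow> real (card C) \<le> s" "0 \<le> s"
  shows "Pr (\<lambda>\<omega>. C0 n \<omega> \<in> \<C>) * exp (- a * s * ((N / b) ^ Suc n / (1 - N / b)))
    \<le> Pr (\<lambda>\<omega>. C0 n \<omega> \<in> \<C> \<and> confined n \<omega>)"
proof -
  let ?r = "N / b"
  have r: "0 \<le> ?r" "?r < 1" using assms(1) b_pos by auto
  let ?Q = "\<lambda>i \<omega>. C0 n \<omega> \<in> \<C> \<and> C0 (n + i) \<omega> = C0 n \<omega>"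
  have det: "determined_by (edges_within (B0 (n + i))) (?Q i)" for i
    by (rule determined_by_comp2[OF determined_by_C0'[OF le_add1] determined_by_C0,
          where h = "\<lambda>C D. C \<in> \<C> \<and> D = C"])
  have "Pr (\<lambda>\<omega>. C0 n \<omega> \<in> \<C>) * exp (- a * s * (?r ^ Suc n / (1 - ?r))) \<le> Pr (\<lambda>\<omega>. \<forall>i. ?Q i \<omega>)"
  proof (rule pr_all_ge)
    show "{\<omega> \<in> space \<PP>. ?Q i \<omega>} \<in> sets \<PP>" for i
      by (rule determined_event_sets[OF edges_hball[OF zero_V] det])
    show "?Q i \<omega>" if "?Q (Suc i) \<omega>" for i \<omega>
      using that C0_mono[of n "n + i" \<omega>] C0_mono[of "n + i" "n + Suc i" \<omega>] by auto
    fix i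
    have "(\<Sum>j\<in>{n<..n + i}. ?r ^ j) \<le> ?r ^ Suc n / (1 - ?r)"
    proof -
      have "(\<Sum>j\<in>{n<..n + i}. ?r ^ j) = (\<Sum>j<i. ?r ^ Suc n * ?r ^ j)"
        by (rule sum.reindex_bij_witness[where i="\<lambda>j. Suc n + j" and j="\<lambda>j. j - Suc n"])
          (auto simp flip: power_add power_Suc)
      also have "\<dots> = ?r ^ Suc n * ((1 - ?r ^ i) / (1 - ?r))"
        using r by (subst sum_distrib_left[symmetric], subst sum_gp_strict) auto
      also have "\<dots> \<le> ?r ^ Suc n * (1 / (1 - ?r))"
        using r by (intro mult_left_mono divide_right_mono zero_le_power) auto
      finally show ?thesis by simp
    qed
    then have "a * s * (\<Sum>j\<in>{n<..n + i}. ?r ^ j) \<le> a * s * (?r ^ Suc n / (1 - ?r))"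
      using assms(3) a_pos by (intro mult_left_mono) auto
    then have "exp (- a * s * (?r ^ Suc n / (1 - ?r))) \<le> exp (- a * s * (\<Sum>j\<in>{n<..n + i}. ?r ^ j))"
      by simp
    then have "Pr (\<lambda>\<omega>. C0 n \<omega> \<in> \<C>) * exp (- a * s * (?r ^ Suc n / (1 - ?r))) \<le>
       Pr (\<lambda>\<omega>. C0 n \<omega> \<in> \<C>) * exp (- a * s * (\<Sum>j\<in>{n<..n + i}. ?r ^ j))"
      using pr_nonneg by (rule mult_left_mono)
    also have "\<dots> \<le> Pr (?Q i)" by (rule pr_C0_stays_ge) (use assms in auto)
    finally show "Pr (\<lambda>\<omega>. C0 n \<omega> \<in> \<C>) * exp (- a * s * (?r ^ Suc n / (1 - ?r))) \<le> Pr (?Q i)" .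
  qed
  also have "\<dots> \<le> Pr (\<lambda>\<omega>. C0 n \<omega> \<in> \<C> \<and> confined n \<omega>)"
  proof (rule pr_mono_sets)
    have "{\<omega> \<in> space \<PP>. C0 n \<omega> \<in> \<C> \<and> confined n \<omega>} =
        {\<omega> \<in> space \<PP>. C0 n \<omega> \<in> \<C>} \<inter> {\<omega> \<in> space \<PP>. confined n \<omega>}" by auto
    then show "{\<omega> \<in> space \<PP>. C0 n \<omega> \<in> \<C> \<and> confined n \<omega>} \<in> sets \<PP>"
      using C0_event_sets confined_sets by simp
    fix \<omega> assume Q: "\<forall>i. ?Q i \<omega>"
    have "C0 k \<omega> \<subseteq> B0 n" for k
    proof (cases "k \<le> n")
      case True then show ?thesis using C0_mono C0_subset by blast
    next
      case False
      then have "C0 k \<omega> = C0 n \<omega>" using Q[rule_format, of "k - n"] by simp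
      then show ?thesis using C0_subset by blast
    qed
    then show "C0 n \<omega> \<in> \<C> \<and> confined n \<omega>" using Q by (simp add: confined_iff)
  qed
  finally show ?thesis .
qed

end


section \<open>Renormalisation\<close>

text \<open>One large cluster per ball is singled out as a function of the edges inside the ball, so
  that edges between two balls are independent of the choice. The default is empty, hence of size
  below any positive \<open>s\<close>.\<close>

definition chosen_cluster :: "vertex set \<Rightarrow> real \<Rightarrow> config \<Rightarrow> vertex set" where
  "chosen_cluster W s \<omega> = (if large_cluster W s \<omega>
     then local_cluster W \<omega> (SOME u. u \<in> W \<and> s \<le> real (card (local_cluster W \<omega> u))) else {})"

lemma determined_by_chosen_cluster: "determined_by (edges_within W) (chosen_cluster W s)"
  unfolding determined_by_def
proof (intro allI impI)
  fix \<omega> \<omega>' :: config assume *: "\<forall>e\<in>edges_within W. \<omega> e = \<omega>' e"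
  have "local_cluster W \<omega> u = local_cluster W \<omega>' u" for u
    by (rule determined_by_D[OF determined_by_local_cluster]) (use * in auto)
  then show "chosen_cluster W s \<omega> = chosen_cluster W s \<omega>'"
    by (simp add: chosen_cluster_def large_cluster_def)
qed

lemma chosen_cluster_large:
  assumes "large_cluster W s \<omega>"
  obtains u where "u \<in> W" "s \<le> real (card (local_cluster W \<omega> u))"
    "chosen_cluster W s \<omega> = local_cluster W \<omega> u"
proof -
  let ?P = "\<lambda>u. u \<in> W \<and> s \<le> real (card (local_cluster W \<omega> u))"
  have "?P (SOME u. ?P u)" by (rule someI_ex[of ?P]) (use assms in \<open>auto simp: large_cluster_def\<close>)
  then show thesis using assms by (intro that[of "SOME u. ?P u"]) (simp_all add: chosen_cluster_def)
qed

lemma chosen_cluster_subset: "chosen_cluster W s \<omega> \<subseteq> W"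
proof (cases "large_cluster W s \<omega>")
  case True
  then show ?thesis by (rule chosen_cluster_large) (use local_cluster_subset in auto)
qed (simp add: chosen_cluster_def)

context percolation_model
begin

text \<open>The representatives are the centres of the balls of radius \<open>n\<close> that tile the ball of radius
  \<open>n + L\<close> around the origin.\<close>

definition reps :: "nat \<Rightarrow> nat \<Rightarrow> vertex set" where
  "reps n L = box N (\<lambda>_. 0) {n<..n + L}"

lemma card_reps: "card (reps n L) = N ^ L" and finite_reps: "finite (reps n L)"
  unfolding reps_def using card_box[OF zero_V, of "{n<..n + L}"] by auto

lemma zero_in_reps: "(\<lambda>_. 0) \<in> reps n L"
  by (simp add: reps_def box_def zero_V)

lemma reps_V: "y \<in> reps n L \<Longrightarrow> y \<in> V"
  by (simp add: reps_def box_def)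

lemma reps_ball_subset: "y \<in> reps n L \<Longrightarrow> B n y \<subseteq> B0 (n + L)"
  by (auto simp: reps_def box_def hball_def)

lemma reps_ball_disjoint:
  assumes "y \<in> reps n L" "z \<in> reps n L" "y \<noteq> z" shows "B n y \<inter> B n z = {}"
proof (rule ccontr)
  assume "B n y \<inter> B n z \<noteq> {}"
  then obtain w where w: "w \<in> B n y" "w \<in> B n z" by auto
  have "y i = z i" for i
    using w assms(1,2) by (cases "n < i") (auto simp: hball_def reps_def box_def)
  then show False using assms(3) by auto
qed

lemma ex_nonzero_rep:
  assumes "1 \<le> L" shows "\<exists>y\<in>reps n L. y \<noteq> (\<lambda>_. 0)"
proof -
  have "2 \<le> N ^ L" using N_ge_2 power_increasing[OF assms, of N] by simp
  then have "\<not> reps n L \<subseteq> {\<lambda>_. 0}" using card_reps[of n L] card_mono[of "{\<lambda>_. 0}" "reps n L"] by auto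
  then show ?thesis by auto
qed

lemma pr_two_not_large:
  assumes "y \<in> reps n L" "z \<in> reps n L" "y \<noteq> z"
  shows "Pr (\<lambda>\<omega>. \<not> large_cluster (B n y) s \<omega> \<and> \<not> large_cluster (B n z) s \<omega>)
    = (1 - Pr (large_cluster (B0 n) s))\<^sup>2"
proof -
  have det: "determined_by (edges_within (B n x)) (\<lambda>\<omega>. \<not> large_cluster (B n x) s \<omega>)" for x
    by (rule determined_by_comp[OF determined_by_large_cluster])
  have one: "Pr (\<lambda>\<omega>. \<not> large_cluster (B n x) s \<omega>) = 1 - Pr (large_cluster (B0 n) s)" if "x \<in> V" for x
    by (simp only: pr_not[OF edges_hball[OF that] determined_by_large_cluster]
        pr_large_cluster_transitive[OF that])
  have V: "y \<in> V" "z \<in> V" using assms reps_V by auto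
  have "Pr (\<lambda>\<omega>. \<not> large_cluster (B n y) s \<omega> \<and> \<not> large_cluster (B n z) s \<omega>) =
      Pr (\<lambda>\<omega>. \<not> large_cluster (B n y) s \<omega>) * Pr (\<lambda>\<omega>. \<not> large_cluster (B n z) s \<omega>)"
    by (rule pr_indep[OF edges_hball[OF V(1)] det edges_hball[OF V(2)] det
          edges_within_disjoint[OF reps_ball_disjoint[OF assms]]])
  then show ?thesis by (simp only: one[OF V(1)] one[OF V(2)] power2_eq_square)
qed

text \<open>The size conditions rule out the empty default of \<open>chosen_cluster\<close> when
  \<open>0 < s\<close>; without an actual cluster the absence of edges would be vacuous.\<close>

definition unjoined :: "nat \<Rightarrow> real \<Rightarrow> vertex \<Rightarrow> vertex \<Rightarrow> config \<Rightarrow> bool" where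
  "unjoined n s y z \<omega> \<longleftrightarrow>
     s \<le> real (card (chosen_cluster (B n y) s \<omega>)) \<and> s \<le> real (card (chosen_cluster (B n z) s \<omega>)) \<and>
     (\<forall>e\<in>edges_between (chosen_cluster (B n y) s \<omega>) (chosen_cluster (B n z) s \<omega>). \<not> \<omega> e)"

text \<open>The set of inspected edges is itself random, but it is a function of the edges of
  \<open>A\<close> and always contained in \<open>A\<close>.\<close>

lemma determined_by_no_edge_between:
  assumes "determined_by A U1" "determined_by A U2"
    and "\<And>\<omega>. U1 \<omega> \<subseteq> X" "\<And>\<omega>. U2 \<omega> \<subseteq> Y" "edges_between X Y \<subseteq> A"
  shows "determined_by A (\<lambda>\<omega>. s \<le> real (card (U1 \<omega>)) \<and> t \<le> real (card (U2 \<omega>)) \<and>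
      (\<forall>e\<in>edges_between (U1 \<omega>) (U2 \<omega>). \<not> \<omega> e))"
  unfolding determined_by_def
proof (intro allI impI)
  fix \<omega> \<omega>' :: config assume *: "\<forall>e\<in>A. \<omega> e = \<omega>' e"
  have eq: "U1 \<omega> = U1 \<omega>'" "U2 \<omega> = U2 \<omega>'"
    using determined_by_D[OF assms(1), of \<omega> \<omega>'] determined_by_D[OF assms(2), of \<omega> \<omega>'] * by auto
  have "edges_between (U1 \<omega>') (U2 \<omega>') \<subseteq> A"
    using edges_between_mono[OF assms(3,4)] assms(5) by blast
  then have "(\<forall>e\<in>edges_between (U1 \<omega>') (U2 \<omega>'). \<not> \<omega> e) \<longleftrightarrow>
      (\<forall>e\<in>edges_between (U1 \<omega>') (U2 \<omega>'). \<not> \<omega>' e)" using * by blast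
  then show "(s \<le> real (card (U1 \<omega>)) \<and> t \<le> real (card (U2 \<omega>)) \<and>
      (\<forall>e\<in>edges_between (U1 \<omega>) (U2 \<omega>). \<not> \<omega> e)) =
    (s \<le> real (card (U1 \<omega>')) \<and> t \<le> real (card (U2 \<omega>')) \<and>
      (\<forall>e\<in>edges_between (U1 \<omega>') (U2 \<omega>'). \<not> \<omega>' e))" unfolding eq by simp
qed

lemma determined_by_mono_hball:
  assumes "determined_by (edges_within (B n y)) f" "y \<in> reps n L"
  shows "determined_by (edges_within (B0 (n + L))) f"
  using assms(1) by (rule determined_by_mono) (intro edges_between_mono reps_ball_subset assms(2))

lemma determined_by_unjoined:
  assumes "y \<in> reps n L" "z \<in> reps n L"
  shows "determined_by (edges_within (B0 (n + L))) (unjoined n s y z)"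
  unfolding unjoined_def[abs_def]
  by (rule determined_by_no_edge_between[OF
        determined_by_mono_hball[OF determined_by_chosen_cluster assms(1)]
        determined_by_mono_hball[OF determined_by_chosen_cluster assms(2)]
        chosen_cluster_subset chosen_cluster_subset
        edges_between_mono[OF reps_ball_subset[OF assms(1)] reps_ball_subset[OF assms(2)]]])

lemma pr_unjoined_le:
  assumes "y \<in> reps n L" "z \<in> reps n L" "y \<noteq> z" "0 \<le> s"
  shows "Pr (unjoined n s y z) \<le> exp (- a * (s * s) / b1 ^ (n + L))"
  unfolding unjoined_def[abs_def]
  by (rule pr_not_joined_le[OF reps_ball_subset[OF assms(1)] reps_ball_subset[OF assms(2)]
        reps_ball_disjoint[OF assms(1-3)] determined_by_chosen_cluster determined_by_chosen_cluster
        chosen_cluster_subset chosen_cluster_subset assms(4,4)])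

text \<open>All subballs but at most one have a large cluster, and each chosen cluster is joined
  directly to that of a fixed subball \<open>y0\<close>; the sizes of these disjoint sets add up.
  Tolerating one bad subball costs some density, but failure then requires two independent bad
  subballs.\<close>

lemma large_cluster_renormalise:
  assumes "1 \<le> L" "0 < s"
    and few_bad: "\<And>y z. y \<in> reps n L \<Longrightarrow> z \<in> reps n L \<Longrightarrow> y \<noteq> z \<Longrightarrow>
      large_cluster (B n y) s \<omega> \<or> large_cluster (B n z) s \<omega>"
    and joined: "\<And>y z. y \<in> reps n L \<Longrightarrow> z \<in> reps n L \<Longrightarrow> y \<noteq> z \<Longrightarrow> \<not> unjoined n s y z \<omega>"
  shows "large_cluster (B0 (n + L)) ((real (N ^ L) - 1) * s) \<omega>"
proof -
  let ?R = "reps n L" and ?W = "B0 (n + L)"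
  let ?U = "\<lambda>y. chosen_cluster (B n y) s \<omega>"
  define G where "G = {y\<in>?R. large_cluster (B n y) s \<omega>}"
  have finG: "finite G" "G \<subseteq> ?R" using finite_reps by (auto simp: G_def)
  have "card (?R - G) \<le> 1"
    using few_bad finite_reps by (subst card_le_Suc0_iff_eq[unfolded One_nat_def[symmetric]]) (auto simp: G_def)
  then have cardG: "N ^ L \<le> card G + 1"
    using card_Diff_subset[OF finG] card_mono[OF finite_reps finG(2)] card_reps[of n L] by linarith
  have "2 \<le> N ^ L" using N_ge_2 power_increasing[OF assms(1), of N] by simp
  with cardG have "G \<noteq> {}" by auto
  then obtain y0 where y0: "y0 \<in> G" by auto
  have U: "s \<le> real (card (?U y)) \<and> (\<exists>u\<in>B n y. ?U y = local_cluster (B n y) \<omega> u)" if "y \<in> G" for y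
    using that unfolding G_def by (auto elim!: chosen_cluster_large[of "B n y" s \<omega>])
  obtain u0 where u0: "u0 \<in> B n y0" "?U y0 = local_cluster (B n y0) \<omega> u0" using U[OF y0] by auto
  let ?C = "local_cluster ?W \<omega> u0"
  have sub: "B n y \<subseteq> ?W" if "y \<in> G" for y using that finG reps_ball_subset by blast
  have base: "?U y0 \<subseteq> ?C" unfolding u0(2) by (rule local_cluster_mono[OF sub[OF y0]])
  have "?U y \<subseteq> ?C" if y: "y \<in> G" for y
  proof (cases "y = y0")
    case False
    have "\<not> unjoined n s y0 y \<omega>" using joined[of y0 y] y y0 finG False by auto
    then obtain e where e: "e \<in> edges_between (?U y0) (?U y)" "\<omega> e"
      using U[OF y] U[OF y0] by (auto simp: unjoined_def)
    then obtain p q where pq: "p \<in> ?U y0" "q \<in> ?U y" "\<omega> {p, q}" by (auto simp: edges_between_def)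
    have "p \<in> ?W" "q \<in> ?W" using pq chosen_cluster_subset sub[OF y] sub[OF y0] by blast+
    then have "local_cluster ?W \<omega> p = local_cluster ?W \<omega> q" using pq(3) by (rule local_cluster_edge)
    moreover have "local_cluster ?W \<omega> p = ?C" using pq(1) base by (intro local_cluster_eq) auto
    moreover obtain u where u: "?U y = local_cluster (B n y) \<omega> u" using U[OF y] by auto
    then have "?U y = local_cluster (B n y) \<omega> q" using pq(2) local_cluster_eq by auto
    then have "?U y \<subseteq> local_cluster ?W \<omega> q" using local_cluster_mono[OF sub[OF y]] by auto
    ultimately show ?thesis by simp
  qed (use base in simp)
  then have UN: "(\<Union>y\<in>G. ?U y) \<subseteq> ?C" by blast
  have W0: "u0 \<in> ?W" using u0 sub[OF y0] by auto
  have finC: "finite ?C"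
    using local_cluster_subset[OF W0] finite_hball[OF zero_V] by (rule finite_subset)
  have finU: "finite (?U y)" if "y \<in> G" for y by (rule finite_subset[OF _ finC]) (use UN that in blast)
  have disj: "?U y \<inter> ?U z = {}" if "y \<in> G" "z \<in> G" "y \<noteq> z" for y z
    using reps_ball_disjoint[of y n L z] that finG chosen_cluster_subset by blast
  have "real (N ^ L) \<le> real (card G + 1)" using cardG by (simp only: of_nat_le_iff)
  then have "real (N ^ L) - 1 \<le> real (card G)" by simp
  then have "(real (N ^ L) - 1) * s \<le> real (card G) * s" using assms(2) by (intro mult_right_mono) auto
  also have "\<dots> \<le> (\<Sum>y\<in>G. real (card (?U y)))" using U sum_mono[of G "\<lambda>_. s"] by auto
  also have "\<dots> = real (card (\<Union>y\<in>G. ?U y))"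
    using card_UN_disjoint[of G ?U] finG finU disj by simp
  also have "\<dots> \<le> real (card ?C)" using card_mono[OF finC UN] by simp
  finally show ?thesis unfolding large_cluster_def using W0 by blast
qed

text \<open>Failure at the larger scale needs an ordered pair of subballs that both fail or are
  unjoined, and there are at most \<open>(N ^ L) ^ 2\<close> pairs. The square of the old failure
  probability is what makes the recursion contract.\<close>

lemma pr_renormalise:
  assumes "1 \<le> L" "0 < s"
  shows "1 - Pr (large_cluster (B0 (n + L)) ((real (N ^ L) - 1) * s)) \<le>
    (real (N ^ L))\<^sup>2 * ((1 - Pr (large_cluster (B0 n) s))\<^sup>2 + exp (- a * (s * s) / b1 ^ (n + L)))"
proof -
  let ?W = "B0 (n + L)"
  let ?I = "{i \<in> reps n L \<times> reps n L. fst i \<noteq> snd i}"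
  let ?F = "\<lambda>i \<omega>. (\<not> large_cluster (B n (fst i)) s \<omega> \<and> \<not> large_cluster (B n (snd i)) s \<omega>)
      \<or> unjoined n s (fst i) (snd i) \<omega>"
  let ?d = "(1 - Pr (large_cluster (B0 n) s))\<^sup>2 + exp (- a * (s * s) / b1 ^ (n + L))"
  have fin: "finite ?I" using finite_reps by simp
  have det1: "determined_by (edges_within ?W)
      (\<lambda>\<omega>. \<not> large_cluster (B n y) s \<omega> \<and> \<not> large_cluster (B n z) s \<omega>)"
    if "y \<in> reps n L" "z \<in> reps n L" for y z
    by (rule determined_by_comp2[OF determined_by_mono_hball[OF determined_by_large_cluster that(1)]
          determined_by_mono_hball[OF determined_by_large_cluster that(2)], where h = "\<lambda>x y. \<not> x \<and> \<not> y"])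
  have det: "determined_by (edges_within ?W) (?F i)" if "i \<in> ?I" for i
  proof -
    have i: "fst i \<in> reps n L" "snd i \<in> reps n L" using that by auto
    show ?thesis
      by (rule determined_by_comp2[OF det1[OF i] determined_by_unjoined[OF i], where h = "(\<or>)"])
  qed
  have detW: "determined_by (edges_within ?W) (\<lambda>\<omega>. \<exists>i\<in>?I. ?F i \<omega>)"
    by (rule determined_by_bex[OF det])
  have one: "Pr (?F i) \<le> ?d" if "i \<in> ?I" for i
  proof -
    have i: "fst i \<in> reps n L" "snd i \<in> reps n L" "fst i \<noteq> snd i" using that by auto
    have "Pr (?F i) \<le> Pr (\<lambda>\<omega>. \<not> large_cluster (B n (fst i)) s \<omega> \<and> \<not> large_cluster (B n (snd i)) s \<omega>)
        + Pr (unjoined n s (fst i) (snd i))"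
      by (rule pr_disj_le[OF edges_hball[OF zero_V] det1[OF i(1,2)] determined_by_unjoined[OF i(1,2)]])
    then show ?thesis
      unfolding pr_two_not_large[OF i] using pr_unjoined_le[OF i, of s] assms(2) by linarith
  qed
  have "1 - Pr (large_cluster ?W ((real (N ^ L) - 1) * s)) =
      Pr (\<lambda>\<omega>. \<not> large_cluster ?W ((real (N ^ L) - 1) * s) \<omega>)"
    by (simp only: pr_not[OF edges_hball[OF zero_V] determined_by_large_cluster])
  also have "\<dots> \<le> Pr (\<lambda>\<omega>. \<exists>i\<in>?I. ?F i \<omega>)"
  proof (rule pr_mono[OF edges_hball[OF zero_V] detW], rule ccontr)
    fix \<omega> assume not_large: "\<not> large_cluster ?W ((real (N ^ L) - 1) * s) \<omega>" and
      no: "\<not> (\<exists>i\<in>?I. ?F i \<omega>)"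
    have not_F: "\<not> ?F (y, z) \<omega>" if "y \<in> reps n L" "z \<in> reps n L" "y \<noteq> z" for y z
    proof
      assume "?F (y, z) \<omega>"
      moreover have "(y, z) \<in> ?I" using that by simp
      ultimately have "\<exists>i\<in>?I. ?F i \<omega>" by (rule bexI)
      with no show False by (rule notE)
    qed
    have "large_cluster ?W ((real (N ^ L) - 1) * s) \<omega>"
    proof (rule large_cluster_renormalise[OF assms])
      fix y z assume yz: "y \<in> reps n L" "z \<in> reps n L" "y \<noteq> z"
      show "large_cluster (B n y) s \<omega> \<or> large_cluster (B n z) s \<omega>" "\<not> unjoined n s y z \<omega>"
        using not_F[OF yz] by simp_all
    qed
    with not_large show False by (rule notE)
  qed
  also have "\<dots> \<le> (\<Sum>i\<in>?I. Pr (?F i))" by (rule pr_ex_le[OF edges_hball[OF zero_V] fin det])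
  also have "\<dots> \<le> (\<Sum>i\<in>?I. ?d)" by (rule sum_mono[OF one])
  also have "\<dots> = real (card ?I) * ?d" by simp
  also have "\<dots> \<le> (real (N ^ L))\<^sup>2 * ?d"
  proof (rule mult_right_mono)
    have "card ?I \<le> card (reps n L \<times> reps n L)" using finite_reps by (intro card_mono) auto
    then have "real (card ?I) \<le> real (N ^ L * N ^ L)"
      by (simp only: card_cartesian_product card_reps of_nat_le_iff)
    then show "real (card ?I) \<le> (real (N ^ L))\<^sup>2" by (simp add: power2_eq_square)
  qed simp
  finally show ?thesis .
qed

text \<open>The origin is attached to the large cluster of a different subball \<open>y\<close>,
  because the edges to that subball are independent of both clusters. If \<open>y\<close> has a
  large cluster and the join succeeds, the origin inherits its size.\<close>

lemma pr_origin_grows: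
  assumes "1 \<le> L" "0 < s" "0 \<le> t"
  shows "Pr (\<lambda>\<omega>. t \<le> real (card (C0 n \<omega>))) - (1 - Pr (large_cluster (B0 n) s))
      - exp (- a * (t * s) / b1 ^ (n + L)) \<le> Pr (\<lambda>\<omega>. s \<le> real (card (C0 (n + L) \<omega>)))"
proof -
  let ?W = "B0 (n + L)"
  obtain y where y: "y \<in> reps n L" "y \<noteq> (\<lambda>_. 0)" using ex_nonzero_rep[OF assms(1)] by blast
  have yV: "y \<in> V" using y(1) by (rule reps_V)
  let ?U = "chosen_cluster (B n y) s"
  let ?Q = "\<lambda>\<omega>. t \<le> real (card (C0 n \<omega>)) \<and> s \<le> real (card (?U \<omega>)) \<and>
      (\<forall>e\<in>edges_between (C0 n \<omega>) (?U \<omega>). \<not> \<omega> e)"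
  have sub: "B n y \<subseteq> ?W" "B0 n \<subseteq> ?W" using reps_ball_subset[OF y(1)] hball_mono[of n "n + L"] by auto
  have detU: "determined_by (edges_within ?W) ?U"
    by (rule determined_by_mono_hball[OF determined_by_chosen_cluster y(1)])
  have detC: "determined_by (edges_within ?W) (C0 n)" by (rule determined_by_C0') simp
  have detQ: "determined_by (edges_within ?W) ?Q"
    by (rule determined_by_no_edge_between[OF detC detU C0_subset chosen_cluster_subset
          edges_between_mono[OF sub(2,1)]])
  have detL: "determined_by (edges_within ?W) (\<lambda>\<omega>. \<not> large_cluster (B n y) s \<omega>)"
    by (rule determined_by_comp[OF determined_by_mono_hball[OF determined_by_large_cluster y(1)]])
  have detS: "determined_by (edges_within ?W) (\<lambda>\<omega>. s \<le> real (card (C0 (n + L) \<omega>)))"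
    by (rule determined_by_comp[OF determined_by_C0])
  have detLQ: "determined_by (edges_within ?W) (\<lambda>\<omega>. \<not> large_cluster (B n y) s \<omega> \<or> ?Q \<omega>)"
    by (rule determined_by_comp2[OF detL detQ, where h = "(\<or>)"])
  have detSLQ: "determined_by (edges_within ?W)
      (\<lambda>\<omega>. s \<le> real (card (C0 (n + L) \<omega>)) \<or> (\<not> large_cluster (B n y) s \<omega> \<or> ?Q \<omega>))"
    by (rule determined_by_comp2[OF detS detLQ, where h = "(\<or>)"])
  have "Pr (\<lambda>\<omega>. t \<le> real (card (C0 n \<omega>))) \<le>
      Pr (\<lambda>\<omega>. s \<le> real (card (C0 (n + L) \<omega>)) \<or> (\<not> large_cluster (B n y) s \<omega> \<or> ?Q \<omega>))"
  proof (rule pr_mono[OF edges_hball[OF zero_V] detSLQ])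
    fix \<omega> assume t: "t \<le> real (card (C0 n \<omega>))"
    show "s \<le> real (card (C0 (n + L) \<omega>)) \<or> (\<not> large_cluster (B n y) s \<omega> \<or> ?Q \<omega>)"
    proof (rule ccontr)
      assume neg: "\<not> (s \<le> real (card (C0 (n + L) \<omega>)) \<or> (\<not> large_cluster (B n y) s \<omega> \<or> ?Q \<omega>))"
      then obtain u where u: "u \<in> B n y" "s \<le> real (card (local_cluster (B n y) \<omega> u))"
        "?U \<omega> = local_cluster (B n y) \<omega> u"
        using chosen_cluster_large by blast
      obtain p q where pq: "p \<in> C0 n \<omega>" "q \<in> ?U \<omega>" "\<omega> {p, q}"
        using neg t u by (auto simp: edges_between_def)
      have W: "p \<in> ?W" "q \<in> ?W" using pq C0_subset chosen_cluster_subset sub by blast+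
      have "q \<in> C0 (n + L) \<omega>"
      proof -
        have "p \<in> C0 (n + L) \<omega>" using pq(1) C0_mono[of n "n + L" \<omega>] by auto
        then have "local_cluster ?W \<omega> q = C0 (n + L) \<omega>"
          using local_cluster_eq local_cluster_edge[OF W(1,2), of \<omega>] pq(3) by metis
        then show ?thesis using local_cluster_refl by blast
      qed
      moreover have "?U \<omega> = local_cluster (B n y) \<omega> q" using u(3) pq(2) local_cluster_eq by auto
      ultimately have "?U \<omega> \<subseteq> C0 (n + L) \<omega>"
        using local_cluster_mono[OF sub(1), of \<omega> q] local_cluster_eq by metis
      from card_mono[OF finite_C0 this] show False using neg u by auto
    qed
  qed
  also have "\<dots> \<le> Pr (\<lambda>\<omega>. s \<le> real (card (C0 (n + L) \<omega>))) +
      Pr (\<lambda>\<omega>. \<not> large_cluster (B n y) s \<omega> \<or> ?Q \<omega>)"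
    by (rule pr_disj_le[OF edges_hball[OF zero_V] detS detLQ])
  also have "Pr (\<lambda>\<omega>. \<not> large_cluster (B n y) s \<omega> \<or> ?Q \<omega>) \<le>
      Pr (\<lambda>\<omega>. \<not> large_cluster (B n y) s \<omega>) + Pr ?Q"
    by (rule pr_disj_le[OF edges_hball[OF zero_V] detL detQ])
  also have "Pr (\<lambda>\<omega>. \<not> large_cluster (B n y) s \<omega>) = 1 - Pr (large_cluster (B0 n) s)"
    by (simp only: pr_not[OF edges_hball[OF yV] determined_by_large_cluster]
        pr_large_cluster_transitive[OF yV])
  also have "Pr ?Q \<le> exp (- a * (t * s) / b1 ^ (n + L))"
    using y assms zero_in_reps
    by (intro pr_not_joined_le[OF sub(2,1) reps_ball_disjoint determined_by_C0
          determined_by_chosen_cluster C0_subset chosen_cluster_subset]) auto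
  finally show ?thesis by simp
qed

text \<open>With \<open>K = N ^ L - 1\<close>, scale \<open>i\<close> uses the thresholds \<open>t0 * K ^ i\<close> and \<open>s0 * K ^ i\<close> in the ball of
  radius \<open>n + i * L\<close>.  By \<open>rho\<close> the exponent of the probability of failing to join two such clusters
  at least doubles from one scale to the next, so failures at scale \<open>i\<close> cost at most
  \<open>d0 / 2 ^ i\<close>.\<close>

lemma percolation_prob_ge:
  fixes t0 s0 d0 q :: real
  assumes "1 \<le> L" "3 \<le> N ^ L" and rho: "2 * b1 ^ L \<le> (real (N ^ L) - 1)\<^sup>2"
    and t0: "0 < t0" "t0 * real (N ^ L) \<le> s0"
    and d0: "0 < d0" "4 * (real (N ^ L))\<^sup>2 * d0 \<le> 1"
    and e0: "4 * (real (N ^ L))\<^sup>2 * exp (- a * (t0 * s0) / b1 ^ (n + L)) \<le> d0"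
    and large0: "1 - d0 \<le> Pr (large_cluster (B0 n) s0)"
    and origin0: "q \<le> Pr (\<lambda>\<omega>. t0 \<le> real (card (C0 n \<omega>)))"
  shows "q - 3 * d0 \<le> percolation_prob N a b"
proof -
  define M where "M = real (N ^ L)"
  define K where "K = M - 1"
  have M: "3 \<le> M" using assms(2) unfolding M_def by (metis of_nat_le_iff of_nat_numeral)
  then have K: "2 \<le> K" by (simp add: K_def)
  define m where "m i = n + i * L" for i
  define t where "t i = t0 * K ^ i" for i
  define s where "s i = s0 * K ^ i" for i
  define x where "x i = a * (t i * s i) / b1 ^ (m i + L)" for i
  have M2: "9 \<le> M\<^sup>2" using power_mono[OF M, of 2] by simp
  have "0 < t0 * M" using t0 M by simp
  then have s0: "0 < s0" using t0(2) unfolding M_def by linarith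
  have pos: "0 < t i" "0 < s i" for i using t0 s0 K by (auto simp: t_def s_def)
  have x0: "M\<^sup>2 * exp (- x 0) \<le> d0 / 4" using e0 by (simp add: x_def t_def s_def m_def M_def)
  have x0_pos: "0 \<le> x 0" using pos a_pos b1_facts by (auto simp: x_def intro!: divide_nonneg_nonneg mult_nonneg_nonneg less_imp_le)
  \<comment> \<open>This turns an exponent of at least \<open>(i + 1) * x 0\<close> into a factor
    \<open>1 / 2 ^ i\<close>. It follows from \<open>9 * exp (- x 0) \<le> d0 / 4\<close>, with
    \<open>d0 \<le> 1 / 36\<close>.\<close>
  have ex0: "exp (- x 0) \<le> 1 / 2"
  proof -
    have "9 * exp (- x 0) \<le> M\<^sup>2 * exp (- x 0)" using M2 by (intro mult_right_mono) auto
    moreover have "9 * d0 \<le> M\<^sup>2 * d0" using M2 d0 by (intro mult_right_mono) auto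
    ultimately show ?thesis using x0 d0(2) unfolding M_def[symmetric] by linarith
  qed
  have xi: "x 0 * 2 ^ i \<le> x i" for i
  proof (induction i)
    case (Suc i)
    have eq: "x (Suc i) = x i * (K\<^sup>2 / b1 ^ L)"
      by (simp add: x_def t_def s_def m_def power_add power2_eq_square algebra_simps)
    have "2 \<le> K\<^sup>2 / b1 ^ L" using rho b1_facts by (simp add: K_def M_def field_simps)
    moreover have "0 \<le> x i" using Suc x0_pos by (smt (verit) zero_le_mult_iff zero_le_power)
    ultimately have "x i * 2 \<le> x (Suc i)" unfolding eq by (intro mult_left_mono)
    then show ?case using Suc by simp
  qed simp
  have ei: "exp (- x i) \<le> exp (- x 0) / 2 ^ i" for i
  proof -
    \<comment> \<open>Of the doubling only \<open>i + 1 \<le> 2 ^ i\<close> is used: one factor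
      \<open>exp (- x 0)\<close> is kept and the other \<open>i\<close> are bounded by
      \<open>1 / 2\<close> each.\<close>
    have "real (Suc i) \<le> 2 ^ i" using Bernoulli_inequality[of 1 i] by (simp add: numeral_2_eq_2)
    then have "x 0 * real (Suc i) \<le> x 0 * 2 ^ i" using x0_pos by (rule mult_left_mono)
    then have "exp (- x i) \<le> exp (- (x 0 * real (Suc i)))" using xi[of i] by simp
    also have "\<dots> = exp (- x 0) * exp (- x 0) ^ i"
      by (simp add: exp_of_nat_mult[symmetric] exp_add[symmetric] algebra_simps)
    also have "\<dots> \<le> exp (- x 0) * (1 / 2) ^ i" using ex0 by (intro mult_left_mono power_mono) auto
    finally show ?thesis by (simp add: power_divide)
  qed
  have M2ei: "M\<^sup>2 * exp (- x i) \<le> d0 / 2 ^ i / 4" for i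
  proof -
    have "M\<^sup>2 * exp (- x i) \<le> M\<^sup>2 * (exp (- x 0) / 2 ^ i)" using ei by (intro mult_left_mono) auto
    also have "\<dots> \<le> d0 / 4 / 2 ^ i" using divide_right_mono[OF x0, of "2 ^ i"] by simp
    finally show ?thesis by simp
  qed
  have ts: "t i \<le> s i" for i
  proof -
    have "t0 * 1 \<le> t0 * M" using t0 M by (intro mult_left_mono) auto
    then have "t0 \<le> s0" using t0(2) unfolding M_def by linarith
    then show ?thesis using K unfolding t_def s_def by (intro mult_right_mono) auto
  qed
  have large: "1 - Pr (large_cluster (B0 (m i)) (s i)) \<le> d0 / 2 ^ i" for i
  proof (induction i)
    case 0 then show ?case using large0 by (simp add: m_def s_def)
  next
    case (Suc i)
    let ?d = "1 - Pr (large_cluster (B0 (m i)) (s i))"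
    have "a * (t i * s i) / b1 ^ (m i + L) \<le> a * (s i * s i) / b1 ^ (m i + L)"
      using a_pos pos ts[of i] b1_facts by (intro divide_right_mono mult_left_mono mult_right_mono) (auto simp: less_imp_le)
    then have "exp (- a * (s i * s i) / b1 ^ (m i + L)) \<le> exp (- x i)" by (simp add: x_def)
    then have "M\<^sup>2 * exp (- a * (s i * s i) / b1 ^ (m i + L)) \<le> d0 / 2 ^ i / 4"
      using M2ei[of i] mult_left_mono[of _ "exp (- x i)" "M\<^sup>2"] by fastforce
    \<comment> \<open>Half of the allowance \<open>d0 / 2 ^ Suc i\<close> is for pairs of failing
      subballs, half for unjoined pairs. In the first half one factor \<open>d0\<close> of the
      square absorbs the number of pairs, by \<open>4 * M ^ 2 * d0 \<le> 1\<close>.\<close>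
    moreover have "M\<^sup>2 * ?d\<^sup>2 \<le> d0 / 2 ^ i / 4"
    proof -
      have d: "0 \<le> ?d" using pr_le_1 by simp
      have "?d\<^sup>2 \<le> (d0 / 2 ^ i)\<^sup>2" using Suc d by (intro power_mono) auto
      also have "\<dots> = d0 * d0 / 2 ^ i / 2 ^ i" by (simp add: power2_eq_square)
      also have "\<dots> \<le> d0 * d0 / 2 ^ i / 1" using d0 by (intro divide_left_mono) auto
      finally have "M\<^sup>2 * ?d\<^sup>2 \<le> M\<^sup>2 * (d0 * d0 / 2 ^ i)" by (intro mult_left_mono) auto
      also have "\<dots> = (4 * M\<^sup>2 * d0) * (d0 / 2 ^ i / 4)" by simp
      also have "\<dots> \<le> 1 * (d0 / 2 ^ i / 4)" using d0 by (intro mult_right_mono) (auto simp: M_def)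
      finally show ?thesis by simp
    qed
    moreover have "1 - Pr (large_cluster (B0 (m i + L)) ((M - 1) * s i)) \<le>
       M\<^sup>2 * (?d\<^sup>2 + exp (- a * (s i * s i) / b1 ^ (m i + L)))"
      unfolding M_def by (rule pr_renormalise[OF assms(1) pos(2)])
    moreover have "m (Suc i) = m i + L" "s (Suc i) = (M - 1) * s i" by (simp_all add: m_def s_def K_def)
    ultimately show ?case by (simp add: distrib_left)
  qed
  \<comment> \<open>Scale \<open>i\<close> loses at most \<open>d0 / 2 ^ i\<close> for a missing
    large cluster and a quarter of that for a failed join. The error
    \<open>3 * d0 * (1 - 1 / 2 ^ i)\<close> leaves room for
    \<open>3 / 2 * d0 / 2 ^ i\<close>.\<close>
  have origin: "q - 3 * d0 * (1 - 1 / 2 ^ i) \<le> Pr (\<lambda>\<omega>. t i \<le> real (card (C0 (m i) \<omega>)))" for i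
  proof (induction i)
    case 0 then show ?case using origin0 by (simp add: t_def m_def)
  next
    case (Suc i)
    \<comment> \<open>Joining a cluster of size \<open>s i\<close> meets the next threshold of the
      origin at once, since \<open>t0 * K \<le> t0 * N ^ L \<le> s0\<close>.\<close>
    have ts': "t (Suc i) \<le> s i"
    proof -
      have "t0 * K \<le> s0" using t0 by (smt (verit) K_def M_def mult_left_mono)
      then show ?thesis using K unfolding t_def s_def power_Suc by (simp add: mult.assoc[symmetric] mult_right_mono)
    qed
    have m': "m (Suc i) = m i + L" by (simp add: m_def)
    have "1 * exp (- x i) \<le> M\<^sup>2 * exp (- x i)" using M2 by (intro mult_right_mono) auto
    then have "exp (- x i) \<le> d0 / 2 ^ i / 4" using M2ei[of i] by linarith
    then have "q - 3 * d0 * (1 - 1 / 2 ^ i) - d0 / 2 ^ i - d0 / 2 ^ i / 4 \<le>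
        Pr (\<lambda>\<omega>. t i \<le> real (card (C0 (m i) \<omega>))) - (1 - Pr (large_cluster (B0 (m i)) (s i))) - exp (- x i)"
      using Suc large[of i] by linarith
    also have "\<dots> \<le> Pr (\<lambda>\<omega>. s i \<le> real (card (C0 (m i + L) \<omega>)))"
      using pr_origin_grows[OF assms(1) pos(2)[of i] less_imp_le[OF pos(1)[of i]], of "m i"]
      by (simp add: x_def)
    also have "\<dots> \<le> Pr (\<lambda>\<omega>. t (Suc i) \<le> real (card (C0 (m (Suc i)) \<omega>)))"
      unfolding m'
      by (rule pr_mono[OF edges_hball[OF zero_V] determined_by_comp[OF determined_by_C0]])
        (use ts' in linarith)
    finally have "q - 3 * d0 * (1 - 1 / 2 ^ i) - d0 / 2 ^ i - d0 / 2 ^ i / 4 \<le>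
      Pr (\<lambda>\<omega>. t (Suc i) \<le> real (card (C0 (m (Suc i)) \<omega>)))" .
    moreover have "q - 3 * d0 * (1 - 1 / 2 ^ Suc i) \<le> q - 3 * d0 * (1 - 1 / 2 ^ i) - d0 / 2 ^ i - d0 / 2 ^ i / 4"
    proof -
      have "0 \<le> d0 / 2 ^ i" using d0 by simp
      then show ?thesis by (simp add: right_diff_distrib)
    qed
    ultimately show ?case by linarith
  qed
  have "Pr (confined k) \<le> 1 - (q - 3 * d0)" for k
  proof -
    \<comment> \<open>The thresholds \<open>t i\<close> are unbounded, so some of them exceeds the
      volume of the ball of radius \<open>k\<close> and excludes confinement to it.\<close>
    have "\<exists>i. real (N ^ k) / t0 < K ^ i" using K by (intro real_arch_pow) auto
    then obtain i where i: "real (N ^ k) < t i" using t0 by (auto simp: t_def field_simps)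
    have "Pr (confined k) \<le> Pr (\<lambda>\<omega>. \<not> t i \<le> real (card (C0 (m i) \<omega>)))"
    proof (rule pr_mono[OF edges_hball[OF zero_V] determined_by_comp[OF determined_by_C0]])
      fix \<omega> assume "confined k \<omega>"
      then have "C0 (m i) \<omega> \<subseteq> B0 k" by (simp add: confined_iff)
      from card_mono[OF finite_hball[OF zero_V] this] have "card (C0 (m i) \<omega>) \<le> N ^ k"
        by (simp add: card_hball[OF zero_V])
      then show "\<not> t i \<le> real (card (C0 (m i) \<omega>))" using i by (metis of_nat_le_iff not_le order_trans)
    qed
    also have "\<dots> = 1 - Pr (\<lambda>\<omega>. t i \<le> real (card (C0 (m i) \<omega>)))"
      by (rule pr_not[OF edges_hball[OF zero_V] determined_by_comp[OF determined_by_C0]])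
    also have "\<dots> \<le> 1 - (q - 3 * d0)"
    proof -
      have "3 * d0 * (1 - 1 / 2 ^ i) \<le> 3 * d0 * 1" using d0 by (intro mult_left_mono) auto
      then show ?thesis using origin[of i] by simp
    qed
    finally show ?thesis .
  qed
  then have "1 - percolation_prob N a b \<le> 1 - (q - 3 * d0)"
    by (intro LIMSEQ_le_const2[OF pr_confined_tendsto]) auto
  then show ?thesis by simp
qed

end


section \<open>The cluster of the origin in large balls\<close>

context percolation_model
begin

text \<open>Since \<open>2 \<le> N\<close>, the outer shell holds at least half of a ball of radius
  \<open>k + 1\<close>; \<open>b \<le> N\<close> then gives the shell a total weight of at least
  \<open>1 / 2\<close>.\<close>

lemma sum_shell_ge:
  assumes "b \<le> N" "m \<le> k"
  shows "real (k - m) / 2 \<le> (\<Sum>v\<in>B0 k - B0 m. 1 / b ^ hier_dist (\<lambda>_. 0) v)"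
  using assms(2)
proof (induction k rule: dec_induct)
  case (step k)
  have sub: "B0 m \<subseteq> B0 k" "B0 k \<subseteq> B0 (Suc k)" using step by (auto intro!: hball_mono)
  have fin: "finite (B0 k)" "finite (B0 (Suc k))" using finite_hball[OF zero_V] by auto
  have "1 / 2 \<le> real (card (B0 (Suc k) - B0 k)) / b ^ Suc k"
  proof -
    have "card (B0 (Suc k) - B0 k) + N ^ k = N ^ Suc k"
      using card_Diff_subset[OF fin(1) sub(2)] card_mono[OF fin(2) sub(2)] by (simp add: card_hball[OF zero_V])
    moreover have "2 * N ^ k \<le> N ^ Suc k" using N_ge_2 by simp
    ultimately have "N ^ Suc k \<le> 2 * card (B0 (Suc k) - B0 k)" by linarith
    then have "real (N ^ Suc k) \<le> real (2 * card (B0 (Suc k) - B0 k))" by (simp only: of_nat_le_iff)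
    moreover have "b ^ Suc k \<le> real N ^ Suc k" using assms(1) b_pos by (intro power_mono) auto
    ultimately have "b ^ Suc k \<le> 2 * real (card (B0 (Suc k) - B0 k))" by simp
    then show ?thesis using b_pos by (simp add: field_simps)
  qed
  also have "\<dots> = (\<Sum>v\<in>B0 (Suc k) - B0 k. 1 / b ^ Suc k)" by simp
  also have "\<dots> = (\<Sum>v\<in>B0 (Suc k) - B0 k. 1 / b ^ hier_dist (\<lambda>_. 0) v)"
  proof (rule sum.cong[OF refl])
    fix v assume v: "v \<in> B0 (Suc k) - B0 k"
    have zero: "(\<lambda>_. 0) \<in> B0 k" "(\<lambda>_. 0) \<in> B0 (Suc k)" by (rule center_in_hball[OF zero_V])+
    have "k < hier_dist (\<lambda>_. 0) v" using hier_dist_shell[OF zero(1)] v by auto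
    moreover have "hier_dist (\<lambda>_. 0) v \<le> Suc k"
      using v zero by (intro hier_dist_le_in_hball[of _ N _ "\<lambda>_. 0"]) auto
    ultimately have "hier_dist (\<lambda>_. 0) v = Suc k" by simp
    then show "1 / b ^ Suc k = 1 / b ^ hier_dist (\<lambda>_. 0) v" by simp
  qed
  finally have "1 / 2 \<le> (\<Sum>v\<in>B0 (Suc k) - B0 k. 1 / b ^ hier_dist (\<lambda>_. 0) v)" .
  moreover have "(\<Sum>v\<in>B0 (Suc k) - B0 m. 1 / b ^ hier_dist (\<lambda>_. 0) v) =
      (\<Sum>v\<in>B0 k - B0 m. 1 / b ^ hier_dist (\<lambda>_. 0) v) +
      (\<Sum>v\<in>B0 (Suc k) - B0 k. 1 / b ^ hier_dist (\<lambda>_. 0) v)"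
    using sub fin by (subst sum.union_disjoint[symmetric]) (auto intro!: sum.cong)
  moreover have "real (Suc k - m) / 2 = real (k - m) / 2 + 1 / 2"
    using step by (simp add: Suc_diff_le add_divide_distrib)
  ultimately show ?case using step by linarith
qed simp

text \<open>Confinement to \<open>B0 m\<close> closes every edge from the origin to the next
  \<open>i\<close> shells, which has probability at most \<open>exp (- a / 2) ^ i\<close> for every
  \<open>i\<close>.\<close>

lemma percolation_prob_eq_1:
  assumes "b \<le> N"
  shows "percolation_prob N a b = 1"
proof -
  have "Pr (confined m) \<le> 0" for m
  proof -
    have bound: "Pr (confined m) \<le> exp (- a / 2) ^ i" for i
    proof -
      let ?F = "edges_between {\<lambda>_. 0} (B0 (m + i) - B0 m)"
      have zero: "(\<lambda>_. 0) \<in> B0 k" for k by (rule center_in_hball[OF zero_V])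
      have fin: "finite ?F" by (intro finite_edges_between finite_Diff finite_hball zero_V) simp
      have E: "?F \<subseteq> E" using zero_V hball_subset by (intro edges_between_subset) blast+
      have "Pr (confined m) \<le> Pr (\<lambda>\<omega>. \<forall>e\<in>?F. \<not> \<omega> e)"
      proof (rule pr_mono[OF fin E determined_by_closed[OF order_refl]], intro ballI notI)
        fix \<omega> e assume conf: "confined m \<omega>" and e: "e \<in> ?F" "\<omega> e"
        then obtain v where v: "e = {\<lambda>_. 0, v}" "v \<in> B0 (m + i)" "v \<notin> B0 m"
          unfolding edges_between_def by blast
        have "C0 (m + i) \<omega> = local_cluster (B0 (m + i)) \<omega> v"
          using v e by (intro local_cluster_edge zero) auto
        then have "v \<in> C0 (m + i) \<omega>" using local_cluster_refl by blast
        then show False using conf v by (auto simp: confined_iff)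
      qed
      also have "\<dots> = exp (- a * (\<Sum>e\<in>?F. 1 / b ^ pair_dist e))" by (rule pr_closed[OF fin E])
      also have "(\<Sum>e\<in>?F. 1 / b ^ pair_dist e) = (\<Sum>v\<in>B0 (m + i) - B0 m. 1 / b ^ hier_dist (\<lambda>_. 0) v)"
        using sum_edges_between[of "{\<lambda>_. 0}" "B0 (m + i) - B0 m" "\<lambda>d. 1 / b ^ d"] zero
          finite_hball[OF zero_V] by simp
      also have "exp (- a * \<dots>) \<le> exp (- a * (real i / 2))"
      proof -
        have "a * (real i / 2) \<le> a * (\<Sum>v\<in>B0 (m + i) - B0 m. 1 / b ^ hier_dist (\<lambda>_. 0) v)"
          using sum_shell_ge[OF assms, of m "m + i"] a_pos by (intro mult_left_mono) auto
        then show ?thesis by simp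
      qed
      also have "\<dots> = exp (- a / 2) ^ i" by (simp add: exp_of_nat_mult[symmetric] mult.commute)
      finally show ?thesis .
    qed
    have "(\<lambda>i. exp (- a / 2) ^ i) \<longlonglongrightarrow> 0" using a_pos by (intro LIMSEQ_power_zero) simp
    then show ?thesis by (rule LIMSEQ_le_const) (use bound in auto)
  qed
  then have "1 - percolation_prob N a b \<le> 0"
    by (intro LIMSEQ_le_const2[OF pr_confined_tendsto]) auto
  moreover have "percolation_prob N a b \<le> 1" by (simp add: percolation_prob_def)
  ultimately show ?thesis by linarith
qed

lemma finite_subset_C0:
  assumes "finite F" "F \<subseteq> cluster N \<omega> (\<lambda>_. 0)"
  shows "\<exists>k. F \<subseteq> C0 k \<omega>"
  using assms
proof (induction rule: finite_induct)
  case (insert x F)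
  then obtain k l where kl: "F \<subseteq> C0 k \<omega>" "x \<in> C0 l \<omega>" unfolding cluster_0_eq by auto
  then have "insert x F \<subseteq> C0 (max k l) \<omega>"
    using C0_mono[of k "max k l" \<omega>] C0_mono[of l "max k l" \<omega>] by auto
  then show ?case by blast
qed simp

lemma origin_unbounded:
  assumes "0 < \<epsilon>"
  shows "\<forall>\<^sub>F n in sequentially. percolation_prob N a b - \<epsilon> < Pr (\<lambda>\<omega>. A \<le> real (card (C0 n \<omega>)))"
proof -
  let ?Q = "\<lambda>n \<omega>. A \<le> real (card (C0 n \<omega>))"
  have sets: "{\<omega> \<in> space \<PP>. ?Q n \<omega>} \<in> sets \<PP>" for n
    by (rule determined_event_sets[OF edges_hball[OF zero_V] determined_by_comp[OF determined_by_C0]])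
  have "?Q (Suc n) \<omega>" if "?Q n \<omega>" for n \<omega>
  proof -
    have "card (C0 n \<omega>) \<le> card (C0 (Suc n) \<omega>)" by (intro card_mono finite_C0 C0_mono) simp
    then show ?thesis using that by linarith
  qed
  then have lim: "(\<lambda>n. Pr (?Q n)) \<longlonglongrightarrow> Pr (\<lambda>\<omega>. \<exists>n. ?Q n \<omega>)" by (rule pr_ex_limit[OF sets])
  have "{\<omega> \<in> space \<PP>. \<exists>n. ?Q n \<omega>} = (\<Union>n. {\<omega> \<in> space \<PP>. ?Q n \<omega>})" by auto
  then have "{\<omega> \<in> space \<PP>. \<exists>n. ?Q n \<omega>} \<in> sets \<PP>" using sets by (auto intro: sets.countable_UN)
  then have "Pr (\<lambda>\<omega>. infinite (cluster N \<omega> (\<lambda>_. 0))) \<le> Pr (\<lambda>\<omega>. \<exists>n. ?Q n \<omega>)"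
  proof (rule pr_mono_sets)
    fix \<omega> assume "infinite (cluster N \<omega> (\<lambda>_. 0))"
    then obtain F where F: "F \<subseteq> cluster N \<omega> (\<lambda>_. 0)" "finite F" "card F = nat \<lceil>A\<rceil>"
      using infinite_arbitrarily_large by blast
    then obtain k where "F \<subseteq> C0 k \<omega>" using finite_subset_C0 by blast
    then have "nat \<lceil>A\<rceil> \<le> card (C0 k \<omega>)" using card_mono[OF finite_C0] F(3) by metis
    then have "A \<le> real (card (C0 k \<omega>))" by linarith
    then show "\<exists>n. ?Q n \<omega>" by blast
  qed
  then have "percolation_prob N a b - \<epsilon> < Pr (\<lambda>\<omega>. \<exists>n. ?Q n \<omega>)"
    using assms by (simp add: percolation_prob_def pr_def)
  then show ?thesis by (rule order_tendstoD(1)[OF lim])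
qed

text \<open>A cluster of the origin that is smaller than \<open>A (b / N) ^ n\<close> fails to leave the ball of
  radius \<open>n\<close> with probability bounded below, uniformly in \<open>n\<close>; so on the event of percolation such
  small clusters become unlikely.\<close>

lemma origin_large_supercritical_scale:
  assumes "N < b" "0 < A" "0 < \<epsilon>"
  shows "\<forall>\<^sub>F n in sequentially. percolation_prob N a b - \<epsilon> <
    Pr (\<lambda>\<omega>. A * (b / N) ^ n \<le> real (card (C0 n \<omega>)))"
proof -
  let ?\<theta> = "percolation_prob N a b"
  let ?r = "N / b"
  have N0: "0 < real N" using N_ge_2 by simp
  have r: "0 < ?r" "?r < 1" using assms(1) b_pos N0 by auto
  \<comment> \<open>The exponential factor of \<open>pr_cluster_stays_ge\<close> for
    \<open>s = A * (b / N) ^ n\<close>; the powers cancel except for one factor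
    \<open>N / b\<close>.\<close>
  define q where "q = exp (- a * A * (?r / (1 - ?r)))"
  have q: "0 < q" by (simp add: q_def)
  \<comment> \<open>\<open>m\<close> is chosen so that enlarging the ball adds less than
    \<open>q * (\<epsilon> / 2)\<close> to the probability of confinement. If \<open>C0 n\<close> is
    small but not inside \<open>B0 m\<close>, then with conditional probability at least
    \<open>q\<close> it is confined to \<open>B0 n\<close> and not to \<open>B0 m\<close>; so this
    case has probability below \<open>\<epsilon> / 2\<close>.\<close>
  have "(\<lambda>m. Pr (confined m)) \<longlonglongrightarrow> 1 - ?\<theta>" by (rule pr_confined_tendsto)
  moreover have "1 - ?\<theta> - q * (\<epsilon> / 2) < 1 - ?\<theta>" using q assms(3) by simp
  ultimately have "\<forall>\<^sub>F m in sequentially. 1 - ?\<theta> - q * (\<epsilon> / 2) < Pr (confined m)"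
    by (rule order_tendstoD(1))
  then obtain m where m: "1 - ?\<theta> - q * (\<epsilon> / 2) < Pr (confined m)"
    by (auto simp: eventually_sequentially)
  have "Pr (confined m) < 1 - ?\<theta> + \<epsilon> / 2" using pr_confined_le[of m] assms(3) by linarith
  then have "\<forall>\<^sub>F n in sequentially. Pr (\<lambda>\<omega>. C0 n \<omega> \<subseteq> B0 m) < 1 - ?\<theta> + \<epsilon> / 2"
    by (rule order_tendstoD(2)[OF C0_tendsto_confined])
  then show ?thesis using eventually_ge_at_top[of m]
  proof eventually_elim
    case (elim n)
    let ?s = "A * (b / N) ^ n"
    let ?\<C> = "{C. \<not> C \<subseteq> B0 m \<and> real (card C) \<le> ?s}"
    have s0: "0 \<le> ?s" using assms(2) b_pos N0 by simp
    have "Pr (\<lambda>\<omega>. C0 n \<omega> \<in> ?\<C>) * q \<le> Pr (\<lambda>\<omega>. C0 n \<omega> \<in> ?\<C> \<and> confined n \<omega>)"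
    proof -
      have "(b / N) ^ n * ?r ^ Suc n = ?r"
        using N0 b_pos by (simp add: power_divide field_simps)
      then have "a * ?s * (?r ^ Suc n / (1 - ?r)) = a * A * (?r / (1 - ?r))"
        by (simp only: times_divide_eq_right mult.assoc)
      then have "q = exp (- a * ?s * (?r ^ Suc n / (1 - ?r)))" unfolding q_def by simp
      then show ?thesis using pr_cluster_stays_ge[OF assms(1) _ s0, of ?\<C> n] by simp
    qed
    also have "\<dots> \<le> Pr (\<lambda>\<omega>. confined n \<omega> \<and> \<not> confined m \<omega>)"
    proof (rule pr_mono_sets)
      have "{\<omega> \<in> space \<PP>. confined n \<omega> \<and> \<not> confined m \<omega>} =
          {\<omega> \<in> space \<PP>. confined n \<omega>} - {\<omega> \<in> space \<PP>. confined m \<omega>}" by auto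
      then show "{\<omega> \<in> space \<PP>. confined n \<omega> \<and> \<not> confined m \<omega>} \<in> sets \<PP>"
        using confined_sets by simp
    qed (auto simp: confined_iff)
    also have "\<dots> = Pr (confined n) - Pr (confined m)"
    proof -
      have "{\<omega> \<in> space \<PP>. confined n \<omega> \<and> \<not> confined m \<omega>} =
          {\<omega> \<in> space \<PP>. confined n \<omega>} - {\<omega> \<in> space \<PP>. confined m \<omega>}" by auto
      then show ?thesis unfolding pr_def
        using finite_measure_Diff[OF confined_sets[of n] confined_sets[of m]] confined_mono[OF elim(2)]
        by auto
    qed
    also have "\<dots> < q * (\<epsilon> / 2)" using m pr_confined_le[of n] by linarith
    finally have small: "Pr (\<lambda>\<omega>. C0 n \<omega> \<in> ?\<C>) < \<epsilon> / 2" using q by (simp add: mult.commute)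
    have det: "determined_by (edges_within (B0 n)) (\<lambda>\<omega>. C0 n \<omega> \<in> \<D>)" for \<D>
      by (rule determined_by_comp[OF determined_by_C0])
    have "1 - Pr (\<lambda>\<omega>. ?s \<le> real (card (C0 n \<omega>))) = Pr (\<lambda>\<omega>. \<not> ?s \<le> real (card (C0 n \<omega>)))"
      by (rule pr_not[OF edges_hball[OF zero_V] determined_by_comp[OF determined_by_C0], symmetric])
    also have "\<dots> \<le> Pr (\<lambda>\<omega>. C0 n \<omega> \<in> Pow (B0 m) \<or> C0 n \<omega> \<in> ?\<C>)"
      by (rule pr_mono[OF edges_hball[OF zero_V]
            determined_by_comp[OF determined_by_C0, where h = "\<lambda>C. C \<in> Pow (B0 m) \<or> C \<in> ?\<C>"]]) auto
    also have "\<dots> \<le> Pr (\<lambda>\<omega>. C0 n \<omega> \<in> Pow (B0 m)) + Pr (\<lambda>\<omega>. C0 n \<omega> \<in> ?\<C>)"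
      by (rule pr_disj_le[OF edges_hball[OF zero_V] det det])
    finally show ?case using small elim(1) by simp
  qed
qed

text \<open>For \<open>b \<le> N\<close> the factor \<open>(b1 / N) ^ n\<close> is at most 1, so
  exceeding every constant is enough; the escape estimate serves the case
  \<open>N < b\<close>.\<close>

lemma origin_large:
  assumes "0 < A" "0 < \<epsilon>"
  shows "\<forall>\<^sub>F n in sequentially. percolation_prob N a b - \<epsilon> <
    Pr (\<lambda>\<omega>. A * (b1 / N) ^ n \<le> real (card (C0 n \<omega>)))"
proof (cases "N < b")
  case True
  then have "b1 = b" using N_ge_2 by simp
  then show ?thesis using origin_large_supercritical_scale[OF True assms] by simp
next
  case False
  then have "b1 / N \<le> 1" "0 \<le> b1 / N" using N_ge_2 by auto
  then have "A * (b1 / N) ^ n \<le> A" for n using assms(1) by (simp add: power_le_one)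
  then have "Pr (\<lambda>\<omega>. A \<le> real (card (C0 n \<omega>))) \<le> Pr (\<lambda>\<omega>. A * (b1 / N) ^ n \<le> real (card (C0 n \<omega>)))" for n
    by (intro pr_mono[OF edges_hball[OF zero_V, of n] determined_by_comp[OF determined_by_C0]])
      (rule order_trans)
  then show ?thesis using origin_unbounded[OF assms(2), of A]
    by (auto elim!: eventually_mono intro: less_le_trans)
qed

text \<open>With \<open>A = 2\<close>, \<open>origin_large\<close> yields a cluster of size at least
  \<open>2 * (b1 / N) ^ n\<close> inside a ball of \<open>N ^ n\<close> vertices.\<close>

lemma b1_less_N_square:
  assumes "0 < percolation_prob N a b"
  shows "b1 < (real N)\<^sup>2"
proof (rule ccontr)
  assume not: "\<not> b1 < (real N)\<^sup>2"
  have N0: "0 < real N" using N_ge_2 by simp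
  let ?\<theta> = "percolation_prob N a b"
  have "\<forall>\<^sub>F n in sequentially. ?\<theta> - ?\<theta> < Pr (\<lambda>\<omega>. 2 * (b1 / N) ^ n \<le> real (card (C0 n \<omega>)))"
    using assms by (intro origin_large) auto
  then obtain n where n: "0 < Pr (\<lambda>\<omega>. 2 * (b1 / N) ^ n \<le> real (card (C0 n \<omega>)))"
    by (auto simp: eventually_sequentially)
  have "{\<omega> \<in> space \<PP>. 2 * (b1 / N) ^ n \<le> real (card (C0 n \<omega>))} \<noteq> {}"
  proof
    assume "{\<omega> \<in> space \<PP>. 2 * (b1 / N) ^ n \<le> real (card (C0 n \<omega>))} = {}"
    then show False using n unfolding pr_def by (simp only: measure_empty less_irrefl)
  qed
  then obtain \<omega> where \<omega>: "2 * (b1 / N) ^ n \<le> real (card (C0 n \<omega>))" by auto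
  also have "\<dots> \<le> real (N ^ n)"
    using card_mono[OF finite_hball[OF zero_V] C0_subset, of n \<omega>]
    by (simp only: card_hball[OF zero_V] of_nat_le_iff)
  also have "\<dots> \<le> (b1 / N) ^ n"
  proof -
    have "real N * real N \<le> b1" using not by (simp only: not_less power2_eq_square)
    then have "real N \<le> b1 / N" using N0 by (simp only: pos_le_divide_eq)
    then have "real N ^ n \<le> (b1 / N) ^ n" using N0 by (intro power_mono) auto
    then show ?thesis by simp
  qed
  finally have "2 * (b1 / N) ^ n \<le> (b1 / N) ^ n" .
  moreover have "0 < (b1 / N) ^ n" using N0 b1_facts by simp
  ultimately show False by linarith
qed

end

section \<open>Merging two balls\<close>

text \<open>Items are added one at a time; the step at which the total reaches \<open>h\<close>
  overshoots by at most one item.\<close>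

lemma subset_sum_between:
  fixes f :: "'a \<Rightarrow> real"
  assumes "finite I" "\<And>i. i \<in> I \<Longrightarrow> 0 \<le> f i" "\<And>i. i \<in> I \<Longrightarrow> f i \<le> d" "0 \<le> d" "0 \<le> h" "h \<le> sum f I"
  shows "\<exists>J\<subseteq>I. h \<le> sum f J \<and> sum f J \<le> h + d"
  using assms
proof (induction I rule: finite_induct)
  case empty then show ?case by auto
next
  case (insert i I)
  show ?case
  proof (cases "h \<le> sum f I")
    case True
    then obtain J where "J \<subseteq> I" "h \<le> sum f J" "sum f J \<le> h + d" using insert by auto
    then show ?thesis by blast
  next
    case False
    then have "sum f (insert i I) \<le> h + d" using insert.hyps insert.prems(2)[of i] by simp
    then show ?thesis using insert.prems(5) by blast
  qed
qed

text \<open>Equivalence classes, given through the class of each point. The instances are the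
  clusters of one set and those of two disjoint sets kept apart.\<close>

locale finite_partition =
  fixes X :: "'a set" and cl :: "'a \<Rightarrow> 'a set"
  assumes finite_X: "finite X"
    and cl_refl: "x \<in> X \<Longrightarrow> x \<in> cl x" and cl_subset: "x \<in> X \<Longrightarrow> cl x \<subseteq> X"
    and cl_eq: "x \<in> X \<Longrightarrow> y \<in> cl x \<Longrightarrow> cl y = cl x"
begin

lemma cl_disjoint:
  assumes "x \<in> X" "y \<in> X" "cl x \<noteq> cl y" shows "cl x \<inter> cl y = {}"
  using assms cl_eq by blast

text \<open>\<open>subset_sum_between\<close> is applied to whole classes, each weighted by the part
  of \<open>K\<close> that it contains.\<close>

lemma balanced_split:
  assumes "K \<subseteq> X" "\<And>x. x \<in> X \<Longrightarrow> real (card (cl x)) \<le> d" "0 \<le> d"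
  shows "\<exists>S\<subseteq>X. (\<forall>x\<in>S. cl x \<subseteq> S) \<and> real (card K) / 2 \<le> real (card (S \<inter> K)) \<and>
    real (card (S \<inter> K)) \<le> real (card K) / 2 + d"
proof -
  let ?f = "\<lambda>C. real (card (C \<inter> K))"
  have finK: "finite K" using assms(1) finite_X by (rule finite_subset)
  have sum: "sum ?f J = real (card (\<Union>J \<inter> K))" if "J \<subseteq> cl ` X" for J
  proof -
    have "card (\<Union>C\<in>J. C \<inter> K) = (\<Sum>C\<in>J. card (C \<inter> K))"
    proof (rule card_UN_disjoint)
      show "finite J" using that finite_X finite_subset by blast
      show "\<forall>C\<in>J. finite (C \<inter> K)" using finK by auto
      show "\<forall>C\<in>J. \<forall>D\<in>J. C \<noteq> D \<longrightarrow> (C \<inter> K) \<inter> (D \<inter> K) = {}"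
        using that cl_disjoint by blast
    qed
    moreover have "(\<Union>C\<in>J. C \<inter> K) = \<Union>J \<inter> K" by blast
    ultimately show ?thesis by simp
  qed
  have "\<Union>(cl ` X) = X" using cl_refl cl_subset by blast
  then have "sum ?f (cl ` X) = real (card K)" using sum[OF order_refl] assms(1) by (simp add: Int_absorb1)
  moreover have "?f C \<le> d" if "C \<in> cl ` X" for C
  proof -
    obtain x where x: "x \<in> X" "C = cl x" using \<open>C \<in> cl ` X\<close> by blast
    have "card (C \<inter> K) \<le> card C"
      using x cl_subset finite_X by (intro card_mono) (auto intro: finite_subset)
    then have "real (card (C \<inter> K)) \<le> real (card (cl x))" using x(2) by simp
    then show ?thesis using assms(2)[OF x(1)] by (rule order_trans)
  qed
  ultimately obtain J where J: "J \<subseteq> cl ` X" "real (card K) / 2 \<le> sum ?f J" "sum ?f J \<le> real (card K) / 2 + d"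
    using subset_sum_between[of "cl ` X" ?f d "real (card K) / 2"] finite_X assms(3) by auto
  have "\<forall>x\<in>\<Union>J. cl x \<subseteq> \<Union>J" using J(1) cl_eq by blast
  moreover have "\<Union>J \<subseteq> X" using J(1) cl_subset by blast
  ultimately show ?thesis using J sum[OF J(1)] by (intro exI[of _ "\<Union>J"]) auto
qed

text \<open>Disjoint classes of size at least \<open>s\<close> number at most
  \<open>card X / s\<close>, and \<open>2 \<le> exp 1\<close>. This is the entropy side of the
  merging estimate.\<close>

lemma card_closed_unions_le:
  assumes "0 < s" and K: "K = {x \<in> X. s \<le> real (card (cl x))}"
  shows "finite {Z. Z \<subseteq> K \<and> (\<forall>x\<in>Z. cl x \<subseteq> Z)}"
    and "real (card {Z. Z \<subseteq> K \<and> (\<forall>x\<in>Z. cl x \<subseteq> Z)}) \<le> exp (real (card X) / s)"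
proof -
  let ?Z = "{Z. Z \<subseteq> K \<and> (\<forall>x\<in>Z. cl x \<subseteq> Z)}"
  have finK: "finite (cl ` K)" using finite_X K by simp
  have KX: "K \<subseteq> X" using K by auto
  have "card (\<Union>C\<in>cl ` K. C) = (\<Sum>C\<in>cl ` K. card C)"
  proof (rule card_UN_disjoint[OF finK])
    show "\<forall>C\<in>cl ` K. finite C" using KX cl_subset finite_subset[OF _ finite_X] by blast
    show "\<forall>C\<in>cl ` K. \<forall>D\<in>cl ` K. C \<noteq> D \<longrightarrow> C \<inter> D = {}" using KX cl_disjoint by blast
  qed
  moreover have "card (\<Union>C\<in>cl ` K. C) \<le> card X"
    using KX cl_subset by (intro card_mono finite_X) blast
  moreover have "(\<Sum>C\<in>cl ` K. s) \<le> (\<Sum>C\<in>cl ` K. real (card C))"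
    by (rule sum_mono) (use K in auto)
  ultimately have "real (card (cl ` K)) * s \<le> real (card X)"
    by (simp flip: of_nat_sum)
  then have le: "real (card (cl ` K)) \<le> real (card X) / s" using assms(1) by (simp add: field_simps)
  have sub: "?Z \<subseteq> Union ` Pow (cl ` K)"
  proof
    fix Z assume Z: "Z \<in> ?Z"
    then have "Z = \<Union>(cl ` Z)" using cl_refl KX by blast
    then show "Z \<in> Union ` Pow (cl ` K)" using Z by (intro image_eqI[of _ _ "cl ` Z"]) auto
  qed
  show "finite ?Z" by (rule finite_subset[OF sub]) (use finK in simp)
  have "card ?Z \<le> 2 ^ card (cl ` K)"
    using card_mono[OF _ sub] card_image_le[of "Pow (cl ` K)" Union] finK by (simp add: card_Pow)
  then have "real (card ?Z) \<le> real (2 ^ card (cl ` K))" by (simp only: of_nat_le_iff)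
  also have "\<dots> = 2 ^ card (cl ` K)" by simp
  also have "\<dots> \<le> exp 1 ^ card (cl ` K)" using exp_ge_add_one_self[of 1] by (intro power_mono) auto
  also have "\<dots> = exp (real (card (cl ` K)))" by (simp add: exp_of_nat_mult[symmetric])
  also have "\<dots> \<le> exp (real (card X) / s)" using le by simp
  finally show "real (card ?Z) \<le> exp (real (card X) / s)" .
qed

end


section \<open>Pairs separated by a grouping of the clusters of two balls\<close>

definition bulk :: "vertex set \<Rightarrow> real \<Rightarrow> config \<Rightarrow> vertex set" where
  "bulk W s \<omega> = {u \<in> W. s \<le> real (card (local_cluster W \<omega> u))}"

lemma determined_by_bulk: "determined_by (edges_within W) (bulk W s)"
  unfolding determined_by_def
proof (intro allI impI)
  fix \<omega> \<omega>' :: config assume *: "\<forall>e\<in>edges_within W. \<omega> e = \<omega>' e"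
  have "local_cluster W \<omega> u = local_cluster W \<omega>' u" for u
    by (rule determined_by_D[OF determined_by_local_cluster]) (use * in auto)
  then show "bulk W s \<omega> = bulk W s \<omega>'" by (simp add: bulk_def)
qed

lemma finite_partition_local_cluster:
  "finite W \<Longrightarrow> finite_partition W (local_cluster W \<omega>)"
  by unfold_locales (auto simp: local_cluster_refl local_cluster_eq dest: subsetD[OF local_cluster_subset])

text \<open>The pairs of \<open>k\<close> between \<open>X\<close> and \<open>Y\<close> that
  \<open>Z\<close> separates. Pairs inside \<open>X\<close> or inside \<open>Y\<close> are left out
  because those edges already determine the bulk and the admissible \<open>Z\<close>.\<close>

definition cross_edges :: "vertex set \<Rightarrow> vertex set \<Rightarrow> vertex set \<Rightarrow> vertex set \<Rightarrow> vertex set set" where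
  "cross_edges X Y k Z = edges_between (Z \<inter> k \<inter> X) ((k - Z) \<inter> Y) \<union> edges_between ((k - Z) \<inter> X) (Z \<inter> k \<inter> Y)"

lemma cross_edges_cases:
  assumes "e \<in> cross_edges X Y k Z"
  obtains u v where "e = {u, v}" "u \<in> Z \<inter> k" "v \<in> k - Z"
proof -
  consider "e \<in> edges_between (Z \<inter> k \<inter> X) ((k - Z) \<inter> Y)" | "e \<in> edges_between ((k - Z) \<inter> X) (Z \<inter> k \<inter> Y)"
    using assms by (auto simp: cross_edges_def)
  then show thesis
  proof cases
    case 1
    then obtain u v where "e = {u, v}" "u \<in> Z \<inter> k" "v \<in> k - Z" by (auto simp: edges_between_def)
    then show thesis by (rule that)
  next
    case 2
    then obtain u v where "e = {u, v}" "u \<in> k - Z" "v \<in> Z \<inter> k" by (auto simp: edges_between_def)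
    then show thesis using that[of v u] by (simp add: insert_commute)
  qed
qed

text \<open>For disjoint \<open>X\<close> and \<open>Y\<close>, these are the clusters that remain
  in the union after all edges between the two sets are deleted.\<close>

definition two_cluster :: "vertex set \<Rightarrow> vertex set \<Rightarrow> config \<Rightarrow> vertex \<Rightarrow> vertex set" where
  "two_cluster X Y \<omega> x = (if x \<in> X then local_cluster X \<omega> x else local_cluster Y \<omega> x)"

lemma finite_partition_two_cluster:
  assumes "finite X" "finite Y" "X \<inter> Y = {}"
  shows "finite_partition (X \<union> Y) (two_cluster X Y \<omega>)"
proof
  show "finite (X \<union> Y)" using assms by simp
  fix x assume x: "x \<in> X \<union> Y"
  show "x \<in> two_cluster X Y \<omega> x" by (simp add: two_cluster_def local_cluster_refl)
  show "two_cluster X Y \<omega> x \<subseteq> X \<union> Y"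
    using x local_cluster_subset[of x X] local_cluster_subset[of x Y] by (auto simp: two_cluster_def)
  fix y assume y: "y \<in> two_cluster X Y \<omega> x"
  show "two_cluster X Y \<omega> y = two_cluster X Y \<omega> x"
  proof (cases "x \<in> X")
    case True
    then have "y \<in> X" using y local_cluster_subset[OF True] by (auto simp: two_cluster_def)
    then show ?thesis using y True by (simp add: two_cluster_def local_cluster_eq)
  next
    case False
    then have xY: "x \<in> Y" using x by simp
    have "y \<in> Y" using y False local_cluster_subset[OF xY] by (auto simp: two_cluster_def)
    then have "y \<notin> X" using assms(3) by auto
    then show ?thesis using y False by (simp add: two_cluster_def local_cluster_eq)
  qed
qed

lemma two_cluster_bulk:
  assumes "X \<inter> Y = {}"
  shows "{x \<in> X \<union> Y. s \<le> real (card (two_cluster X Y \<omega> x))} = bulk X s \<omega> \<union> bulk Y s \<omega>"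
  using assms by (auto simp: two_cluster_def bulk_def split: if_splits)

text \<open>Only the \<open>X\<close> side has to be balanced. Each vertex of \<open>k1\<close> lies
  either in \<open>Z\<close> or outside it, and in both cases at least a quarter of
  \<open>k0\<close> is on the opposite side.\<close>

lemma card_cross_edges:
  assumes "finite X" "finite Y" "X \<inter> Y = {}" "k0 \<subseteq> X" "k1 \<subseteq> Y"
    and k: "k = k0 \<union> k1" and h: "0 \<le> h" "h \<le> real (card k0)" "h \<le> real (card k1)"
    and Z: "real (card k0) / 4 \<le> real (card (Z \<inter> k0))" "real (card (Z \<inter> k0)) \<le> 3 * real (card k0) / 4"
  shows "h\<^sup>2 / 4 \<le> real (card (cross_edges X Y k Z))"
proof -
  have fin: "finite k0" "finite k1" using assms finite_subset by auto
  have sets: "Z \<inter> k \<inter> X = Z \<inter> k0" "(k - Z) \<inter> Y = k1 - Z" "(k - Z) \<inter> X = k0 - Z" "Z \<inter> k \<inter> Y = Z \<inter> k1"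
    using assms by auto
  have c1: "card (edges_between (Z \<inter> k0) (k1 - Z)) = card (Z \<inter> k0) * card (k1 - Z)"
    and c2: "card (edges_between (k0 - Z) (Z \<inter> k1)) = card (k0 - Z) * card (Z \<inter> k1)"
    using fin assms(3-5) by (auto intro!: card_edges_between)
  have "edges_between (Z \<inter> k0) (k1 - Z) \<inter> edges_between (k0 - Z) (Z \<inter> k1) = {}"
    using assms(3-5) unfolding edges_between_def by (fastforce simp: doubleton_eq_iff)
  then have card_eq: "card (cross_edges X Y k Z) = card (Z \<inter> k0) * card (k1 - Z) + card (k0 - Z) * card (Z \<inter> k1)"
    unfolding cross_edges_def sets using fin c1 c2 by (subst card_Un_disjoint) (auto intro!: finite_edges_between)
  have split: "card (k0 - Z) + card (Z \<inter> k0) = card k0" "card (k1 - Z) + card (Z \<inter> k1) = card k1"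
    using card_Diff_subset_Int[of k0 Z] card_Diff_subset_Int[of k1 Z] fin
      card_mono[of k0 "k0 \<inter> Z"] card_mono[of k1 "k1 \<inter> Z"] by (auto simp: Int_commute)
  have "real (card (k0 - Z)) + real (card (Z \<inter> k0)) = real (card k0)"
    using split(1) by (simp flip: of_nat_add)
  then have q: "real (card k0) / 4 \<le> real (card (k0 - Z))" using Z(2) by linarith
  have "h\<^sup>2 / 4 = h / 4 * h" by (simp add: power2_eq_square)
  also have "\<dots> \<le> real (card k0) / 4 * real (card k1)" using h by (intro mult_mono) auto
  also have "\<dots> = real (card k0) / 4 * real (card (k1 - Z)) + real (card k0) / 4 * real (card (Z \<inter> k1))"
    unfolding split(2)[symmetric] by (simp add: distrib_left)
  also have "\<dots> \<le> real (card (Z \<inter> k0)) * real (card (k1 - Z)) + real (card (k0 - Z)) * real (card (Z \<inter> k1))"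
    using Z q by (intro add_mono mult_right_mono) auto
  also have "\<dots> = real (card (cross_edges X Y k Z))" by (simp add: card_eq)
  finally show ?thesis .
qed

text \<open>If all clusters of \<open>W\<close> are small, whole clusters can be grouped into a set
  \<open>S\<close> containing between a quarter and three quarters of the bulk of \<open>X\<close>;
  no open edge of \<open>W\<close> leaves \<open>S\<close>. Although \<open>S\<close> depends on all
  edges of \<open>W\<close>, its trace on the bulk is a union of inner clusters, so the candidates
  for it are known from the edges inside \<open>X\<close> and \<open>Y\<close>.\<close>

lemma no_large_cluster_split:
  assumes fin: "finite W" and sub: "X \<subseteq> W" "Y \<subseteq> W" and disj: "X \<inter> Y = {}"
    and h: "0 \<le> h" "h \<le> real (card (bulk X s \<omega>))" "h \<le> real (card (bulk Y s \<omega>))"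
    and not_large: "\<not> large_cluster W (h / 4) \<omega>"
  defines "k \<equiv> bulk X s \<omega> \<union> bulk Y s \<omega>"
  shows "\<exists>Z\<subseteq>k. (\<forall>x\<in>Z. two_cluster X Y \<omega> x \<subseteq> Z) \<and> h\<^sup>2 / 4 \<le> real (card (cross_edges X Y k Z)) \<and>
    (\<forall>e\<in>cross_edges X Y k Z. \<not> \<omega> e)"
proof -
  have finXY: "finite X" "finite Y" using fin sub finite_subset by auto
  interpret W: finite_partition W "local_cluster W \<omega>" by (rule finite_partition_local_cluster[OF fin])
  interpret T: finite_partition "X \<union> Y" "two_cluster X Y \<omega>"
    by (rule finite_partition_two_cluster[OF finXY disj])
  have k_eq: "k = {x \<in> X \<union> Y. s \<le> real (card (two_cluster X Y \<omega> x))}"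
    unfolding k_def using two_cluster_bulk[OF disj] by simp
  have bulks: "bulk X s \<omega> \<subseteq> X" "bulk Y s \<omega> \<subseteq> Y" by (auto simp: bulk_def)
  have small: "real (card (local_cluster W \<omega> x)) \<le> h / 4" if "x \<in> W" for x
    using not_large that unfolding large_cluster_def by (meson le_cases)
  have bW: "bulk X s \<omega> \<subseteq> W" using bulks(1) sub(1) by (rule order_trans)
  obtain S where S: "\<forall>x\<in>S. local_cluster W \<omega> x \<subseteq> S"
    "real (card (bulk X s \<omega>)) / 2 \<le> real (card (S \<inter> bulk X s \<omega>))"
    "real (card (S \<inter> bulk X s \<omega>)) \<le> real (card (bulk X s \<omega>)) / 2 + h / 4"
    using W.balanced_split[OF bW small] h(1) by auto
  \<comment> \<open>Restricting to the bulk discards inner clusters smaller than \<open>s\<close>,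
    which would be too many to enumerate.\<close>
  define Z where "Z = S \<inter> k"
  have "two_cluster X Y \<omega> x \<subseteq> Z" if x: "x \<in> Z" for x
  proof
    fix y assume y: "y \<in> two_cluster X Y \<omega> x"
    have xk: "x \<in> k" "x \<in> X \<union> Y" "x \<in> S" using x by (auto simp: Z_def k_eq)
    have "two_cluster X Y \<omega> x \<subseteq> local_cluster W \<omega> x"
      unfolding two_cluster_def using local_cluster_mono sub by auto
    then have "y \<in> S" using S(1) xk y by blast
    moreover have "y \<in> k" using T.cl_eq[OF xk(2) y] T.cl_subset[OF xk(2)] y xk(1) by (auto simp: k_eq)
    ultimately show "y \<in> Z" by (simp add: Z_def)
  qed
  moreover have "h\<^sup>2 / 4 \<le> real (card (cross_edges X Y k Z))"
  proof (rule card_cross_edges[OF finXY disj bulks k_def[THEN meta_eq_to_obj_eq] h])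
    have "Z \<inter> bulk X s \<omega> = S \<inter> bulk X s \<omega>" by (auto simp: Z_def k_def)
    then show "real (card (bulk X s \<omega>)) / 4 \<le> real (card (Z \<inter> bulk X s \<omega>))"
      "real (card (Z \<inter> bulk X s \<omega>)) \<le> 3 * real (card (bulk X s \<omega>)) / 4"
      using S(2,3) h(2) by simp_all
  qed
  moreover have "\<not> \<omega> e" if e: "e \<in> cross_edges X Y k Z" for e
  proof
    assume open_e: "\<omega> e"
    obtain u v where uv: "e = {u, v}" "u \<in> S" "v \<in> k" "v \<notin> S" "u \<in> k"
      by (rule cross_edges_cases[OF e]) (auto simp: Z_def)
    have "u \<in> W" "v \<in> W" using uv sub by (auto simp: k_eq)
    then have "local_cluster W \<omega> u = local_cluster W \<omega> v"
      using open_e uv(1) by (intro local_cluster_edge) auto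
    then show False using S(1) uv local_cluster_refl by blast
  qed
  ultimately show ?thesis by (intro exI[of _ Z]) (auto simp: Z_def)
qed

context percolation_model
begin

text \<open>Union bound over the pairs of the bulk and a union \<open>Z\<close> of its inner clusters; given the inner
  configuration there are at most \<open>exp (2 N ^ n / s)\<close> choices of \<open>Z\<close>.\<close>

lemma pr_no_merge_le:
  assumes y: "y \<in> reps n 1" "y \<noteq> (\<lambda>_. 0)" and "0 < s" "0 \<le> h"
  shows "Pr (\<lambda>\<omega>. (h \<le> real (card (bulk (B0 n) s \<omega>)) \<and> h \<le> real (card (bulk (B n y) s \<omega>))) \<and>
      \<not> large_cluster (B0 (n + 1)) (h / 4) \<omega>)
    \<le> exp (2 * real (N ^ n) / s) * exp (- a * (h\<^sup>2 / 4) / b1 ^ (n + 1))"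
proof -
  let ?X = "B0 n" and ?Y = "B n y" and ?W = "B0 (n + 1)"
  have yV: "y \<in> V" using y(1) by (rule reps_V)
  have sub: "?X \<subseteq> ?W" "?Y \<subseteq> ?W" using reps_ball_subset[OF y(1)] hball_mono[of n "n + 1"] by auto
  have disj: "?X \<inter> ?Y = {}" using reps_ball_disjoint[OF zero_in_reps y(1)] y(2) by auto
  have fin: "finite ?X" "finite ?Y" "finite ?W" using finite_hball zero_V yV by auto
  let ?A = "edges_within ?X \<union> edges_within ?Y" and ?B = "edges_between ?X ?Y"
  let ?I = "{i \<in> Pow (?X \<union> ?Y) \<times> Pow (?X \<union> ?Y). h\<^sup>2 / 4 \<le> real (card (cross_edges ?X ?Y (fst i) (snd i)))}"
  let ?K = "\<lambda>\<omega>. bulk ?X s \<omega> \<union> bulk ?Y s \<omega>"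
  \<comment> \<open>The bulk is recorded as the first component of the index, so that the edges
    required closed in \<open>?G\<close> form a deterministic set.\<close>
  let ?F = "\<lambda>i \<omega>. fst i = ?K \<omega> \<and> snd i \<subseteq> ?K \<omega> \<and> (\<forall>x\<in>snd i. two_cluster ?X ?Y \<omega> x \<subseteq> snd i)"
  let ?G = "\<lambda>i \<omega>. \<forall>e\<in>cross_edges ?X ?Y (fst i) (snd i). \<not> \<omega> e"
  have finI: "finite ?I" using fin by simp
  have finA: "finite ?A" and AE: "?A \<subseteq> E" using edges_hball[OF zero_V] edges_hball[OF yV] by auto
  have finB: "finite ?B" and BE: "?B \<subseteq> E"
    using fin hball_subset by (auto intro!: finite_edges_between) (blast dest: subsetD[OF edges_between_subset])
  have cross_sub: "cross_edges ?X ?Y k Z \<subseteq> ?B" for k Z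
    unfolding cross_edges_def by (intro Un_least edges_between_mono) auto
  have detF: "determined_by ?A (?F i)" for i
    unfolding determined_by_def
  proof (intro allI impI)
    fix \<omega> \<omega>' :: config assume *: "\<forall>e\<in>?A. \<omega> e = \<omega>' e"
    have "bulk ?X s \<omega> = bulk ?X s \<omega>'" "bulk ?Y s \<omega> = bulk ?Y s \<omega>'"
      by (rule determined_by_D[OF determined_by_bulk]; use * in blast)+
    moreover have "local_cluster ?X \<omega> x = local_cluster ?X \<omega>' x" "local_cluster ?Y \<omega> x = local_cluster ?Y \<omega>' x" for x
      by (rule determined_by_D[OF determined_by_local_cluster]; use * in blast)+
    ultimately show "?F i \<omega> = ?F i \<omega>'" by (simp only: two_cluster_def)
  qed
  have count: "real (card {i \<in> ?I. ?F i \<omega>}) \<le> exp (2 * real (N ^ n) / s)" for \<omega>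
  proof -
    interpret T: finite_partition "?X \<union> ?Y" "two_cluster ?X ?Y \<omega>"
      by (rule finite_partition_two_cluster[OF fin(1,2) disj])
    let ?Z = "{Z. Z \<subseteq> ?K \<omega> \<and> (\<forall>x\<in>Z. two_cluster ?X ?Y \<omega> x \<subseteq> Z)}"
    note T.card_closed_unions_le[OF assms(3) two_cluster_bulk[OF disj, symmetric]]
    note Z = this
    have sub_img: "{i \<in> ?I. ?F i \<omega>} \<subseteq> Pair (?K \<omega>) ` ?Z" by force
    have "card {i \<in> ?I. ?F i \<omega>} \<le> card (Pair (?K \<omega>) ` ?Z)"
      by (rule card_mono[OF finite_imageI[OF Z(1)] sub_img])
    also have "\<dots> \<le> card ?Z" by (rule card_image_le[OF Z(1)])
    finally have "real (card {i \<in> ?I. ?F i \<omega>}) \<le> real (card ?Z)" by (simp only: of_nat_le_iff)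
    also have "\<dots> \<le> exp (real (card (?X \<union> ?Y)) / s)" by (rule Z(2))
    also have "real (card (?X \<union> ?Y)) = 2 * real (N ^ n)"
      using card_Un_disjoint[OF fin(1,2) disj] by (simp add: card_hball[OF zero_V] card_hball[OF yV])
    finally show ?thesis .
  qed
  have detEx: "determined_by (?A \<union> ?B) (\<lambda>\<omega>. \<exists>i\<in>?I. ?F i \<omega> \<and> ?G i \<omega>)"
    by (rule determined_by_bex[OF determined_by_conj_Un[OF detF determined_by_closed[OF cross_sub]]])
  have "Pr (\<lambda>\<omega>. (h \<le> real (card (bulk ?X s \<omega>)) \<and> h \<le> real (card (bulk ?Y s \<omega>))) \<and>
      \<not> large_cluster ?W (h / 4) \<omega>) \<le> Pr (\<lambda>\<omega>. \<exists>i\<in>?I. ?F i \<omega> \<and> ?G i \<omega>)"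
  proof (rule pr_mono[OF _ _ detEx])
    fix \<omega> assume "(h \<le> real (card (bulk ?X s \<omega>)) \<and> h \<le> real (card (bulk ?Y s \<omega>))) \<and>
      \<not> large_cluster ?W (h / 4) \<omega>"
    then have *: "h \<le> real (card (bulk ?X s \<omega>))" "h \<le> real (card (bulk ?Y s \<omega>))"
      "\<not> large_cluster ?W (h / 4) \<omega>" by simp_all
    from no_large_cluster_split[OF fin(3) sub disj assms(4) *]
    obtain Z where Z: "Z \<subseteq> ?K \<omega>" "\<forall>x\<in>Z. two_cluster ?X ?Y \<omega> x \<subseteq> Z"
      "h\<^sup>2 / 4 \<le> real (card (cross_edges ?X ?Y (?K \<omega>) Z))" "\<forall>e\<in>cross_edges ?X ?Y (?K \<omega>) Z. \<not> \<omega> e"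
      by (elim exE conjE)
    have K: "?K \<omega> \<subseteq> ?X \<union> ?Y" by (auto simp: bulk_def)
    then have "Z \<subseteq> ?X \<union> ?Y" using Z(1) by (rule order_trans[rotated])
    with K Z(3) have "(?K \<omega>, Z) \<in> ?I"
      by (simp only: mem_Collect_eq mem_Times_iff fst_conv snd_conv Pow_iff simp_thms)
    moreover have "?F (?K \<omega>, Z) \<omega> \<and> ?G (?K \<omega>, Z) \<omega>"
      unfolding fst_conv snd_conv using Z(1,2,4) by (intro conjI refl)
    ultimately show "\<exists>i\<in>?I. ?F i \<omega> \<and> ?G i \<omega>" by (rule rev_bexI)
  qed (use finA AE finB BE in auto)
  also have "\<dots> \<le> exp (2 * real (N ^ n) / s) * exp (- a * (h\<^sup>2 / 4) / b1 ^ (n + 1))"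
  proof (rule pr_ex_conj_le[OF finA AE finB BE _ finI detF determined_by_closed[OF cross_sub] _ exp_ge_zero count])
    show "?A \<inter> ?B = {}" using edges_within_between_disjoint[OF disj] by blast
    fix i assume i: "i \<in> ?I"
    show "Pr (?G i) \<le> exp (- a * (h\<^sup>2 / 4) / b1 ^ (n + 1))"
      by (rule pr_closed_le) (use i cross_sub edges_between_subset_within[OF sub] in auto)
  qed
  finally show ?thesis .
qed

text \<open>By transitivity the expected density of the bulk is at least \<open>2 * \<eta>\<close>;
  the reverse Markov inequality at density \<open>\<eta>\<close> leaves probability
  \<open>\<eta>\<close>.\<close>

lemma pr_bulk_ge:
  assumes "y \<in> V" "0 \<le> \<eta>" "2 * \<eta> \<le> Pr (\<lambda>\<omega>. s \<le> real (card (C0 n \<omega>)))"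
  shows "\<eta> \<le> Pr (\<lambda>\<omega>. \<eta> * real (N ^ n) \<le> real (card (bulk (B n y) s \<omega>)))"
proof -
  let ?Y = "B n y"
  let ?q = "Pr (\<lambda>\<omega>. s \<le> real (card (C0 n \<omega>)))"
  have N0: "0 < real (N ^ n)" using N_ge_2 by simp
  have "Pr (\<lambda>\<omega>. s \<le> real (card (local_cluster ?Y \<omega> x))) = ?q" if "x \<in> ?Y" for x
  proof -
    have "x \<in> V" using that hball_subset by auto
    \<comment> \<open>Every point of an ultrametric ball is a centre of it.\<close>
    then show ?thesis using pr_cluster_size_transitive[of x s n] hball_cong[OF that] by simp
  qed
  then have "real (N ^ n) * ?q = (\<Sum>x\<in>?Y. Pr (\<lambda>\<omega>. s \<le> real (card (local_cluster ?Y \<omega> x))))"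
    by (simp add: card_hball[OF assms(1)])
  also have "\<dots> \<le> real (card ?Y) * Pr (\<lambda>\<omega>. \<eta> * real (N ^ n) \<le>
      real (card {x\<in>?Y. s \<le> real (card (local_cluster ?Y \<omega> x))})) + \<eta> * real (N ^ n)"
    by (rule reverse_Markov_card[OF edges_hball[OF assms(1)] finite_hball[OF assms(1)]
          determined_by_comp[OF determined_by_local_cluster]]) (use assms N0 in auto)
  finally have "real (N ^ n) * ?q \<le>
      real (N ^ n) * (Pr (\<lambda>\<omega>. \<eta> * real (N ^ n) \<le> real (card (bulk ?Y s \<omega>))) + \<eta>)"
    by (simp only: card_hball[OF assms(1)] bulk_def) (simp add: algebra_simps)
  then have "?q \<le> Pr (\<lambda>\<omega>. \<eta> * real (N ^ n) \<le> real (card (bulk ?Y s \<omega>))) + \<eta>"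
    using N0 by (simp only: mult_le_cancel_left_pos)
  then show ?thesis using assms(3) by linarith
qed

text \<open>Two sibling balls have dense bulks simultaneously with probability at least the square
  of \<open>\<eta>\<close>, by independence; the subtracted term is the probability that they then
  fail to merge.\<close>

lemma pr_large_next_ge:
  assumes "0 < s" "0 \<le> \<eta>" "2 * \<eta> \<le> Pr (\<lambda>\<omega>. s \<le> real (card (C0 n \<omega>)))"
  shows "\<eta>\<^sup>2 - exp (2 * real (N ^ n) / s) * exp (- a * ((\<eta> * real (N ^ n))\<^sup>2 / 4) / b1 ^ (n + 1))
    \<le> Pr (large_cluster (B0 (n + 1)) (\<eta> * real (N ^ n) / 4))"
proof -
  let ?h = "\<eta> * real (N ^ n)"
  obtain y where y: "y \<in> reps n 1" "y \<noteq> (\<lambda>_. 0)" using ex_nonzero_rep[of 1 n] by auto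
  have yV: "y \<in> V" using y(1) by (rule reps_V)
  let ?P = "\<lambda>\<omega>. ?h \<le> real (card (bulk (B0 n) s \<omega>)) \<and> ?h \<le> real (card (bulk (B n y) s \<omega>))"
  let ?L = "large_cluster (B0 (n + 1)) (?h / 4)"
  have det0: "determined_by (edges_within (B n x)) (\<lambda>\<omega>. ?h \<le> real (card (bulk (B n x) s \<omega>)))" for x
    by (rule determined_by_comp[OF determined_by_bulk])
  have disj: "B0 n \<inter> B n y = {}" using reps_ball_disjoint[OF zero_in_reps y(1)] y(2) by auto
  have "\<eta> * \<eta> \<le> Pr (\<lambda>\<omega>. ?h \<le> real (card (bulk (B0 n) s \<omega>))) * Pr (\<lambda>\<omega>. ?h \<le> real (card (bulk (B n y) s \<omega>)))"
    by (intro mult_mono pr_bulk_ge zero_V yV assms pr_nonneg)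
  also have "\<dots> = Pr ?P"
    by (rule pr_indep[OF edges_hball[OF zero_V] det0 edges_hball[OF yV] det0
          edges_within_disjoint[OF disj], symmetric])
  also have "\<dots> \<le> Pr (\<lambda>\<omega>. ?L \<omega> \<or> ?P \<omega> \<and> \<not> ?L \<omega>)"
  proof -
    have detP: "determined_by (edges_within (B0 (n + 1))) ?P"
      by (rule determined_by_comp2[OF determined_by_mono_hball[OF det0 zero_in_reps]
            determined_by_mono_hball[OF det0 y(1)], where h = "(\<and>)"])
    have "determined_by (edges_within (B0 (n + 1))) (\<lambda>\<omega>. ?L \<omega> \<or> ?P \<omega> \<and> \<not> ?L \<omega>)"
      by (rule determined_by_comp2[OF determined_by_large_cluster detP, where h = "\<lambda>l p. l \<or> p \<and> \<not> l"])
    then show ?thesis by (rule pr_mono[OF edges_hball[OF zero_V]]) blast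
  qed
  also have "\<dots> \<le> Pr ?L + Pr (\<lambda>\<omega>. ?P \<omega> \<and> \<not> ?L \<omega>)"
  proof -
    have detP: "determined_by (edges_within (B0 (n + 1))) ?P"
      by (rule determined_by_comp2[OF determined_by_mono_hball[OF det0 zero_in_reps]
            determined_by_mono_hball[OF det0 y(1)], where h = "(\<and>)"])
    have "determined_by (edges_within (B0 (n + 1))) (\<lambda>\<omega>. ?P \<omega> \<and> \<not> ?L \<omega>)"
      by (rule determined_by_comp2[OF determined_by_large_cluster detP, where h = "\<lambda>l p. p \<and> \<not> l"])
    then show ?thesis by (rule pr_disj_le[OF edges_hball[OF zero_V] determined_by_large_cluster])
  qed
  also have "Pr (\<lambda>\<omega>. ?P \<omega> \<and> \<not> ?L \<omega>) \<le>
      exp (2 * real (N ^ n) / s) * exp (- a * (?h\<^sup>2 / 4) / b1 ^ (n + 1))"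
    using assms by (intro pr_no_merge_le[OF y]) auto
  finally show ?thesis by (simp add: power2_eq_square)
qed

end


section \<open>Clusters of positive density\<close>

lemma eventually_power_ge:
  assumes "1 < (x :: real)" shows "\<forall>\<^sub>F n in sequentially. c \<le> x ^ n"
proof -
  obtain m where m: "c < x ^ m" using real_arch_pow[OF assms] by blast
  have "c \<le> x ^ n" if "m \<le> n" for n
    using m power_increasing[OF that, of x] assms by linarith
  then show ?thesis by (auto simp: eventually_sequentially)
qed

context percolation_model
begin

lemma pr_large_eventually_bounded_below:
  assumes "0 < percolation_prob N a b"
  shows "\<exists>c>0. \<exists>q>0. \<forall>\<^sub>F n in sequentially. q \<le> Pr (large_cluster (B0 n) (c * real (N ^ n)))"
proof -
  let ?\<theta> = "percolation_prob N a b"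
  \<comment> \<open>\<open>origin_large\<close> is used with an error of half the percolation
    probability, and the remaining half is \<open>2 * \<eta>\<close>.\<close>
  define \<eta> where "\<eta> = ?\<theta> / 4"
  \<comment> \<open>With this \<open>A\<close> the entropy exponent is \<open>2 / A * ?R ^ n\<close>
    and the energy exponent \<open>4 / A * ?R ^ n\<close>, so the product decays as
    \<open>exp (- (2 / A * ?R ^ n))\<close>.\<close>
  define A where "A = 16 * b1 / (a * \<eta>\<^sup>2)"
  let ?R = "(real N)\<^sup>2 / b1"
  have N0: "0 < real N" using N_ge_2 by simp
  have \<eta>: "0 < \<eta>" using assms by (simp add: \<eta>_def)
  have A: "0 < A" using a_pos \<eta> b1_facts by (auto simp: A_def intro!: divide_pos_pos mult_pos_pos)
  have R: "1 < ?R" using b1_less_N_square[OF assms] b1_facts by (simp only: less_divide_eq_1_pos)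
  have "\<forall>\<^sub>F n in sequentially. \<eta>\<^sup>2 / 2 \<le> Pr (large_cluster (B0 (Suc n)) (\<eta> / (4 * N) * real (N ^ Suc n)))"
    using origin_large[OF A half_gt_zero[OF assms]] eventually_power_ge[OF R, of "A / 2 * (- ln (\<eta>\<^sup>2 / 2))"]
  proof eventually_elim
    case (elim n)
    let ?s = "A * (b1 / N) ^ n"
    have s: "0 < ?s" using A N0 b1_facts by simp
    have "2 * \<eta> \<le> Pr (\<lambda>\<omega>. ?s \<le> real (card (C0 n \<omega>)))" using elim(1) assms by (simp add: \<eta>_def)
    then have "\<eta>\<^sup>2 - exp (2 * real (N ^ n) / ?s) * exp (- a * ((\<eta> * real (N ^ n))\<^sup>2 / 4) / b1 ^ (n + 1))
      \<le> Pr (large_cluster (B0 (n + 1)) (\<eta> * real (N ^ n) / 4))"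
      by (intro pr_large_next_ge s less_imp_le[OF \<eta>])
    moreover have "exp (2 * real (N ^ n) / ?s) * exp (- a * ((\<eta> * real (N ^ n))\<^sup>2 / 4) / b1 ^ (n + 1)) \<le> \<eta>\<^sup>2 / 2"
    proof -
      have e1: "2 * real (N ^ n) / ?s = 2 / A * ?R ^ n"
        using N0 b1_facts A by (simp add: power_divide power_mult[symmetric] field_simps power2_eq_square power_mult_distrib)
      have "a * \<eta>\<^sup>2 = 16 * b1 / A" using a_pos \<eta> b1_facts A by (simp add: A_def)
      moreover have "a * ((\<eta> * real (N ^ n))\<^sup>2 / 4) / b1 ^ (n + 1) = a * \<eta>\<^sup>2 / (4 * b1) * ?R ^ n"
        by (simp add: power_divide power_mult_distrib power_mult[symmetric] mult_ac)
      ultimately have e2: "a * ((\<eta> * real (N ^ n))\<^sup>2 / 4) / b1 ^ (n + 1) = 4 / A * ?R ^ n"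
        using b1_facts A by simp
      have "- ln (\<eta>\<^sup>2 / 2) \<le> 2 / A * ?R ^ n"
        using mult_left_mono[OF elim(2), of "2 / A"] A by simp
      then have "exp (- (2 / A * ?R ^ n)) \<le> exp (ln (\<eta>\<^sup>2 / 2))" by (simp only: exp_le_cancel_iff)
      also have "\<dots> = \<eta>\<^sup>2 / 2" using \<eta> by simp
      finally have "exp (- (2 / A * ?R ^ n)) \<le> \<eta>\<^sup>2 / 2" .
      moreover have "2 / A * ?R ^ n + - (4 / A * ?R ^ n) = - (2 / A * ?R ^ n)"
        by (simp add: field_simps)
      ultimately show ?thesis
        unfolding mult_minus_left minus_divide_left[symmetric] e2 e1 exp_add[symmetric] by (simp only:)
    qed
    \<comment> \<open>The merged cluster lives in the ball of radius \<open>n + 1\<close>, hence the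
      factor \<open>N\<close> in the denominator of the density.\<close>
    moreover have eq: "\<eta> / (4 * N) * real (N ^ (n + 1)) = \<eta> * real (N ^ n) / 4" using N0 by simp
    ultimately show ?case unfolding Suc_eq_plus1 eq by linarith
  qed
  then have "\<forall>\<^sub>F n in sequentially. \<eta>\<^sup>2 / 2 \<le> Pr (large_cluster (B0 n) (\<eta> / (4 * N) * real (N ^ n)))"
    by (rule eventually_sequentially_Suc[THEN iffD1])
  moreover have "0 < \<eta> / (4 * N)" "0 < \<eta>\<^sup>2 / 2" using \<eta> N0 by auto
  ultimately show ?thesis by blast
qed

text \<open>The threshold \<open>s\<close> stays fixed while the ball grows, so two disjoint
  subballs both have to fail. Each step divides the density by \<open>N\<close>, which is affordable
  for a fixed number of steps.\<close>

lemma pr_not_large_next_le: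
  "1 - Pr (large_cluster (B0 (n + 1)) s) \<le> (1 - Pr (large_cluster (B0 n) s))\<^sup>2"
proof -
  obtain y where y: "y \<in> reps n 1" "y \<noteq> (\<lambda>_. 0)" using ex_nonzero_rep[of 1 n] by auto
  have det: "determined_by (edges_within (B0 (n + 1)))
      (\<lambda>\<omega>. \<not> large_cluster (B0 n) s \<omega> \<and> \<not> large_cluster (B n y) s \<omega>)"
    by (rule determined_by_comp2[OF determined_by_mono_hball[OF determined_by_large_cluster zero_in_reps]
          determined_by_mono_hball[OF determined_by_large_cluster y(1)], where h = "\<lambda>x y. \<not> x \<and> \<not> y"])
  have "1 - Pr (large_cluster (B0 (n + 1)) s) = Pr (\<lambda>\<omega>. \<not> large_cluster (B0 (n + 1)) s \<omega>)"
    by (simp only: pr_not[OF edges_hball[OF zero_V] determined_by_large_cluster])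
  also have "\<dots> \<le> Pr (\<lambda>\<omega>. \<not> large_cluster (B0 n) s \<omega> \<and> \<not> large_cluster (B n y) s \<omega>)"
    using large_cluster_mono[OF reps_ball_subset[OF zero_in_reps] finite_hball[OF zero_V] order_refl]
      large_cluster_mono[OF reps_ball_subset[OF y(1)] finite_hball[OF zero_V] order_refl]
    by (intro pr_mono[OF edges_hball[OF zero_V] det]) blast
  also have "\<dots> = (1 - Pr (large_cluster (B0 n) s))\<^sup>2"
    using y zero_in_reps by (intro pr_two_not_large[of _ n 1]) auto
  finally show ?thesis .
qed

lemma pr_not_large_iterate_le:
  "1 - Pr (large_cluster (B0 (n + j)) s) \<le> (1 - Pr (large_cluster (B0 n) s)) ^ (2 ^ j)"
proof (induction j)
  case (Suc j)
  have "1 - Pr (large_cluster (B0 (n + Suc j)) s) \<le> (1 - Pr (large_cluster (B0 (n + j)) s))\<^sup>2"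
    using pr_not_large_next_le[of "n + j" s] by simp
  also have "\<dots> \<le> ((1 - Pr (large_cluster (B0 n) s)) ^ (2 ^ j))\<^sup>2"
    using Suc pr_le_1 by (intro power_mono) auto
  also have "\<dots> = (1 - Pr (large_cluster (B0 n) s)) ^ (2 ^ Suc j)"
    by (simp add: power_mult[symmetric] mult.commute)
  finally show ?case .
qed simp

lemma pr_large_eventually_near_1:
  assumes "0 < percolation_prob N a b" "0 < \<delta>"
  shows "\<exists>c>0. \<forall>\<^sub>F n in sequentially. 1 - \<delta> < Pr (large_cluster (B0 n) (c * real (N ^ n)))"
proof -
  obtain c q where cq: "0 < c" "0 < q"
    and ev: "\<forall>\<^sub>F n in sequentially. q \<le> Pr (large_cluster (B0 n) (c * real (N ^ n)))"
    using pr_large_eventually_bounded_below[OF assms(1)] by blast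
  obtain n0 where "q \<le> Pr (large_cluster (B0 n0) (c * real (N ^ n0)))"
    using ev by (auto simp: eventually_sequentially)
  then have q1: "q \<le> 1" using pr_le_1[of "large_cluster (B0 n0) (c * real (N ^ n0))"] by linarith
  obtain j where j: "(1 - q) ^ j < \<delta>" using real_arch_pow_inv[OF assms(2), of "1 - q"] cq by auto
  have N0: "0 < real N" using N_ge_2 by simp
  have "\<forall>\<^sub>F n in sequentially. 1 - \<delta> < Pr (large_cluster (B0 (n + j)) (c / real (N ^ j) * real (N ^ (n + j))))"
    using ev
  proof eventually_elim
    case (elim n)
    let ?s = "c * real (N ^ n)"
    have "1 - Pr (large_cluster (B0 (n + j)) ?s) \<le> (1 - Pr (large_cluster (B0 n) ?s)) ^ (2 ^ j)"
      by (rule pr_not_large_iterate_le)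
    also have "\<dots> \<le> (1 - q) ^ (2 ^ j)" using elim pr_le_1 by (intro power_mono) auto
    also have "\<dots> \<le> (1 - q) ^ j" using cq q1 by (intro power_decreasing less_imp_le[OF less_exp]) auto
    also have "\<dots> < \<delta>" by (rule j)
    finally have "1 - \<delta> < Pr (large_cluster (B0 (n + j)) ?s)" by simp
    moreover have "?s = c / real (N ^ j) * real (N ^ (n + j))" using N0 by (simp add: power_add)
    ultimately show ?case by simp
  qed
  then have "\<forall>\<^sub>F n in sequentially. 1 - \<delta> < Pr (large_cluster (B0 n) (c / real (N ^ j) * real (N ^ n)))"
    by (rule eventually_sequentially_seg[THEN iffD1])
  moreover have "0 < c / real (N ^ j)" using cq N0 by simp
  ultimately show ?thesis by blast
qed

end

section \<open>Semicontinuity\<close>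

lemma eventually_greater_of_isCont:
  fixes f :: "'a::t2_space \<Rightarrow> real"
  assumes "isCont f x" "c < f x" shows "\<forall>\<^sub>F y in nhds x. c < f y"
  using order_tendstoD(1)[of f "f x" "nhds x" c] assms
  by (simp add: isCont_def tendsto_at_iff_tendsto_nhds)

lemma eventually_less_of_isCont:
  fixes f :: "'a::t2_space \<Rightarrow> real"
  assumes "isCont f x" "f x < c" shows "\<forall>\<^sub>F y in nhds x. f y < c"
  using order_tendstoD(2)[of f "f x" "nhds x" c] assms
  by (simp add: isCont_def tendsto_at_iff_tendsto_nhds)

lemma percolation_prob_nonneg: "0 \<le> percolation_prob N a b"
  by (simp add: percolation_prob_def)

lemma percolation_prob_lower_semicontinuous:
  assumes "2 \<le> N" "0 < \<alpha>" "0 < \<beta>" "0 < \<epsilon>"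
  shows "\<forall>\<^sub>F x in nhds (\<alpha>, \<beta>). percolation_prob N \<alpha> \<beta> - \<epsilon> \<le> percolation_prob N (fst x) (snd x)"
proof (cases "0 < percolation_prob N \<alpha> \<beta>")
  case False
  then have "percolation_prob N \<alpha> \<beta> = 0" using percolation_prob_nonneg[of N \<alpha> \<beta>] by simp
  then have "percolation_prob N \<alpha> \<beta> - \<epsilon> \<le> percolation_prob N c d" for c d
    using percolation_prob_nonneg[of N c d] assms(4) by linarith
  then show ?thesis by (intro always_eventually allI)
next
  case True
  interpret percolation_model N \<alpha> \<beta> using assms by unfold_locales
  let ?\<theta> = "percolation_prob N \<alpha> \<beta>"
  have N0: "0 < real N" using assms(1) by simp
  let ?R = "(real N)\<^sup>2 / b1"
  have R: "1 < ?R" using b1_less_N_square[OF True] b1_facts by (simp only: less_divide_eq_1_pos)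
  \<comment> \<open>\<open>9 \<le> ?R ^ L\<close> means \<open>9 * b1 ^ L \<le> M ^ 2\<close>. As
    \<open>M - 1 \<ge> 2 / 3 * M\<close>, this gives \<open>(M - 1) ^ 2 \<ge> 4 * b1 ^ L\<close>,
    strictly more than required. \<open>2 \<le> L\<close> ensures
    \<open>3 \<le> N ^ L\<close>.\<close>
  obtain L where L: "2 \<le> L" "9 \<le> ?R ^ L"
    using eventually_conj[OF eventually_ge_at_top[of 2] eventually_power_ge[OF R, of 9]]
    by (auto simp: eventually_sequentially)
  define M where "M = real (N ^ L)"
  have "2 ^ 2 \<le> N ^ L" using power_mono[OF assms(1), of 2] power_increasing[OF L(1), of N] assms(1) by linarith
  then have NL: "3 \<le> N ^ L" by simp
  then have M3: "3 \<le> M" unfolding M_def by (metis of_nat_le_iff of_nat_numeral)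
  have rho: "2 * b1 ^ L < (M - 1)\<^sup>2"
  proof -
    have "9 * b1 ^ L \<le> M\<^sup>2"
      using L(2) b1_facts by (simp add: M_def power_divide field_simps power_mult[symmetric])
    moreover have "(2 / 3 * M)\<^sup>2 \<le> (M - 1)\<^sup>2" using M3 by (intro power_mono) auto
    then have "4 / 9 * M\<^sup>2 \<le> (M - 1)\<^sup>2" by (simp add: power2_eq_square)
    moreover have "0 < b1 ^ L" using b1_facts by simp
    ultimately show ?thesis by linarith
  qed
  \<comment> \<open>The final loss is \<open>\<epsilon> / 4 + 3 * \<delta> \<le> \<epsilon>\<close>;
    the second bound is the smallness condition of \<open>percolation_prob_ge\<close>.\<close>
  define \<delta> where "\<delta> = min (\<epsilon> / 4) (1 / (4 * M\<^sup>2))"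
  have \<delta>: "0 < \<delta>" "\<delta> \<le> \<epsilon> / 4" "4 * M\<^sup>2 * \<delta> \<le> 1"
  proof -
    show "0 < \<delta>" using assms(4) M3 by (simp add: \<delta>_def)
    have "4 * M\<^sup>2 * \<delta> \<le> 4 * M\<^sup>2 * (1 / (4 * M\<^sup>2))" unfolding \<delta>_def by (intro mult_left_mono) auto
    then show "4 * M\<^sup>2 * \<delta> \<le> 1" using M3 by simp
  qed (simp add: \<delta>_def)
  obtain c where c: "0 < c" and
    ev_large: "\<forall>\<^sub>F n in sequentially. 1 - \<delta> < Pr (large_cluster (B0 n) (c * real (N ^ n)))"
    using pr_large_eventually_near_1[OF True \<delta>(1)] by blast
  \<comment> \<open>It makes the exponent \<open>\<alpha> * (t0 * s0) / b1 ^ (n + L)\<close> equal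
    to \<open>\<bar>ln (\<delta> / (4 * M ^ 2))\<bar> + 1\<close> for every \<open>n\<close>. The
    summand 1 provides a strict inequality, which survives a change of parameters.\<close>
  define A where "A = (\<bar>ln (\<delta> / (4 * M\<^sup>2))\<bar> + 1) * b1 ^ L / (\<alpha> * c)"
  have A: "0 < A" using b1_facts a_pos c by (auto simp: A_def intro!: divide_pos_pos mult_pos_pos)
  have "\<forall>\<^sub>F n in sequentially. ?\<theta> - \<epsilon> / 4 < Pr (\<lambda>\<omega>. A * (b1 / N) ^ n \<le> real (card (C0 n \<omega>)))"
    using assms(4) by (intro origin_large A) simp
  \<comment> \<open>The condition on \<open>?R ^ n\<close> is \<open>t0 * M \<le> s0\<close> solved
    for the power.\<close>
  with ev_large eventually_power_ge[OF R, of "A * M / c"]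
  have "\<forall>\<^sub>F n in sequentially. 1 - \<delta> < Pr (large_cluster (B0 n) (c * real (N ^ n))) \<and>
      A * M / c \<le> ?R ^ n \<and> ?\<theta> - \<epsilon> / 4 < Pr (\<lambda>\<omega>. A * (b1 / N) ^ n \<le> real (card (C0 n \<omega>)))"
    by eventually_elim blast
  then obtain n where n: "1 - \<delta> < Pr (large_cluster (B0 n) (c * real (N ^ n)))" "A * M / c \<le> ?R ^ n"
    "?\<theta> - \<epsilon> / 4 < Pr (\<lambda>\<omega>. A * (b1 / N) ^ n \<le> real (card (C0 n \<omega>)))"
    by (auto simp: eventually_sequentially)
  \<comment> \<open>Both thresholds are frozen at their values for
    \<open>(\<alpha>, \<beta>)\<close>; only the probabilities and \<open>max 1 (snd x)\<close> vary
    below.\<close>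
  define t0 where "t0 = A * (b1 / N) ^ n"
  define s0 where "s0 = c * real (N ^ n)"
  have t0: "0 < t0" using A b1_facts N0 by (simp add: t0_def)
  have ts: "t0 * M \<le> s0"
  proof -
    have "A * M \<le> c * ?R ^ n" using n(2) c by (simp add: field_simps)
    then have "(b1 / N) ^ n * (A * M) \<le> (b1 / N) ^ n * (c * ?R ^ n)"
      using b1_facts N0 by (intro mult_left_mono) auto
    also have "\<dots> = c * ((b1 / N) * ?R) ^ n" by (simp only: power_mult_distrib mult.left_commute)
    also have "(b1 / N) * ?R = N" using b1_facts N0 by (simp add: power2_eq_square)
    finally show ?thesis by (simp add: t0_def s0_def mult_ac)
  qed
  have e0: "4 * M\<^sup>2 * exp (- \<alpha> * (t0 * s0) / b1 ^ (n + L)) < \<delta>"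
  proof -
    have "t0 * s0 = A * c * b1 ^ n" using N0 by (simp add: t0_def s0_def power_divide)
    then have "\<alpha> * (t0 * s0) / b1 ^ (n + L) = \<alpha> * A * c / b1 ^ L"
      using b1_facts by (simp add: power_add)
    also have "\<dots> = \<bar>ln (\<delta> / (4 * M\<^sup>2))\<bar> + 1" using a_pos c b1_facts by (simp add: A_def)
    finally have "exp (- (\<alpha> * (t0 * s0) / b1 ^ (n + L))) < exp (ln (\<delta> / (4 * M\<^sup>2)))" by simp
    then have "exp (- (\<alpha> * (t0 * s0) / b1 ^ (n + L))) < \<delta> / (4 * M\<^sup>2)" using \<delta>(1) M3 by simp
    then show ?thesis using M3 by (simp add: field_simps)
  qed
  let ?x = "(\<alpha>, \<beta>)"
  have "\<forall>\<^sub>F x in nhds ?x. 0 < fst x" "\<forall>\<^sub>F x in nhds ?x. 0 < snd x"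
    using a_pos b_pos by (auto intro!: eventually_greater_of_isCont continuous_intros)
  moreover have "\<forall>\<^sub>F x in nhds ?x. 2 * (max 1 (snd x)) ^ L < (M - 1)\<^sup>2"
    using rho by (intro eventually_less_of_isCont continuous_intros) auto
  moreover have "\<forall>\<^sub>F x in nhds ?x. 4 * M\<^sup>2 * exp (- fst x * (t0 * s0) / (max 1 (snd x)) ^ (n + L)) < \<delta>"
    using e0 b1_facts by (intro eventually_less_of_isCont continuous_intros) auto
  moreover have "\<forall>\<^sub>F x in nhds ?x. 1 - \<delta> < pr N (fst x) (snd x) (large_cluster (B0 n) s0)"
    using eventually_greater_of_isCont[OF isCont_pr[OF assms(1-3) edges_hball[OF zero_V]
          determined_by_large_cluster[of "B0 n" s0]], of "1 - \<delta>"] n(1)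
    by (simp add: s0_def case_prod_beta)
  moreover have "\<forall>\<^sub>F x in nhds ?x. ?\<theta> - \<epsilon> / 4 < pr N (fst x) (snd x) (\<lambda>\<omega>. t0 \<le> real (card (C0 n \<omega>)))"
    using eventually_greater_of_isCont[OF isCont_pr[OF assms(1-3) edges_hball[OF zero_V]
          determined_by_comp[OF determined_by_C0, where h = "\<lambda>C. t0 \<le> real (card C)"]], of "?\<theta> - \<epsilon> / 4" n] n(3)
    by (simp add: t0_def case_prod_beta)
  ultimately show ?thesis
  proof eventually_elim
    case (elim x)
    interpret x: percolation_model N "fst x" "snd x" using assms(1) elim(1,2) by unfold_locales
    have "?\<theta> - \<epsilon> / 4 - 3 * \<delta> \<le> percolation_prob N (fst x) (snd x)"
      using elim L(1) NL t0 ts \<delta> unfolding M_def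
      by (intro x.percolation_prob_ge[of L t0 s0 \<delta> n]) auto
    then show ?case using \<delta>(2) by linarith
  qed
qed

lemma percolation_prob_upper_semicontinuous:
  assumes "2 \<le> N" "0 < \<alpha>" "0 < \<beta>" "0 < \<epsilon>"
  shows "\<forall>\<^sub>F x in nhds (\<alpha>, \<beta>). percolation_prob N (fst x) (snd x) < percolation_prob N \<alpha> \<beta> + \<epsilon>"
proof -
  interpret percolation_model N \<alpha> \<beta> using assms by unfold_locales
  let ?\<theta> = "percolation_prob N \<alpha> \<beta>"
  let ?x = "(\<alpha>, \<beta>)"
  show ?thesis
  proof (cases "N < \<beta>")
    case False
    then have one: "?\<theta> = 1" by (intro percolation_prob_eq_1) simp
    have le: "percolation_prob N c d \<le> 1" if "0 < c" "0 < d" for c d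
    proof -
      interpret x: percolation_model N c d using assms(1) that by unfold_locales
      show ?thesis by (simp add: percolation_prob_def)
    qed
    have "\<forall>\<^sub>F x in nhds ?x. 0 < fst x" "\<forall>\<^sub>F x in nhds ?x. 0 < snd x"
      using a_pos b_pos by (auto intro!: eventually_greater_of_isCont continuous_intros)
    then show ?thesis
    proof eventually_elim
      case (elim x)
      then show ?case using le[of "fst x" "snd x"] one assms(4) by linarith
    qed
  next
    case True
    have N0: "0 < real N" using assms(1) by simp
    have "1 - ?\<theta> - \<epsilon> < 1 - ?\<theta>" using assms(4) by simp
    then have "\<forall>\<^sub>F m in sequentially. 1 - ?\<theta> - \<epsilon> < Pr (confined m)"
      by (rule order_tendstoD(1)[OF pr_confined_tendsto])
    then obtain m where m: "1 - ?\<theta> - \<epsilon> < Pr (confined m)" by (auto simp: eventually_sequentially)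
    \<comment> \<open>A lower bound for the probability of \<open>confined n\<close> at all
      parameters with \<open>0 < c\<close> and \<open>N < d\<close>, continuous there. The exit
      exponent carries the fixed size \<open>N ^ m\<close>, not the volume of the ball of radius
      \<open>n\<close>, and therefore vanishes as \<open>n\<close> grows.\<close>
    define g where "g n c d = pr N c d (\<lambda>\<omega>. C0 n \<omega> \<subseteq> B0 m) *
        exp (- c * real (N ^ m) * ((N / d) ^ Suc n / (1 - N / d)))" for n c d
    have "(\<lambda>n. (N / \<beta>) ^ Suc n) \<longlonglongrightarrow> 0"
      by (intro LIMSEQ_Suc LIMSEQ_power_zero) (use True b_pos in auto)
    then have "(\<lambda>n. g n \<alpha> \<beta>) \<longlonglongrightarrow> Pr (confined m) * exp (- \<alpha> * real (N ^ m) * (0 / (1 - N / \<beta>)))"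
      unfolding g_def using True b_pos by (intro tendsto_intros C0_tendsto_confined) auto
    then have "(\<lambda>n. g n \<alpha> \<beta>) \<longlonglongrightarrow> Pr (confined m)" by simp
    then have "\<forall>\<^sub>F n in sequentially. 1 - ?\<theta> - \<epsilon> < g n \<alpha> \<beta>" using m by (rule order_tendstoD(1))
    then obtain n where n: "1 - ?\<theta> - \<epsilon> < g n \<alpha> \<beta>" by (auto simp: eventually_sequentially)
    have "isCont (\<lambda>x. pr N (fst x) (snd x) (\<lambda>\<omega>. C0 n \<omega> \<subseteq> B0 m)) ?x"
      using isCont_pr[OF assms(1-3) edges_hball[OF zero_V]
          determined_by_comp[OF determined_by_C0[of n], where h = "\<lambda>C. C \<subseteq> B0 m"]]
      by (simp only: case_prod_unfold)
    then have "isCont (\<lambda>x. g n (fst x) (snd x)) ?x"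
      unfolding g_def using True b_pos by (intro continuous_intros) auto
    then have "\<forall>\<^sub>F x in nhds ?x. 1 - ?\<theta> - \<epsilon> < g n (fst x) (snd x)"
      by (rule eventually_greater_of_isCont) (use n in simp)
    moreover have "\<forall>\<^sub>F x in nhds ?x. 0 < fst x" "\<forall>\<^sub>F x in nhds ?x. N < snd x"
      using a_pos True by (auto intro!: eventually_greater_of_isCont continuous_intros)
    ultimately show ?thesis
    proof eventually_elim
      case (elim x)
      interpret x: percolation_model N "fst x" "snd x" using assms(1) elim(2,3) N0 by unfold_locales auto
      have card_le: "real (card C) \<le> real (N ^ m)" if "C \<in> Pow (B0 m)" for C
        using card_mono[OF finite_hball[OF zero_V], of C m] that by (simp only: card_hball[OF zero_V] of_nat_le_iff Pow_iff)
      have "g n (fst x) (snd x) \<le> x.Pr (\<lambda>\<omega>. C0 n \<omega> \<in> Pow (B0 m) \<and> x.confined n \<omega>)"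
        using x.pr_cluster_stays_ge[where \<C> = "Pow (B0 m)" and n = n, OF elim(3) card_le of_nat_0_le_iff]
        by (simp add: g_def)
      also have "\<dots> \<le> x.Pr (x.confined n)" by (rule x.pr_mono_sets[OF x.confined_sets]) simp
      also have "\<dots> \<le> 1 - percolation_prob N (fst x) (snd x)" by (rule x.pr_confined_le)
      finally show ?case using elim(1) by linarith
    qed
  qed
qed

theorem theorem3:
  fixes N :: nat and \<alpha> \<beta> :: real
  assumes "N \<ge> 2" and "\<alpha> > 0" and "\<beta> > 0"
  shows "isCont (\<lambda>(a, b). percolation_prob N a b) (\<alpha>, \<beta>)"
proof -
  have "((\<lambda>x. percolation_prob N (fst x) (snd x)) \<longlongrightarrow> percolation_prob N \<alpha> \<beta>) (nhds (\<alpha>, \<beta>))"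
  proof (rule order_tendstoI)
    fix c assume c: "c < percolation_prob N \<alpha> \<beta>"
    \<comment> \<open>Half the gap, because lower semicontinuity is proved with a weak
      inequality.\<close>
    define \<epsilon> where "\<epsilon> = (percolation_prob N \<alpha> \<beta> - c) / 2"
    have "0 < \<epsilon>" using c by (simp add: \<epsilon>_def)
    from percolation_prob_lower_semicontinuous[OF assms this]
    show "\<forall>\<^sub>F x in nhds (\<alpha>, \<beta>). c < percolation_prob N (fst x) (snd x)"
      by eventually_elim (use c in \<open>simp add: \<epsilon>_def field_simps\<close>)
  next
    fix c assume c: "percolation_prob N \<alpha> \<beta> < c"
    then show "\<forall>\<^sub>F x in nhds (\<alpha>, \<beta>). percolation_prob N (fst x) (snd x) < c"
      using percolation_prob_upper_semicontinuous[OF assms, of "c - percolation_prob N \<alpha> \<beta>"] by simp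
  qed
  then show ?thesis
    unfolding isCont_def case_prod_unfold
    using tendsto_at_iff_tendsto_nhds[of "\<lambda>x. percolation_prob N (fst x) (snd x)" "(\<alpha>, \<beta>)"]
    by (simp only: fst_conv snd_conv)
qed

end
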